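(* Let $d=1$, fix $m\in\mathbb N^{+}$, a period $X>0$ and $V_+>0$, and let $\mathcal A=\mathcal A(X,V_+)$. Any maximizer of $G_m[V]$ over $\mathcal A$ is piecewise constant and takes only the values $0$ and $V_+$ almost everywhere. Furthermore, any local maximizer $\tilde V\in\mathcal A$ of $G_m$ with nonzero gap ($\alpha\neq\beta$) satisfies, with $(\alpha,\psi_\alpha)$ and $(\beta,\psi_\beta)$ the eigenpairs of $\tilde V$ at the left and right edges of the $m$-th gap, for almost every $x$: $$\tilde V(x)=\begin{cases}V_+ & \text{if } \psi_\alpha^2(x)/\alpha<\psi_\beta^2(x)/\beta,\\ 0 & \text{if }\psi_\alpha^2(x)/\alpha>\psi_\beta^2(x)/\beta.\end{cases}$$
   Context: $\mathcal A(X,V_+)$ is the set of real-valued $V\in L^\infty(\mathbb R)$ that are $X$-periodic with $V(x)\in[0,V_+]$ for a.e. $x$. For $V\in\mathcal A$ and $k\in[-\pi/X,\pi/X]$, $E_1(k)\le E_2(k)\le\cdots$ are the eigenvalues (with multiplicity) of $H_V(k)=-(\partial_x+ik)^2+V$ on $X$-periodic functions. The edges of the $m$-th gap are $\alpha=\alpha_m=\max_kE_m(k)$ and $\beta=\beta_m=\min_kE_{m+1}(k)$, and $G_m[V]=\frac{\beta_m-\alpha_m}{(\alpha_m+\beta_m)/2}$. When $\beta>\alpha$, $\alpha$ and $\beta$ are simple eigenvalues of $-\psi''+V\psi=E\psi$ with periodic ($m$ even: $\psi(x+X)=\psi(x)$) or anti-periodic ($m$ odd: $\psi(x+X)=-\psi(x)$)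 boundary conditions; $\psi_\alpha,\psi_\beta$ denote the corresponding real-valued eigenfunctions, normalized by $\int_0^X\psi^2\,dx=1$. Local maximizer is understood with respect to the $L^\infty$ norm on $\mathcal A$. *)

theory Defs
  imports
    "HOL-Analysis.Analysis"
    "HOL-Probability.Essential_Supremum"
    "HOL-Library.Function_Algebras"
begin

text \<open>
  Elements of \<open>L\<^sup>\<infinity>(\<real>)\<close> are represented by Lebesgue measurable functions; every notion below is
  invariant under changing a potential on a null set.
\<close>

definition admissible :: "real \<Rightarrow> real \<Rightarrow> (real \<Rightarrow> real) set" where
  "admissible X Vp =
     {V. V \<in> borel_measurable lebesgue
       \<and> (AE x in lebesgue. V (x + X) = V x)
       \<and> (AE x in lebesgue. 0 \<le> V x \<and> V x \<le> Vp)}"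

definition Linf_dist :: "(real \<Rightarrow> real) \<Rightarrow> (real \<Rightarrow> real) \<Rightarrow> ereal" where
  "Linf_dist V W = esssup lebesgue (\<lambda>x. ereal \<bar>V x - W x\<bar>)"

text \<open>
  \<open>H2_loc u u1 u2\<close>: the (continuous representative) \<open>u\<close> is in \<open>H\<^sup>2\<^sub>l\<^sub>o\<^sub>c(\<real>)\<close> with weak derivatives
  \<open>u1 = u'\<close> and \<open>u2 = u''\<close>, that is, \<open>u\<close> is continuously differentiable and \<open>u1\<close> is an indefinite
  integral of the locally square integrable function \<open>u2\<close>.
\<close>
definition H2_loc ::
  "(real \<Rightarrow> 'a::euclidean_space) \<Rightarrow> (real \<Rightarrow> 'a) \<Rightarrow> (real \<Rightarrow> 'a) \<Rightarrow> bool" where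
  "H2_loc u u1 u2 \<longleftrightarrow>
     (\<forall>x. (u has_vector_derivative u1 x) (at x))
   \<and> u2 \<in> borel_measurable lebesgue
   \<and> (\<forall>a b. a \<le> b \<longrightarrow>
        (\<lambda>x. (norm (u2 x))\<^sup>2) integrable_on {a..b}
      \<and> (u2 has_integral (u1 b - u1 a)) {a..b})"

text \<open>
  The eigenspace \<open>ker (H\<^sub>V(k) - E)\<close> of \<open>H\<^sub>V(k) = -(\<partial>\<^sub>x + ik)\<^sup>2 + V\<close> on \<open>X\<close>-periodic functions,
  with domain the \<open>X\<close>-periodic \<open>H\<^sup>2\<^sub>l\<^sub>o\<^sub>c\<close> functions and
  \<open>(\<partial>\<^sub>x + ik)\<^sup>2 u = u'' + 2ik u' + (ik)\<^sup>2 u\<close>.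
\<close>
definition bloch_eigenspace ::
  "real \<Rightarrow> (real \<Rightarrow> real) \<Rightarrow> real \<Rightarrow> real \<Rightarrow> (real \<Rightarrow> complex) set" where
  "bloch_eigenspace X V k E =
     {u. (\<forall>x. u (x + X) = u x)
       \<and> (\<exists>u1 u2. H2_loc u u1 u2
           \<and> (AE x in lebesgue.
                - (u2 x + 2 * (\<i> * complex_of_real k) * u1 x
                     + (\<i> * complex_of_real k)\<^sup>2 * u x)
                + complex_of_real (V x) * u x = complex_of_real E * u x))}"

interpretation cfun: vector_space "\<lambda>(c::complex) (f::real \<Rightarrow> complex) x. c * f x"
  by unfold_locales (auto simp: fun_eq_iff algebra_simps)

text \<open>
  \<open>H\<^sub>V(k)\<close> is self-adjoint, so its eigenvalues are real and their multiplicity is the complex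
  dimension of the eigenspace. An enumeration \<open>e 1 \<le> e 2 \<le> \<dots>\<close> repeats every eigenvalue according
  to its multiplicity; the value \<open>e 0\<close> is irrelevant.
\<close>
definition eigenvalue_enumeration ::
  "real \<Rightarrow> (real \<Rightarrow> real) \<Rightarrow> real \<Rightarrow> (nat \<Rightarrow> real) \<Rightarrow> bool" where
  "eigenvalue_enumeration X V k e \<longleftrightarrow>
     mono_on {1..} e
   \<and> (\<forall>E. finite {n \<in> {1..}. e n = E}
        \<and> card {n \<in> {1..}. e n = E} = cfun.dim (bloch_eigenspace X V k E))"

definition band :: "real \<Rightarrow> (real \<Rightarrow> real) \<Rightarrow> nat \<Rightarrow> real \<Rightarrow> real" where
  "band X V n k = (THE E. \<exists>e. eigenvalue_enumeration X V k e \<and> E = e n)"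

definition gap_left :: "real \<Rightarrow> nat \<Rightarrow> (real \<Rightarrow> real) \<Rightarrow> real" where
  "gap_left X m V = (SUP k \<in> {- pi / X .. pi / X}. band X V m k)"

definition gap_right :: "real \<Rightarrow> nat \<Rightarrow> (real \<Rightarrow> real) \<Rightarrow> real" where
  "gap_right X m V = (INF k \<in> {- pi / X .. pi / X}. band X V (m + 1) k)"

definition gap_ratio :: "real \<Rightarrow> nat \<Rightarrow> (real \<Rightarrow> real) \<Rightarrow> real" where
  "gap_ratio X m V =
     (gap_right X m V - gap_left X m V) / ((gap_left X m V + gap_right X m V) / 2)"

definition is_maximizer :: "real \<Rightarrow> real \<Rightarrow> nat \<Rightarrow> (real \<Rightarrow> real) \<Rightarrow> bool" where
  "is_maximizer X Vp m V \<longleftrightarrow>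
     V \<in> admissible X Vp \<and> (\<forall>W \<in> admissible X Vp. gap_ratio X m W \<le> gap_ratio X m V)"

definition is_local_maximizer :: "real \<Rightarrow> real \<Rightarrow> nat \<Rightarrow> (real \<Rightarrow> real) \<Rightarrow> bool" where
  "is_local_maximizer X Vp m V \<longleftrightarrow>
     V \<in> admissible X Vp
   \<and> (\<exists>\<epsilon>>0. \<forall>W \<in> admissible X Vp.
        Linf_dist W V < ereal \<epsilon> \<longrightarrow> gap_ratio X m W \<le> gap_ratio X m V)"

text \<open>
  Normalized real eigenfunctions of \<open>-\<psi>'' + V\<psi> = E\<psi>\<close>, periodic for even \<open>m\<close> and anti-periodic
  for odd \<open>m\<close>.
\<close>
definition edge_eigenfunction ::
  "real \<Rightarrow> nat \<Rightarrow> (real \<Rightarrow> real) \<Rightarrow> real \<Rightarrow> (real \<Rightarrow> real) \<Rightarrow> bool" where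
  "edge_eigenfunction X m V E \<psi> \<longleftrightarrow>
     (\<forall>x. \<psi> (x + X) = (if even m then \<psi> x else - \<psi> x))
   \<and> (\<exists>\<psi>1 \<psi>2. H2_loc \<psi> \<psi>1 \<psi>2
        \<and> (AE x in lebesgue. - \<psi>2 x + V x * \<psi> x = E * \<psi> x))
   \<and> ((\<lambda>x. (\<psi> x)\<^sup>2) has_integral 1) {0..X}"

text \<open>
  Piecewise constant as an element of \<open>L\<^sup>\<infinity>(\<real>)\<close>: there is a set \<open>D\<close> of breakpoints, finitely many
  in every bounded interval, such that \<open>V\<close> is a.e. constant on each interval free of breakpoints.
\<close>
definition piecewise_constant :: "(real \<Rightarrow> real) \<Rightarrow> bool" where
  "piecewise_constant V \<longleftrightarrow>
     (\<exists>D. (\<forall>a b. finite (D \<inter> {a..b}))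
        \<and> (\<forall>a b. D \<inter> {a<..<b} = {} \<longrightarrow>
             (\<exists>c. AE x in lebesgue. x \<in> {a<..<b} \<longrightarrow> V x = c)))"

end

theory Submission
  imports Defs "HOL-Probability.Sinc_Integral"
begin

text \<open>
  Everything is read off from the Pruefer angle \<open>\<theta>' = cos\<^sup>2 \<theta> + (E - V) sin\<^sup>2 \<theta>\<close> of real solutions. The amounts
  \<open>\<theta>(X) - \<theta>(0)\<close> by which angles advance over a period vary by less than \<open>\<pi>\<close> with the initial angle, and
  their maximum and minimum are continuous and strictly increasing in \<open>E\<close>; the maximum equals
  \<open>m \<pi>\<close> exactly at the left edge of the \<open>m\<close>-th gap, the minimum exactly at the right edge. Between two
  gaps the discriminant is strictly monotone, so every quasimomentum has one energy in each band.

  An edge eigenfunction attains the extremal advance, hence changing \<open>V\<close> to \<open>V + t W\<close> gives the one-sided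
  bounds \<open>\<alpha> + t \<integral> W \<psi>\<alpha>\<^sup>2 + o(t)\<close> from above on the left edge and \<open>\<beta> + t \<integral> W \<psi>\<beta>\<^sup>2 - o(t)\<close> from below on the right
  edge. The gap ratio increases with \<open>\<beta> / \<alpha>\<close>, so it can be improved to first order unless \<open>V\<close> is extremal
  wherever \<open>\<psi>\<alpha>\<^sup>2 / \<alpha> \<noteq> \<psi>\<beta>\<^sup>2 / \<beta>\<close>. If a maximizer had a closed gap, this would apply to any two
  solutions and also with their roles exchanged, which is contradictory. For an open gap the zeros of
  \<open>\<psi>\<alpha> / \<surd>\<alpha> \<plusminus> \<psi>\<beta> / \<surd>\<beta>\<close> are isolated.
\<close>

section \<open>Primitives of locally bounded measurable functions\<close>

text \<open>A potential is only measurable, so derivatives hold in integrated form: the calculus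
  runs on pairs of a locally bounded function and an indefinite integral of it. Spectral theory of
  the Bloch operators is replaced by counting. Eigenspaces are computed from the monodromy matrix,
  and for each quasimomentum an explicit sequence of energies, one per band, is shown to hit every
  value as often as the dimension demands. The advance of the angle supplies what the discriminant
  alone cannot: the index of a band.

  Eigenvalues are never differentiated in the potential. At a closed gap the edge is a double
  eigenvalue, and the two edges need not depend differentiably on the potential. But an upper bound
  on the left edge needs only one initial angle that advances by at least m pi, and a lower bound on
  the right edge only one that advances by at most m pi. The angle of the unperturbed eigenfunction
  serves as trial object, so open and closed gaps are treated alike. The weights 1/\<alpha> and
  1/\<beta> are those of the formal first variation of log \<beta> - log \<alpha>.\<close>

definition loc_bdd :: "(real \<Rightarrow> 'a::euclidean_space) \<Rightarrow> bool" where
  "loc_bdd f \<longleftrightarrow> f \<in> borel_measurable lebesgue \<and> (\<forall>a b. bounded (f ` {a..b}))"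

text \<open>The Caratheodory form of F' = f. Since \<open>f\<close> may be any locally bounded
  measurable function, \<open>F\<close> is locally Lipschitz, but no derivative at a prescribed
  point is available.\<close>

definition primitive :: "(real \<Rightarrow> 'a::euclidean_space) \<Rightarrow> (real \<Rightarrow> 'a) \<Rightarrow> bool" where
  "primitive F f \<longleftrightarrow> loc_bdd f \<and> (\<forall>a b. a \<le> b \<longrightarrow> (f has_integral F b - F a) {a..b})"

lemma loc_bddI:
  assumes "f \<in> borel_measurable lebesgue" "\<And>x. norm (f x) \<le> B"
  shows "loc_bdd f"
  unfolding loc_bdd_def bounded_iff using assms by blast

lemma loc_bdd_bound:
  assumes "loc_bdd f"
  obtains B where "B > 0" "\<And>x. x \<in> {a..b} \<Longrightarrow> norm (f x) \<le> B"
proof -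
  have "bounded (f ` {a..b})" using assms by (simp add: loc_bdd_def)
  then obtain B where "B > 0" "\<forall>y\<in>f ` {a..b}. norm y \<le> B" unfolding bounded_pos by blast
  then show thesis using that by blast
qed

lemma loc_bdd_integrable:
  assumes "loc_bdd f"
  shows "f integrable_on {a..b}"
proof -
  obtain B where B: "\<And>x. x \<in> {a..b} \<Longrightarrow> norm (f x) \<le> B"
    using loc_bdd_bound[OF assms] by blast
  show ?thesis
  proof (rule measurable_bounded_by_integrable_imp_integrable)
    show "f \<in> borel_measurable (lebesgue_on {a..b})"
      using assms unfolding loc_bdd_def
      by (metis measurable_restrict_space1)
    show "(\<lambda>x. B) integrable_on {a..b}" by (rule integrable_const_ivl)
  qed (use B in auto)
qed

lemma loc_bdd_continuous:
  assumes "continuous_on UNIV f"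
  shows "loc_bdd f"
proof -
  have "f \<in> borel_measurable lebesgue"
    using borel_measurable_continuous_onI[OF assms]
    by (intro measurable_completion) (simp add: measurable_lborel1)
  moreover have "bounded (f ` {a..b})" for a b
    by (metis assms compact_Icc compact_continuous_image compact_imp_bounded continuous_on_subset top_greatest)
  ultimately show ?thesis by (auto simp: loc_bdd_def)
qed

lemma loc_bdd_bilinear:
  fixes f :: "real \<Rightarrow> 'a::euclidean_space" and g :: "real \<Rightarrow> 'b::euclidean_space"
    and prod :: "'a \<Rightarrow> 'b \<Rightarrow> 'c::euclidean_space"
  assumes "bounded_bilinear prod" "loc_bdd f" "loc_bdd g"
  shows "loc_bdd (\<lambda>x. prod (f x) (g x))"
proof -
  obtain K where K: "0 < K" "\<And>a b. norm (prod a b) \<le> norm a * norm b * K"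
    using bounded_bilinear.pos_bounded[OF assms(1)] by blast
  have "continuous_on UNIV (\<lambda>p. prod (fst p) (snd p))"
    by (intro bounded_bilinear.continuous_on[OF assms(1)] continuous_intros)
  then have "(\<lambda>x. prod (fst (f x, g x)) (snd (f x, g x))) \<in> borel_measurable lebesgue"
    using assms(2,3) unfolding loc_bdd_def
    by (intro borel_measurable_continuous_on[where f="\<lambda>p. prod (fst p) (snd p)"]) auto
  moreover have "bounded ((\<lambda>x. prod (f x) (g x)) ` {a..b})" for a b
  proof -
    obtain B1 where B1: "B1 > 0" "\<And>x. x \<in> {a..b} \<Longrightarrow> norm (f x) \<le> B1"
      using loc_bdd_bound[OF assms(2)] by blast
    obtain B2 where B2: "B2 > 0" "\<And>x. x \<in> {a..b} \<Longrightarrow> norm (g x) \<le> B2"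
      using loc_bdd_bound[OF assms(3)] by blast
    have "norm (prod (f x) (g x)) \<le> B1 * B2 * K" if "x \<in> {a..b}" for x
    proof -
      have "norm (prod (f x) (g x)) \<le> norm (f x) * norm (g x) * K" by (rule K)
      also have "\<dots> \<le> B1 * B2 * K"
        using B1 B2 K that by (intro mult_right_mono mult_mono) auto
      finally show ?thesis .
    qed
    then show ?thesis unfolding bounded_iff by blast
  qed
  ultimately show ?thesis by (simp add: loc_bdd_def)
qed

lemma loc_bdd_mult: "loc_bdd f \<Longrightarrow> loc_bdd g \<Longrightarrow> loc_bdd (\<lambda>x. f x * g x :: 'a::{euclidean_space,real_normed_algebra})"
  by (rule loc_bdd_bilinear[OF bounded_bilinear_mult])

lemma loc_bdd_scaleR: "loc_bdd f \<Longrightarrow> loc_bdd g \<Longrightarrow> loc_bdd (\<lambda>x. f x *\<^sub>R g x)"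
  by (rule loc_bdd_bilinear[OF bounded_bilinear_scaleR])

lemma loc_bdd_const [simp]: "loc_bdd (\<lambda>x. c)"
  by (rule loc_bddI[where B="norm c"]) auto

lemma loc_bdd_add: "loc_bdd f \<Longrightarrow> loc_bdd g \<Longrightarrow> loc_bdd (\<lambda>x. f x + g x)"
  unfolding loc_bdd_def by (auto intro!: bounded_plus_comp)

lemma loc_bdd_diff: "loc_bdd f \<Longrightarrow> loc_bdd g \<Longrightarrow> loc_bdd (\<lambda>x. f x - g x)"
  unfolding loc_bdd_def by (auto intro!: bounded_minus_comp)

lemma loc_bdd_minus: "loc_bdd f \<Longrightarrow> loc_bdd (\<lambda>x. - f x)"
  using loc_bdd_diff[of "\<lambda>x. 0" f] by simp

lemma loc_bdd_of_real: "loc_bdd f \<Longrightarrow> loc_bdd (\<lambda>x. complex_of_real (f x))"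
  using loc_bdd_scaleR[of f "\<lambda>x. 1::complex"] by (simp add: scaleR_conv_of_real)

lemmas loc_bdd_intros = loc_bdd_mult loc_bdd_scaleR loc_bdd_const loc_bdd_add loc_bdd_diff loc_bdd_minus loc_bdd_of_real

lemma primitive_loc_bdd: "primitive F f \<Longrightarrow> loc_bdd f"
  by (simp add: primitive_def)

lemma primitive_has_integral: "primitive F f \<Longrightarrow> a \<le> b \<Longrightarrow> (f has_integral F b - F a) {a..b}"
  by (simp add: primitive_def)

lemma primitive_integral: "primitive F f \<Longrightarrow> a \<le> b \<Longrightarrow> integral {a..b} f = F b - F a"
  by (simp add: primitive_def integral_unique)

lemma primitive_norm_diff_le:
  assumes "primitive F f" "a \<le> b" "\<And>x. x \<in> {a..b} \<Longrightarrow> norm (f x) \<le> B"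
  shows "norm (F b - F a) \<le> B * (b - a)"
proof -
  have "0 \<le> B" using order_trans[OF norm_ge_zero assms(3)[of a]] assms(2) by simp
  then show ?thesis
    using has_integral_bound[of B f "F b - F a" a b] primitive_has_integral[OF assms(1,2)] assms
    by auto
qed

lemma primitive_mono:
  fixes F :: "real \<Rightarrow> real"
  assumes "primitive F f" "a \<le> b" "\<And>x. x \<in> {a..b} \<Longrightarrow> 0 \<le> f x"
  shows "F a \<le> F b"
  using has_integral_nonneg[OF primitive_has_integral[OF assms(1,2)]] assms(3) by auto

lemma primitive_le:
  fixes F G :: "real \<Rightarrow> real"
  assumes "primitive F f" "primitive G g" "a \<le> b" "\<And>x. x \<in> {a..b} \<Longrightarrow> f x \<le> g x"
  shows "F b - F a \<le> G b - G a"
  using has_integral_le[OF primitive_has_integral[OF assms(1,3)] primitive_has_integral[OF assms(2,3)]]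
    assms(4) by auto

lemma primitive_lipschitz:
  assumes "primitive F f"
  obtains B where "B > 0" "\<And>s t. s \<in> {a..b} \<Longrightarrow> t \<in> {a..b} \<Longrightarrow> norm (F t - F s) \<le> B * \<bar>t - s\<bar>"
proof -
  obtain B where B: "B > 0" "\<And>x. x \<in> {a..b} \<Longrightarrow> norm (f x) \<le> B"
    using loc_bdd_bound[OF primitive_loc_bdd[OF assms]] by blast
  have "norm (F t - F s) \<le> B * \<bar>t - s\<bar>" if "s \<in> {a..b}" "t \<in> {a..b}" for s t
  proof (cases "s \<le> t")
    case True
    then show ?thesis using primitive_norm_diff_le[OF assms True, of B] B that by auto
  next
    case False
    then show ?thesis using primitive_norm_diff_le[OF assms, of t s B] B that
      by (auto simp: norm_minus_commute)
  qed
  then show thesis using that B by blast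
qed

lemma primitive_continuous:
  assumes "primitive F f"
  shows "continuous_on S F"
proof -
  have "isCont F x" for x
  proof -
    obtain B where B: "B > 0" "\<And>s t. s \<in> {x-1..x+1} \<Longrightarrow> t \<in> {x-1..x+1} \<Longrightarrow> norm (F t - F s) \<le> B * \<bar>t - s\<bar>"
      using primitive_lipschitz[OF assms] by blast
    have "(F \<longlongrightarrow> F x) (at x)"
    proof (rule LIM_I)
      fix r :: real assume "0 < r"
      show "\<exists>s>0. \<forall>y. y \<noteq> x \<and> norm (y - x) < s \<longrightarrow> norm (F y - F x) < r"
      proof (intro exI conjI allI impI)
        show "min 1 (r/B) > 0" using \<open>0 < r\<close> B by auto
        fix y assume y: "y \<noteq> x \<and> norm (y - x) < min 1 (r/B)"
        then have "norm (F y - F x) \<le> B * \<bar>y - x\<bar>" by (intro B) auto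
        also have "\<dots> < B * (r / B)" using y B by (intro mult_strict_left_mono) auto
        finally show "norm (F y - F x) < r" using B by auto
      qed
    qed
    then show ?thesis by (simp add: isCont_def)
  qed
  then show ?thesis by (simp add: continuous_at_imp_continuous_on)
qed

text \<open>Primitives are only differentiable almost everywhere; this criterion replaces
  pointwise derivatives in the rules below.\<close>

lemma constant_if_little_o:
  fixes D :: "real \<Rightarrow> 'a::real_normed_vector"
  assumes "\<And>u e. e > 0 \<Longrightarrow> \<exists>d>0. \<forall>s t. u - d \<le> s \<and> s \<le> t \<and> t \<le> u + d \<longrightarrow> norm (D t - D s) \<le> e * (t - s)"
  shows "D x = D y"
proof -
  have "(D has_vector_derivative 0) (at u within UNIV)" for u
    unfolding has_vector_derivative_def has_derivative_within_alt
  proof (intro conjI allI impI)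
    show "bounded_linear (\<lambda>x. x *\<^sub>R (0::'a))" by simp
    fix e :: real assume "0 < e"
    then obtain d where d: "d > 0" "\<And>s t. u - d \<le> s \<Longrightarrow> s \<le> t \<Longrightarrow> t \<le> u + d \<Longrightarrow> norm (D t - D s) \<le> e * (t - s)"
      using assms[of e u] by blast
    have "norm (D y - D u - (y - u) *\<^sub>R 0) \<le> e * norm (y - u)" if "norm (y - u) < d" for y
      using d(1) d(2)[of u y] d(2)[of y u] that by (cases "u \<le> y") (auto simp: norm_minus_commute)
    then show "\<exists>d>0. \<forall>y\<in>UNIV. norm (y - u) < d \<longrightarrow> norm (D y - D u - (y - u) *\<^sub>R 0) \<le> e * norm (y - u)"
      using d(1) by blast
  qed
  then show ?thesis
    using has_vector_derivative_zero_constant[of UNIV D] by (metis UNIV_I convex_UNIV)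
qed

lemma loc_bdd_has_primitive:
  assumes "loc_bdd f"
  obtains F where "primitive F f" "F c = z"
proof -
  define F where "F x = z + (if c \<le> x then integral {c..x} f else - integral {x..c} f)" for x
  have "(f has_integral F b - F a) {a..b}" if "a \<le> b" for a b
  proof -
    have I: "f integrable_on {u..v}" for u v by (rule loc_bdd_integrable[OF assms])
    note C = Henstock_Kurzweil_Integration.integral_combine[OF _ _ I]
    have "integral {a..b} f = F b - F a"
    proof (cases "c \<le> a")
      case True
      then show ?thesis using C[of c a b] that by (simp add: F_def algebra_simps)
    next
      case ca: False
      show ?thesis
      proof (cases "c \<le> b")
        case True
        then show ?thesis using C[of a c b] ca by (simp add: F_def algebra_simps)
      next
        case False
        then show ?thesis using C[of a b c] ca that by (simp add: F_def algebra_simps)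
      qed
    qed
    then show ?thesis using I integrable_integral by metis
  qed
  moreover have "F c = z" by (simp add: F_def)
  ultimately show thesis using that assms by (auto simp: primitive_def)
qed

section \<open>Calculus of primitives: linearity, shifts, product and chain rule\<close>

lemma primitive_zero: "primitive F (\<lambda>x. 0) \<Longrightarrow> F x = F y"
  using primitive_has_integral[of F "\<lambda>x. 0" x y] primitive_has_integral[of F "\<lambda>x. 0" y x]
  by (cases "x \<le> y") auto

lemma primitive_const: "primitive (\<lambda>x. c) (\<lambda>x. 0)"
  by (simp add: primitive_def)

lemma primitive_add:
  assumes "primitive F f" "primitive G g"
  shows "primitive (\<lambda>x. F x + G x) (\<lambda>x. f x + g x)"
proof -
  have "((\<lambda>x. f x + g x) has_integral (F b + G b) - (F a + G a)) {a..b}" if "a \<le> b" for a b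
    using has_integral_add[OF primitive_has_integral[OF assms(1) that] primitive_has_integral[OF assms(2) that]]
    by (simp add: algebra_simps)
  then show ?thesis using assms by (simp add: primitive_def loc_bdd_add)
qed

lemma primitive_diff:
  assumes "primitive F f" "primitive G g"
  shows "primitive (\<lambda>x. F x - G x) (\<lambda>x. f x - g x)"
proof -
  have "((\<lambda>x. f x - g x) has_integral (F b - G b) - (F a - G a)) {a..b}" if "a \<le> b" for a b
    using has_integral_diff[OF primitive_has_integral[OF assms(1) that] primitive_has_integral[OF assms(2) that]]
    by (simp add: algebra_simps)
  then show ?thesis using assms by (simp add: primitive_def loc_bdd_diff)
qed

lemma primitive_linear:
  assumes "bounded_linear h" "primitive F f"
  shows "primitive (\<lambda>x. h (F x)) (\<lambda>x. h (f x))"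
proof -
  have "loc_bdd (\<lambda>x. h (f x))"
  proof -
    have "(\<lambda>x. h (f x)) \<in> borel_measurable lebesgue"
      using primitive_loc_bdd[OF assms(2)] linear_continuous_on[OF assms(1)]
      by (intro borel_measurable_continuous_on[where f=h]) (auto simp: loc_bdd_def)
    moreover have "bounded (h ` f ` {a..b})" for a b
      using primitive_loc_bdd[OF assms(2)] bounded_linear_image[OF _ assms(1)] by (auto simp: loc_bdd_def)
    ultimately show ?thesis by (simp add: loc_bdd_def image_image)
  qed
  moreover have "((\<lambda>x. h (f x)) has_integral h (F b) - h (F a)) {a..b}" if "a \<le> b" for a b
    using has_integral_linear[OF primitive_has_integral[OF assms(2) that] assms(1)]
    by (simp add: o_def bounded_linear.linear[OF assms(1)] linear_diff)
  ultimately show ?thesis by (simp add: primitive_def)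
qed

lemma primitive_cong:
  assumes "primitive F f" "\<And>x. F x = G x" "\<And>x. f x = g x"
  shows "primitive G g"
proof -
  have "F = G" "f = g" using assms(2,3) by (simp_all add: fun_eq_iff)
  then show ?thesis using assms(1) by simp
qed

lemma primitive_continuousI:
  assumes "\<And>x. (F has_vector_derivative f x) (at x)" "continuous_on UNIV f"
  shows "primitive F f"
  unfolding primitive_def
  using loc_bdd_continuous[OF assms(2)] fundamental_theorem_of_calculus[of _ _ F f] assms(1)
  by (auto intro: has_vector_derivative_at_within)

lemma primitive_has_vector_derivative:
  assumes "primitive F f" "continuous_on UNIV f"
  shows "(F has_vector_derivative f x) (at x)"
proof -
  have "((\<lambda>u. integral {x-1..u} f) has_vector_derivative f x) (at x within {x-1..x+1})"
    by (intro integral_has_vector_derivative continuous_on_subset[OF assms(2)]) auto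
  then have "((\<lambda>u. F u - F (x - 1)) has_vector_derivative f x) (at x within {x-1..x+1})"
    by (rule has_vector_derivative_transform[rotated 2]) (auto simp: primitive_integral[OF assms(1)])
  then have "((\<lambda>u. F u - F (x - 1) + F (x - 1)) has_vector_derivative f x + 0) (at x within {x-1..x+1})"
    by (intro has_vector_derivative_add has_vector_derivative_const)
  then have "(F has_vector_derivative f x) (at x within {x-1..x+1})" by simp
  then show ?thesis
    by (simp add: at_within_Icc_at)
qed

lemma primitive_shift:
  assumes "primitive F f"
  shows "primitive (\<lambda>x. F (x + c)) (\<lambda>x. f (x + c))"
proof -
  have "(\<lambda>x. f (x + c)) \<in> borel_measurable lebesgue"
  proof -
    have "(\<lambda>x::real. x + c) \<in> lebesgue \<rightarrow>\<^sub>M lebesgue"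
      using lebesgue_affine_measurable[of "\<lambda>_. 1" c] by (simp add: euclidean_representation add.commute)
    then show ?thesis
      using primitive_loc_bdd[OF assms] measurable_compose unfolding loc_bdd_def by blast
  qed
  moreover have "bounded ((\<lambda>x. f (x + c)) ` {a..b})" for a b
  proof -
    have "(\<lambda>x. f (x + c)) ` {a..b} = f ` {a + c .. b + c}"
      by (metis image_add_atLeastAtMost' image_image)
    then show ?thesis using primitive_loc_bdd[OF assms] by (simp add: loc_bdd_def)
  qed
  moreover have "((\<lambda>x. f (x + c)) has_integral F (b + c) - F (a + c)) {a..b}" if "a \<le> b" for a b
    using has_integral_shift_real_ivl[OF primitive_has_integral[OF assms, of "a+c" "b+c"], of c] that by simp
  ultimately show ?thesis by (simp add: primitive_def loc_bdd_def)
qed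

lemma has_integral_norm_le:
  assumes "(f has_integral i) {s..t::real}" "s \<le> t" "0 \<le> B" "\<And>x. x \<in> {s..t} \<Longrightarrow> norm (f x) \<le> B"
  shows "norm i \<le> B * (t - s)"
  using has_integral_bound[of B f i s t] assms by simp

lemma primitive_loc_bdd_self: "primitive F f \<Longrightarrow> loc_bdd F"
  by (intro loc_bdd_continuous primitive_continuous)

text \<open>The product is compared with a primitive \<open>H\<close> of the expected derivative:
  the increments of their difference over short intervals are o(t - s), so the difference is
  constant.\<close>

lemma primitive_bilinear:
  fixes F :: "real \<Rightarrow> 'a::euclidean_space" and G :: "real \<Rightarrow> 'b::euclidean_space"
    and prod :: "'a \<Rightarrow> 'b \<Rightarrow> 'c::euclidean_space"
  assumes bil: "bounded_bilinear prod" and F: "primitive F f" and G: "primitive G g"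
  shows "primitive (\<lambda>x. prod (F x) (G x)) (\<lambda>x. prod (f x) (G x) + prod (F x) (g x))"
proof -
  interpret prod: bounded_bilinear prod by (rule bil)
  define k where "k x = prod (f x) (G x) + prod (F x) (g x)" for x
  have lk: "loc_bdd k"
    unfolding k_def by (intro loc_bdd_add loc_bdd_bilinear[OF bil] primitive_loc_bdd[OF F] primitive_loc_bdd[OF G]
        primitive_loc_bdd_self[OF F] primitive_loc_bdd_self[OF G])
  then obtain H where H: "primitive H k" using loc_bdd_has_primitive by blast
  obtain K where K: "0 < K" "\<And>a b. norm (prod a b) \<le> norm a * norm b * K"
    using prod.pos_bounded by blast
  define D where "D x = prod (F x) (G x) - H x" for x
  have "D x = D y" for x y
  proof (rule constant_if_little_o[where D=D])
    fix u e :: real assume e: "e > 0"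
    obtain B1 where B1: "B1 > 0" "\<And>x. x \<in> {u-1..u+1} \<Longrightarrow> norm (f x) \<le> B1"
      using loc_bdd_bound[OF primitive_loc_bdd[OF F]] by blast
    obtain B2 where B2: "B2 > 0" "\<And>x. x \<in> {u-1..u+1} \<Longrightarrow> norm (g x) \<le> B2"
      using loc_bdd_bound[OF primitive_loc_bdd[OF G]] by blast
    \<comment> \<open>Over a short interval \<open>F\<close> and \<open>G\<close> vary by at most
      2h, which puts the integrand below within 2hK(B1 + B2) = e of zero.\<close>
    define h where "h = e / (2 * K * (B1 + B2))"
    have h: "h > 0" using e K B1 B2 by (simp add: h_def)
    have "\<exists>d>0. \<forall>x. dist x u < d \<longrightarrow> dist (F x) (F u) < h"
      using primitive_continuous[OF F, of UNIV] h by (auto simp: continuous_on_iff)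
    then obtain d1 where d1: "d1 > 0" "\<And>x. dist x u < d1 \<Longrightarrow> dist (F x) (F u) < h" by blast
    have "\<exists>d>0. \<forall>x. dist x u < d \<longrightarrow> dist (G x) (G u) < h"
      using primitive_continuous[OF G, of UNIV] h by (auto simp: continuous_on_iff)
    then obtain d2 where d2: "d2 > 0" "\<And>x. dist x u < d2 \<Longrightarrow> dist (G x) (G u) < h" by blast
    define d where "d = min 1 (min d1 d2 / 2)"
    have d: "d > 0" "d < d1" "d < d2" "d \<le> 1" using d1(1) d2(1) by (auto simp: d_def min_def)
    have "norm (D t - D s) \<le> e * (t - s)" if st: "u - d \<le> s" "s \<le> t" "t \<le> u + d" for s t
    proof -
      have near: "dist x u < d1" "dist x u < d2" if "x \<in> {s..t}" for x
        using that st d by (auto simp: dist_real_def abs_less_iff)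
      have Fc: "norm (F t - F x) \<le> 2 * h" if "x \<in> {s..t}" for x
        using dist_triangle2[of "F t" "F x" "F u"] d1(2)[OF near(1)[of t]] d1(2)[OF near(1)[OF that]] st
        by (simp add: dist_norm)
      have Gc: "norm (G s - G x) \<le> 2 * h" if "x \<in> {s..t}" for x
        using dist_triangle2[of "G s" "G x" "G u"] d2(2)[OF near(2)[of s]] d2(2)[OF near(2)[OF that]] st
        by (simp add: dist_norm)
      \<comment> \<open>The increment of the product telescopes with \<open>G\<close> frozen at s
        and \<open>F\<close> frozen at t. Each piece is then an integral, comparable with
        \<open>k\<close> under one integral sign.\<close>
      have "((\<lambda>x. prod (f x) (G s) + prod (F t) (g x) - k x) has_integral
          prod (F t - F s) (G s) + prod (F t) (G t - G s) - (H t - H s)) {s..t}"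
        using has_integral_linear[OF primitive_has_integral[OF F st(2)] prod.bounded_linear_left, of "G s"]
          has_integral_linear[OF primitive_has_integral[OF G st(2)] prod.bounded_linear_right, of "F t"]
        by (intro has_integral_diff has_integral_add primitive_has_integral[OF H st(2)]) (simp_all add: o_def)
      moreover have "norm (prod (f x) (G s) + prod (F t) (g x) - k x) \<le> e" if x: "x \<in> {s..t}" for x
      proof -
        have "prod (f x) (G s) + prod (F t) (g x) - k x = prod (f x) (G s - G x) + prod (F t - F x) (g x)"
          by (simp add: k_def prod.diff_left prod.diff_right)
        also have "norm \<dots> \<le> norm (f x) * norm (G s - G x) * K + norm (F t - F x) * norm (g x) * K"
          by (intro norm_triangle_le add_mono K)
        also have "\<dots> \<le> B1 * (2 * h) * K + (2 * h) * B2 * K"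
          using x st d B1 B2 K Fc[OF x] Gc[OF x] h
          by (intro add_mono mult_right_mono mult_mono) auto
        also have "\<dots> = h * (2 * K * (B1 + B2))" by (simp add: algebra_simps)
        also have "\<dots> = e" using K(1) B1(1) B2(1) by (simp add: h_def)
        finally show ?thesis .
      qed
      ultimately have "norm (prod (F t - F s) (G s) + prod (F t) (G t - G s) - (H t - H s)) \<le> e * (t - s)"
        using e st by (intro has_integral_norm_le) auto
      moreover have "prod (F t - F s) (G s) + prod (F t) (G t - G s) - (H t - H s) = D t - D s"
        by (simp add: D_def prod.diff_left prod.diff_right)
      ultimately show ?thesis by simp
    qed
    then show "\<exists>d>0. \<forall>s t. u - d \<le> s \<and> s \<le> t \<and> t \<le> u + d \<longrightarrow> norm (D t - D s) \<le> e * (t - s)"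
      using d(1) by blast
  qed
  then have "prod (F x) (G x) = H x + D 0" for x unfolding D_def by (metis add.commute diff_add_cancel)
  then show ?thesis
    by (intro primitive_cong[OF primitive_add[OF H primitive_const[of "D 0"]]]) (simp_all add: k_def)
qed

lemmas primitive_mult = primitive_bilinear[OF bounded_bilinear_mult]
lemmas primitive_scaleR = primitive_bilinear[OF bounded_bilinear_scaleR]

lemma primitive_cmult: "primitive F f \<Longrightarrow> primitive (\<lambda>x. c * F x) (\<lambda>x. c * f x :: 'a::{euclidean_space,real_normed_algebra})"
  by (rule primitive_linear[OF bounded_linear_mult_right])

lemma primitive_minus: "primitive F f \<Longrightarrow> primitive (\<lambda>x. - F x) (\<lambda>x. - f x)"
  using primitive_diff[OF primitive_const[of 0]] by force

lemma primitive_chain: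
  fixes F :: "real \<Rightarrow> real"
  assumes phi: "\<And>x. (\<phi> has_real_derivative \<phi>' x) (at x)" "continuous_on UNIV \<phi>'"
    and F: "primitive F f"
  shows "primitive (\<lambda>x. \<phi> (F x)) (\<lambda>x. \<phi>' (F x) * f x)"
proof -
  define k where "k x = \<phi>' (F x) * f x" for x
  have "continuous_on UNIV (\<lambda>x. \<phi>' (F x))"
    by (intro continuous_on_compose2[OF phi(2)] primitive_continuous[OF F]) auto
  then have lk: "loc_bdd k"
    unfolding k_def by (intro loc_bdd_mult loc_bdd_continuous primitive_loc_bdd[OF F])
  then obtain H where H: "primitive H k" using loc_bdd_has_primitive by blast
  define D where "D x = \<phi> (F x) - H x" for x
  have "D x = D y" for x y
  proof (rule constant_if_little_o[where D=D])
    fix u e :: real assume e: "e > 0"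
    obtain B where B: "B > 0" "\<And>x. x \<in> {u-1..u+1} \<Longrightarrow> norm (f x) \<le> B"
      using loc_bdd_bound[OF primitive_loc_bdd[OF F]] by blast
    define h where "h = e / (2 * B)"
    have h: "h > 0" using e B by (simp add: h_def)
    have "\<exists>r>0. \<forall>y. dist y (F u) < r \<longrightarrow> dist (\<phi>' y) (\<phi>' (F u)) < h"
      using phi(2) h by (auto simp: continuous_on_iff)
    then obtain r where r: "r > 0" "\<And>y. dist y (F u) < r \<Longrightarrow> dist (\<phi>' y) (\<phi>' (F u)) < h" by blast
    have "\<exists>d>0. \<forall>x. dist x u < d \<longrightarrow> dist (F x) (F u) < r"
      using primitive_continuous[OF F, of UNIV] r by (auto simp: continuous_on_iff)
    then obtain d1 where d1: "d1 > 0" "\<And>x. dist x u < d1 \<Longrightarrow> dist (F x) (F u) < r" by blast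
    define d where "d = min 1 (d1 / 2)"
    have d: "d > 0" "d < d1" "d \<le> 1" using d1(1) by (auto simp: d_def min_def)
    have "norm (D t - D s) \<le> e * (t - s)" if st: "u - d \<le> s" "s \<le> t" "t \<le> u + d" for s t
    proof -
      have Fr: "dist (F x) (F u) < r" if "x \<in> {s..t}" for x
        using that st d by (intro d1(2)) (auto simp: dist_real_def)
      have "\<exists>z. dist z (F u) < r \<and> \<phi> (F t) - \<phi> (F s) = \<phi>' z * (F t - F s)"
      proof -
        have *: "\<exists>z. dist z (F u) < r \<and> \<phi> b - \<phi> a = \<phi>' z * (b - a)"
          if ab: "a < b" "dist a (F u) < r" "dist b (F u) < r" for a b
        proof -
          obtain z where "z > a" "z < b" "\<phi> b - \<phi> a = (b - a) * \<phi>' z"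
            using MVT2[OF ab(1) phi(1)] by blast
          then show ?thesis using ab by (intro exI[of _ z]) (auto simp: dist_real_def)
        qed
        consider "F s < F t" | "F s = F t" | "F t < F s" by linarith
        then show ?thesis
        proof cases
          case 1
          then show ?thesis using * Fr st by auto
        next
          case 2
          then show ?thesis using Fr[of s] st by auto
        next
          case 3
          then obtain z where "dist z (F u) < r" "\<phi> (F s) - \<phi> (F t) = \<phi>' z * (F s - F t)"
            using *[OF 3] Fr st by auto
          then show ?thesis by (intro exI[of _ z]) (auto simp: algebra_simps)
        qed
      qed
      then obtain z where z: "dist z (F u) < r" "\<phi> (F t) - \<phi> (F s) = \<phi>' z * (F t - F s)" by blast
      have "((\<lambda>x. \<phi>' z * f x - k x) has_integral \<phi>' z * (F t - F s) - (H t - H s)) {s..t}"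
        by (intro has_integral_diff has_integral_mult_right primitive_has_integral[OF F st(2)]
            primitive_has_integral[OF H st(2)])
      moreover have "norm (\<phi>' z * f x - k x) \<le> e" if x: "x \<in> {s..t}" for x
      proof -
        have "norm (\<phi>' z * f x - k x) = dist (\<phi>' z) (\<phi>' (F x)) * norm (f x)"
          by (simp add: k_def dist_real_def abs_mult[symmetric] algebra_simps)
        also have "\<dots> \<le> (2 * h) * B"
          using B(2)[of x] x st d r(2)[OF z(1)] r(2)[OF Fr[OF x]] h
          by (intro mult_mono) (auto simp: dist_real_def)
        also have "\<dots> = e" using B by (simp add: h_def)
        finally show ?thesis .
      qed
      ultimately have "norm (\<phi>' z * (F t - F s) - (H t - H s)) \<le> e * (t - s)"
        using e st by (intro has_integral_norm_le) auto
      moreover have "\<phi>' z * (F t - F s) - (H t - H s) = D t - D s"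
        using z by (simp add: D_def)
      ultimately show ?thesis by simp
    qed
    then show "\<exists>d>0. \<forall>s t. u - d \<le> s \<and> s \<le> t \<and> t \<le> u + d \<longrightarrow> norm (D t - D s) \<le> e * (t - s)"
      using d(1) by blast
  qed
  then have "\<phi> (F x) = H x + D 0" for x unfolding D_def by (metis add.commute diff_add_cancel)
  then show ?thesis
    by (intro primitive_cong[OF primitive_add[OF H primitive_const[of "D 0"]]]) (simp_all add: k_def)
qed

lemma primitive_exp: "primitive F f \<Longrightarrow> primitive (\<lambda>x. exp (F x)) (\<lambda>x. exp (F x) * f x :: real)"
  by (rule primitive_chain[where \<phi>=exp and \<phi>'=exp]) (auto intro!: continuous_intros derivative_eq_intros)

lemma primitive_sin: "primitive F f \<Longrightarrow> primitive (\<lambda>x. sin (F x)) (\<lambda>x. cos (F x) * f x :: real)"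
  by (rule primitive_chain[where \<phi>=sin and \<phi>'=cos]) (auto intro!: continuous_intros derivative_eq_intros)

lemma primitive_cos: "primitive F f \<Longrightarrow> primitive (\<lambda>x. cos (F x)) (\<lambda>x. - sin (F x) * f x :: real)"
  by (rule primitive_chain[where \<phi>=cos and \<phi>'="\<lambda>x. - sin x"]) (auto intro!: continuous_intros derivative_eq_intros)

lemma primitive_strict_mono:
  fixes F :: "real \<Rightarrow> real"
  assumes F: "primitive F f" and "a < b" and c: "continuous_on {a..b} f"
    and f: "\<And>x. x \<in> {a..b} \<Longrightarrow> 0 \<le> f x" and "z \<in> {a..b}" "f z \<noteq> 0"
  shows "F a < F b"
proof -
  have "F a \<le> F b" using \<open>a < b\<close> f by (intro primitive_mono[OF F]) auto
  moreover have "integral {a..b} f \<noteq> 0"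
    using integral_eq_0_iff[OF c \<open>a < b\<close> f] assms(5,6) by blast
  ultimately show ?thesis using primitive_integral[OF F, of a b] \<open>a < b\<close> by simp
qed

text \<open>Bounded on the whole line, in contrast to \<open>loc_bdd\<close>: the fixed point
  argument for the angle uses one Lipschitz constant on all of the line.\<close>

definition bdd_meas :: "(real \<Rightarrow> real) \<Rightarrow> bool" where
  "bdd_meas q \<longleftrightarrow> q \<in> borel_measurable lebesgue \<and> bounded (range q)"

lemma bdd_meas_loc_bdd: "bdd_meas q \<Longrightarrow> loc_bdd q"
  unfolding bdd_meas_def loc_bdd_def by (meson bounded_subset image_mono subset_UNIV)

lemma bdd_meas_bound:
  assumes "bdd_meas q"
  obtains B where "B > 0" "\<And>x. \<bar>q x\<bar> \<le> B"
  using assms unfolding bdd_meas_def bounded_pos by (auto simp: real_norm_def)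

lemma bdd_meas_const [simp]: "bdd_meas (\<lambda>x. c)"
  by (simp add: bdd_meas_def image_constant_conv)

lemma bdd_measI: "q \<in> borel_measurable lebesgue \<Longrightarrow> (\<And>x. \<bar>q x\<bar> \<le> B) \<Longrightarrow> bdd_meas q"
  unfolding bdd_meas_def by (auto simp: bounded_iff)

lemma bdd_meas_add:
  assumes "bdd_meas q" "bdd_meas r"
  shows "bdd_meas (\<lambda>x. q x + r x)"
  using assms unfolding bdd_meas_def by (auto intro!: bounded_plus_comp)

lemma bdd_meas_diff:
  assumes "bdd_meas q" "bdd_meas r"
  shows "bdd_meas (\<lambda>x. q x - r x)"
  using assms unfolding bdd_meas_def by (auto intro!: bounded_minus_comp)

lemma bdd_meas_cmult:
  assumes "bdd_meas q"
  shows "bdd_meas (\<lambda>x. c * q x)"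
proof -
  obtain B where B: "\<And>x. \<bar>q x\<bar> \<le> B" using bdd_meas_bound[OF assms] by blast
  show ?thesis
    using assms B by (intro bdd_measI[of _ "\<bar>c\<bar> * B"]) (auto simp: bdd_meas_def abs_mult intro!: mult_left_mono)
qed

section \<open>The Pruefer angle\<close>

text \<open>The continuous extension of sin x / x. It writes sin (a - b) as a bounded continuous
  factor times a - b, so that differences of angles obey linear equations.\<close>

definition sin_quot :: "real \<Rightarrow> real" where
  "sin_quot x = (if x = 0 then 1 else sin x / x)"

lemma sin_quot_mult: "sin_quot x * x = sin x"
  by (simp add: sin_quot_def)

lemma abs_sin_quot_le: "\<bar>sin_quot x\<bar> \<le> 1"
  using abs_sin_x_le_abs_x[of x] by (auto simp: sin_quot_def divide_le_eq)

lemma continuous_on_sin_quot: "continuous_on S f \<Longrightarrow> continuous_on S (\<lambda>x. sin_quot (f x))"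
  unfolding sin_quot_def by (rule continuous_on_sinc)

lemma isCont_sin_quot: "isCont sin_quot x"
  using isCont_sinc[of x] by (simp add: sin_quot_def[abs_def])

lemma sin2_diff: "(sin a)\<^sup>2 - (sin b)\<^sup>2 = sin (a - b) * sin (a + b :: real)"
proof -
  have "sin (a - b) * sin (a + b) = (sin a * cos b)\<^sup>2 - (cos a * sin b)\<^sup>2"
    by (simp add: sin_add sin_diff power2_eq_square algebra_simps)
  also have "\<dots> = (sin a)\<^sup>2 - (sin b)\<^sup>2"
    by (simp add: power_mult_distrib cos_squared_eq algebra_simps)
  finally show ?thesis by simp
qed

text \<open>Here \<open>q\<close> stands for E - V. The angle is normalized so that a solution of
  u'' = - q u is an amplitude times sin t and u' is the same amplitude times cos t; at zeros of u it
  grows at rate 1 whatever \<open>q\<close> is.\<close>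

definition pruefer_rhs :: "(real \<Rightarrow> real) \<Rightarrow> real \<Rightarrow> real \<Rightarrow> real" where
  "pruefer_rhs q x t = (cos t)\<^sup>2 + q x * (sin t)\<^sup>2"

definition pruefer_solution :: "(real \<Rightarrow> real) \<Rightarrow> (real \<Rightarrow> real) \<Rightarrow> bool" where
  "pruefer_solution q \<theta> \<longleftrightarrow> primitive \<theta> (\<lambda>x. pruefer_rhs q x (\<theta> x))"

text \<open>The right-hand side equals 1 + (q - 1) sin^2 t, and a difference of squared sines
  factors by \<open>sin2_diff\<close>. The change of the potential enters with the nonnegative
  weight sin^2 s.\<close>

lemma pruefer_rhs_diff:
  "pruefer_rhs q2 x s - pruefer_rhs q1 x t =
     (q1 x - 1) * sin (s - t) * sin (s + t) + (q2 x - q1 x) * (sin s)\<^sup>2"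
proof -
  have "pruefer_rhs q2 x s - pruefer_rhs q1 x t =
     (q1 x - 1) * ((sin s)\<^sup>2 - (sin t)\<^sup>2) + (q2 x - q1 x) * (sin s)\<^sup>2"
    by (simp add: pruefer_rhs_def cos_squared_eq algebra_simps)
  then show ?thesis by (simp add: sin2_diff)
qed

lemma pruefer_rhs_lipschitz:
  assumes "\<bar>q x\<bar> + 1 \<le> K"
  shows "\<bar>pruefer_rhs q x s - pruefer_rhs q x t\<bar> \<le> K * \<bar>s - t\<bar>"
proof -
  have "\<bar>pruefer_rhs q x s - pruefer_rhs q x t\<bar> = \<bar>q x - 1\<bar> * \<bar>sin (s - t)\<bar> * \<bar>sin (s + t)\<bar>"
    using pruefer_rhs_diff[of q x s q t] by (simp add: abs_mult)
  also have "\<dots> \<le> K * \<bar>s - t\<bar> * 1"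
    using assms by (intro mult_mono abs_sin_x_le_abs_x abs_sin_le_one) auto
  finally show ?thesis by simp
qed

lemma pruefer_rhs_bound: "\<bar>pruefer_rhs q x t\<bar> \<le> \<bar>q x\<bar> + 1"
proof -
  have "\<bar>(cos t)\<^sup>2\<bar> \<le> 1" "\<bar>q x * (sin t)\<^sup>2\<bar> \<le> \<bar>q x\<bar> * 1"
    unfolding abs_mult by (auto intro!: mult_left_le simp: abs_square_le_1)
  then show ?thesis unfolding pruefer_rhs_def by linarith
qed

lemma loc_bdd_pruefer_rhs:
  assumes "bdd_meas q" "continuous_on UNIV \<theta>"
  shows "loc_bdd (\<lambda>x. pruefer_rhs q x (\<theta> x))"
  unfolding pruefer_rhs_def
  by (intro loc_bdd_intros loc_bdd_continuous bdd_meas_loc_bdd assms continuous_intros)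

text \<open>Integrating the weight exp (2K|t|) gains a factor 1/(2K). Against the Lipschitz constant
  K this leaves 1/2, the contraction factor used below.\<close>

lemma primitive_weighted_bound:
  fixes D :: "real \<Rightarrow> real"
  assumes D: "primitive D g" "D 0 = 0" and "0 \<le> C"
    and g: "\<And>t. \<bar>g t\<bar> \<le> C * K * exp (2 * K * \<bar>t\<bar>)"
  shows "\<bar>D x\<bar> \<le> C / 2 * exp (2 * K * \<bar>x\<bar>)"
proof -
  have g1: "g t \<le> C * K * exp (2 * K * \<bar>t\<bar>)" "- g t \<le> C * K * exp (2 * K * \<bar>t\<bar>)" for t
    using g[of t] by (simp_all add: abs_le_iff)
  have mD: "primitive (\<lambda>x. - D x) (\<lambda>x. - g x)" by (rule primitive_minus[OF D(1)])
  show ?thesis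
  proof (cases "0 \<le> x")
    case True
    have E: "primitive (\<lambda>t. C / 2 * exp (2 * K * t)) (\<lambda>t. C * K * exp (2 * K * t))"
      by (rule primitive_continuousI)
        (auto intro!: continuous_intros derivative_eq_intros simp: has_real_derivative_iff_has_vector_derivative[symmetric])
    have "D x - D 0 \<le> C / 2 * exp (2 * K * x) - C / 2 * exp (2 * K * 0)"
      using True by (intro primitive_le[OF D(1) E]) (auto intro: order_trans[OF g1(1)])
    moreover have "- D x - - D 0 \<le> C / 2 * exp (2 * K * x) - C / 2 * exp (2 * K * 0)"
      using True by (intro primitive_le[OF mD E]) (auto intro: order_trans[OF g1(2)])
    ultimately show ?thesis using D \<open>0 \<le> C\<close> True by (auto simp: abs_le_iff)
  next
    case False
    have E: "primitive (\<lambda>t. - C / 2 * exp (- 2 * K * t)) (\<lambda>t. C * K * exp (- 2 * K * t))"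
      by (rule primitive_continuousI)
        (auto intro!: continuous_intros derivative_eq_intros simp: has_real_derivative_iff_has_vector_derivative[symmetric])
    have g': "g t \<le> C * K * exp (- 2 * K * t)" "- g t \<le> C * K * exp (- 2 * K * t)" if "t \<le> 0" for t
      using g[of t] that by (auto simp: abs_le_iff)
    have "D 0 - D x \<le> - C / 2 * exp (- 2 * K * 0) - (- C / 2 * exp (- 2 * K * x))"
      using False g' by (intro primitive_le[OF D(1) E]) auto
    moreover have "- D 0 - - D x \<le> - C / 2 * exp (- 2 * K * 0) - (- C / 2 * exp (- 2 * K * x))"
      using False g' by (intro primitive_le[OF mD E]) auto
    ultimately show ?thesis using D \<open>0 \<le> C\<close> False by (auto simp: abs_le_iff)
  qed
qed

text \<open>Banach's fixed point theorem for \<open>\<phi>\<close>, where \<open>\<theta> x = t0 + exp (2 K \<bar>x\<bar>) \<phi> x\<close> with \<open>K\<close> a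
  Lipschitz constant: the weight makes the integral operator a contraction on the whole line.\<close>

lemma pruefer_solution_exists:
  assumes q: "bdd_meas q"
  shows "\<exists>\<theta>. \<theta> 0 = t0 \<and> pruefer_solution q \<theta>"
proof -
  obtain B where B: "B > 0" "\<And>x. \<bar>q x\<bar> \<le> B" using bdd_meas_bound[OF q] by blast
  define K where "K = B + 1"
  have K: "K \<ge> 1" "\<And>x. \<bar>q x\<bar> + 1 \<le> K" using B by (auto simp: K_def)
  define w where "w x = exp (2 * K * \<bar>x\<bar>)" for x :: real
  have w0: "w x > 0" for x by (simp add: w_def)
  have wc: "continuous_on UNIV w" unfolding w_def by (intro continuous_intros)
  define g where "g \<phi> x = pruefer_rhs q x (t0 + w x * apply_bcontfun \<phi> x)" for \<phi> :: "real \<Rightarrow>\<^sub>C real" and x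
  have "\<exists>P. primitive P (g \<phi>) \<and> P 0 = 0" for \<phi>
  proof -
    have "loc_bdd (g \<phi>)" unfolding g_def
      by (intro loc_bdd_pruefer_rhs[OF q] continuous_intros wc) auto
    then show ?thesis using loc_bdd_has_primitive by blast
  qed
  then obtain P where P: "\<And>\<phi>. primitive (P \<phi>) (g \<phi>)" "\<And>\<phi>. P \<phi> 0 = 0" by metis
  define S where "S \<phi> = Bcontfun (\<lambda>x. P \<phi> x / w x)" for \<phi>
  have S: "apply_bcontfun (S \<phi>) x = P \<phi> x / w x" for \<phi> x
  proof -
    have "\<bar>P \<phi> x\<bar> \<le> 1 / 2 * w x" for x
    proof -
      have "\<bar>g \<phi> t\<bar> \<le> 1 * K * exp (2 * K * \<bar>t\<bar>)" for t
      proof -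
        have "\<bar>g \<phi> t\<bar> \<le> K * 1"
          using pruefer_rhs_bound[of q t] K(2)[of t] by (auto simp: g_def intro: order_trans)
        also have "\<dots> \<le> K * exp (2 * K * \<bar>t\<bar>)" using K by (intro mult_left_mono) auto
        finally show ?thesis by simp
      qed
      then show ?thesis
        using primitive_weighted_bound[OF P(1) P(2), of 1 \<phi> K x] by (simp add: w_def)
    qed
    then have "norm (P \<phi> x / w x) \<le> 1 / 2" for x
      using w0[of x] by (simp add: divide_le_eq)
    moreover have "continuous_on UNIV (\<lambda>x. P \<phi> x / w x)"
      using w0 by (intro continuous_intros primitive_continuous[OF P(1)] wc) (auto simp: less_imp_neq[symmetric])
    ultimately have "(\<lambda>x. P \<phi> x / w x) \<in> bcontfun" by (intro bcontfun_normI)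
    then show ?thesis by (simp add: S_def Bcontfun_inverse)
  qed
  have "dist (S \<phi>) (S \<psi>) \<le> 1 / 2 * dist \<phi> \<psi>" for \<phi> \<psi>
  proof (rule dist_bound)
    fix x
    have "\<bar>g \<phi> t - g \<psi> t\<bar> \<le> dist \<phi> \<psi> * K * exp (2 * K * \<bar>t\<bar>)" for t
    proof -
      have "\<bar>g \<phi> t - g \<psi> t\<bar> \<le> K * \<bar>w t * apply_bcontfun \<phi> t - w t * apply_bcontfun \<psi> t\<bar>"
        using pruefer_rhs_lipschitz[of q t K "t0 + w t * apply_bcontfun \<phi> t" "t0 + w t * apply_bcontfun \<psi> t"] K(2)[of t]
        by (simp add: g_def)
      also have "\<dots> = K * (w t * dist (apply_bcontfun \<phi> t) (apply_bcontfun \<psi> t))"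
        using w0[of t] by (simp add: dist_real_def abs_mult flip: right_diff_distrib)
      also have "\<dots> \<le> K * (w t * dist \<phi> \<psi>)"
        using K w0[of t] by (intro mult_left_mono dist_bounded) auto
      finally show ?thesis by (simp add: w_def mult_ac)
    qed
    then have "\<bar>P \<phi> x - P \<psi> x\<bar> \<le> dist \<phi> \<psi> / 2 * w x"
      using primitive_weighted_bound[OF primitive_diff[OF P(1) P(1)], of \<phi> \<psi> "dist \<phi> \<psi>" K x] P(2)
      by (simp add: w_def)
    then show "dist (apply_bcontfun (S \<phi>) x) (apply_bcontfun (S \<psi>) x) \<le> 1 / 2 * dist \<phi> \<psi>"
      using w0[of x] by (simp add: S dist_real_def divide_le_eq flip: diff_divide_distrib)
  qed
  then have "\<exists>!\<phi>. S \<phi> = \<phi>"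
    by (intro banach_fix_type[of "1/2"]) auto
  then obtain \<phi> where \<phi>: "S \<phi> = \<phi>" by blast
  have eq: "w x * apply_bcontfun \<phi> x = P \<phi> x" for x
    using S[of \<phi> x] w0[of x] unfolding \<phi> by (simp add: field_simps)
  define \<theta> where "\<theta> x = t0 + P \<phi> x" for x
  have "primitive \<theta> (\<lambda>x. pruefer_rhs q x (\<theta> x))"
    by (rule primitive_cong[OF primitive_add[OF primitive_const[of t0] P(1)[of \<phi>]]])
      (simp_all add: \<theta>_def g_def eq)
  moreover have "\<theta> 0 = t0" by (simp add: \<theta>_def P)
  ultimately show ?thesis by (auto simp: pruefer_solution_def)
qed

definition pruefer :: "(real \<Rightarrow> real) \<Rightarrow> real \<Rightarrow> real \<Rightarrow> real" where
  "pruefer q t0 = (SOME \<theta>. \<theta> 0 = t0 \<and> pruefer_solution q \<theta>)"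

lemma pruefer_solution: "bdd_meas q \<Longrightarrow> pruefer_solution q (pruefer q t0)"
  and pruefer_0 [simp]: "bdd_meas q \<Longrightarrow> pruefer q t0 0 = t0"
  using someI_ex[OF pruefer_solution_exists[of q t0]] unfolding pruefer_def by blast+

lemma pruefer_primitive: "bdd_meas q \<Longrightarrow> primitive (pruefer q t0) (\<lambda>x. pruefer_rhs q x (pruefer q t0 x))"
  using pruefer_solution by (simp add: pruefer_solution_def)

lemma pruefer_continuous: "bdd_meas q \<Longrightarrow> continuous_on S (pruefer q t0)"
  using primitive_continuous[OF pruefer_primitive] .

section \<open>Comparison of angles for different initial values and potentials\<close>

lemma integrating_factor:
  fixes d :: "real \<Rightarrow> real"
  assumes "primitive d (\<lambda>x. a x * d x + g x)" "primitive A a"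
  shows "primitive (\<lambda>x. exp (- A x) * d x) (\<lambda>x. exp (- A x) * g x)"
  by (rule primitive_cong[OF primitive_mult[OF primitive_exp[OF primitive_minus[OF assms(2)]] assms(1)]])
    (auto simp: algebra_simps)

text \<open>Coefficient of the linear equation satisfied by \<theta>2 - \<theta>1. The factor
  \<open>sin_quot\<close> keeps it bounded and meaningful where the two angles coincide.\<close>

definition pruefer_slope :: "(real \<Rightarrow> real) \<Rightarrow> (real \<Rightarrow> real) \<Rightarrow> (real \<Rightarrow> real) \<Rightarrow> real \<Rightarrow> real" where
  "pruefer_slope q \<theta>1 \<theta>2 x = (q x - 1) * (sin_quot (\<theta>2 x - \<theta>1 x) * sin (\<theta>1 x + \<theta>2 x))"

lemma loc_bdd_pruefer_slope:
  assumes "bdd_meas q" "pruefer_solution q1 \<theta>1" "pruefer_solution q2 \<theta>2"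
  shows "loc_bdd (pruefer_slope q \<theta>1 \<theta>2)"
  using assms unfolding pruefer_slope_def[abs_def] pruefer_solution_def
  by (intro loc_bdd_mult[OF loc_bdd_diff[OF bdd_meas_loc_bdd[OF assms(1)] loc_bdd_const]] loc_bdd_continuous
      continuous_intros continuous_on_sin_quot) (auto intro: primitive_continuous)

lemma abs_pruefer_slope_le: "\<bar>pruefer_slope q \<theta>1 \<theta>2 x\<bar> \<le> \<bar>q x\<bar> + 1"
proof -
  have "\<bar>pruefer_slope q \<theta>1 \<theta>2 x\<bar> \<le> \<bar>q x - 1\<bar> * (1 * 1)"
    unfolding pruefer_slope_def abs_mult by (intro mult_left_mono mult_mono abs_sin_quot_le) auto
  then show ?thesis using abs_triangle_ineq4[of "q x" 1] by simp
qed

lemma pruefer_difference: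
  assumes "pruefer_solution q1 \<theta>1" "pruefer_solution q2 \<theta>2" "primitive A (pruefer_slope q1 \<theta>1 \<theta>2)"
  shows "primitive (\<lambda>x. exp (- A x) * (\<theta>2 x - \<theta>1 x)) (\<lambda>x. exp (- A x) * ((q2 x - q1 x) * (sin (\<theta>2 x))\<^sup>2))"
proof (rule integrating_factor[OF _ assms(3)])
  have "pruefer_rhs q2 x (\<theta>2 x) - pruefer_rhs q1 x (\<theta>1 x) =
        pruefer_slope q1 \<theta>1 \<theta>2 x * (\<theta>2 x - \<theta>1 x) + (q2 x - q1 x) * (sin (\<theta>2 x))\<^sup>2" for x
    unfolding pruefer_rhs_diff pruefer_slope_def sin_quot_mult[symmetric, of "\<theta>2 x - \<theta>1 x"]
    by (simp add: algebra_simps)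
  moreover have "primitive (\<lambda>x. \<theta>2 x - \<theta>1 x) (\<lambda>x. pruefer_rhs q2 x (\<theta>2 x) - pruefer_rhs q1 x (\<theta>1 x))"
    using assms(1,2) unfolding pruefer_solution_def by (intro primitive_diff)
  ultimately show "primitive (\<lambda>x. \<theta>2 x - \<theta>1 x) (\<lambda>x. pruefer_slope q1 \<theta>1 \<theta>2 x * (\<theta>2 x - \<theta>1 x) + (q2 x - q1 x) * (sin (\<theta>2 x))\<^sup>2)"
    by simp
qed

lemma pruefer_difference_obtain:
  assumes "bdd_meas q1" "pruefer_solution q1 \<theta>1" "pruefer_solution q2 \<theta>2"
  obtains A where "primitive A (pruefer_slope q1 \<theta>1 \<theta>2)" "A 0 = 0"
    "primitive (\<lambda>x. exp (- A x) * (\<theta>2 x - \<theta>1 x)) (\<lambda>x. exp (- A x) * ((q2 x - q1 x) * (sin (\<theta>2 x))\<^sup>2))"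
  using loc_bdd_has_primitive[OF loc_bdd_pruefer_slope[OF assms], of 0 0] pruefer_difference[OF assms(2,3)]
  by blast

text \<open>For equal potentials the inhomogeneity vanishes, so the difference of the angles times
  the integrating factor is constant. The order of two angles therefore never changes, to either
  side of 0.\<close>

lemma pruefer_mono_init:
  assumes "bdd_meas q" "pruefer_solution q \<theta>1" "pruefer_solution q \<theta>2"
  shows "\<theta>1 0 < \<theta>2 0 \<Longrightarrow> \<theta>1 x < \<theta>2 x" and "\<theta>1 0 = \<theta>2 0 \<Longrightarrow> \<theta>1 x = \<theta>2 x"
proof -
  obtain A where A: "A 0 = 0"
    "primitive (\<lambda>x. exp (- A x) * (\<theta>2 x - \<theta>1 x)) (\<lambda>x. exp (- A x) * ((q x - q x) * (sin (\<theta>2 x))\<^sup>2))"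
    using pruefer_difference_obtain[OF assms] by blast
  have "exp (- A x) * (\<theta>2 x - \<theta>1 x) = exp (- A 0) * (\<theta>2 0 - \<theta>1 0)"
    using A(2) by (intro primitive_zero[of "\<lambda>x. exp (- A x) * (\<theta>2 x - \<theta>1 x)"]) simp
  then have *: "exp (- A x) * (\<theta>2 x - \<theta>1 x) = \<theta>2 0 - \<theta>1 0" using A(1) by simp
  show "\<theta>1 0 < \<theta>2 0 \<Longrightarrow> \<theta>1 x < \<theta>2 x"
    using * by (metis diff_gt_0_iff_gt exp_gt_zero zero_less_mult_pos)
  show "\<theta>1 0 = \<theta>2 0 \<Longrightarrow> \<theta>1 x = \<theta>2 x"
    using * by simp
qed

lemma pruefer_unique:
  assumes "bdd_meas q" "pruefer_solution q \<theta>"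
  shows "\<theta> = pruefer q (\<theta> 0)"
proof
  fix x
  show "\<theta> x = pruefer q (\<theta> 0) x"
    by (rule pruefer_mono_init(2)[OF assms pruefer_solution[OF assms(1)]]) (simp add: assms(1))
qed

text \<open>The right-hand side has period pi in the angle, so a shifted solution is again a
  solution and uniqueness applies.\<close>

lemma pruefer_add_pi:
  assumes "bdd_meas q"
  shows "pruefer q (t0 + of_int n * pi) x = pruefer q t0 x + of_int n * pi"
proof -
  have s2: "(sin (t + of_int n * pi))\<^sup>2 = (sin t)\<^sup>2" for t :: real
  proof -
    have "sin (of_int n * pi) = 0" by (auto simp: sin_zero_iff_int2)
    moreover from this have "(cos (of_int n * pi))\<^sup>2 = 1" by (simp add: cos_squared_eq)
    ultimately show ?thesis by (simp add: sin_add power_mult_distrib)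
  qed
  then have "(cos (t + of_int n * pi))\<^sup>2 = (cos t)\<^sup>2" for t :: real
    by (simp add: cos_squared_eq)
  then have "pruefer_rhs q x (t + of_int n * pi) = pruefer_rhs q x t" for x t
    by (simp add: pruefer_rhs_def s2)
  then have "pruefer_solution q (\<lambda>x. pruefer q t0 x + of_int n * pi)"
    using primitive_add[OF pruefer_primitive[OF assms, of t0] primitive_const[of "of_int n * pi"]]
    by (simp add: pruefer_solution_def)
  from pruefer_unique[OF assms this] show ?thesis
    using assms by (metis pruefer_0)
qed

lemma pruefer_mono_potential:
  assumes "bdd_meas q1" "bdd_meas q2" "pruefer_solution q1 \<theta>1" "pruefer_solution q2 \<theta>2"
    "\<theta>1 0 \<le> \<theta>2 0" "\<And>x. q1 x \<le> q2 x" "0 \<le> x"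
  shows "\<theta>1 x \<le> \<theta>2 x"
proof -
  obtain A where A: "A 0 = 0"
    "primitive (\<lambda>x. exp (- A x) * (\<theta>2 x - \<theta>1 x)) (\<lambda>x. exp (- A x) * ((q2 x - q1 x) * (sin (\<theta>2 x))\<^sup>2))"
    using pruefer_difference_obtain[OF assms(1,3,4)] by blast
  have "exp (- A 0) * (\<theta>2 0 - \<theta>1 0) \<le> exp (- A x) * (\<theta>2 x - \<theta>1 x)"
    using assms by (intro primitive_mono[OF A(2)]) auto
  then have "0 \<le> exp (- A x) * (\<theta>2 x - \<theta>1 x)" using A(1) assms(5) by simp
  then show ?thesis by (simp add: zero_le_mult_iff)
qed

text \<open>A Gronwall estimate. The integrating factor exp (- A) lies between exp (- K X) and exp
  (K X); its lower and upper bound account for the two exponentials.\<close>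

lemma pruefer_lipschitz:
  assumes "bdd_meas q1" "bdd_meas q2" "pruefer_solution q1 \<theta>1" "pruefer_solution q2 \<theta>2"
    and K: "\<And>x. \<bar>q1 x\<bar> + 1 \<le> K" and \<delta>: "\<And>x. \<bar>q2 x - q1 x\<bar> \<le> \<delta>" and "0 \<le> x" "x \<le> X"
  shows "\<bar>\<theta>2 x - \<theta>1 x\<bar> \<le> exp (K * X) * (\<bar>\<theta>2 0 - \<theta>1 0\<bar> + \<delta> * X * exp (K * X))"
proof -
  obtain A where A: "A 0 = 0" "primitive A (pruefer_slope q1 \<theta>1 \<theta>2)"
    "primitive (\<lambda>x. exp (- A x) * (\<theta>2 x - \<theta>1 x)) (\<lambda>x. exp (- A x) * ((q2 x - q1 x) * (sin (\<theta>2 x))\<^sup>2))"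
    using pruefer_difference_obtain[OF assms(1,3,4)] by blast
  have K0: "K \<ge> 0" using K[of 0] by linarith
  have \<delta>0: "\<delta> \<ge> 0" using \<delta>[of 0] by linarith
  have A_le: "\<bar>A y\<bar> \<le> K * X" if "0 \<le> y" "y \<le> X" for y
  proof -
    have "norm (A y - A 0) \<le> K * (y - 0)"
      using abs_pruefer_slope_le[of q1 \<theta>1 \<theta>2] K that
      by (intro primitive_norm_diff_le[OF A(2)]) (auto intro: order_trans)
    also have "\<dots> \<le> K * X" using K0 that by (intro mult_left_mono) auto
    finally show ?thesis using A by simp
  qed
  have "norm (exp (- A x) * (\<theta>2 x - \<theta>1 x) - exp (- A 0) * (\<theta>2 0 - \<theta>1 0)) \<le> (exp (K * X) * (\<delta> * 1)) * (x - 0)"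
  proof (rule primitive_norm_diff_le[OF A(3)])
    fix y assume y: "y \<in> {0..x}"
    have "exp (- A y) \<le> exp (K * X)" using A_le[of y] y assms(8) by auto
    then show "norm (exp (- A y) * ((q2 y - q1 y) * (sin (\<theta>2 y))\<^sup>2)) \<le> exp (K * X) * (\<delta> * 1)"
      using \<delta>[of y] \<delta>0 unfolding real_norm_def abs_mult
      by (intro mult_mono) (auto simp: abs_square_le_1)
  qed (use assms in auto)
  also have "\<dots> \<le> exp (K * X) * \<delta> * X" using \<delta>0 assms by (auto intro!: mult_left_mono)
  finally have "\<bar>exp (- A x) * (\<theta>2 x - \<theta>1 x)\<bar> \<le> \<bar>\<theta>2 0 - \<theta>1 0\<bar> + \<delta> * X * exp (K * X)"
    using A(1) by (simp add: mult_ac)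
  moreover have "exp (- (K * X)) \<le> exp (- A x)" using A_le[of x] assms by auto
  ultimately have "exp (- (K * X)) * \<bar>\<theta>2 x - \<theta>1 x\<bar> \<le> \<bar>\<theta>2 0 - \<theta>1 0\<bar> + \<delta> * X * exp (K * X)"
    unfolding abs_mult using mult_right_mono[of "exp (- (K * X))" "exp (- A x)" "\<bar>\<theta>2 x - \<theta>1 x\<bar>"] by auto
  then show ?thesis by (simp add: exp_minus field_simps)
qed

text \<open>Along this angle the right-hand side has the form a \<theta> + 1 with \<open>a\<close>
  locally bounded. The inhomogeneity 1 is positive, so the angle leaves 0 upwards and cannot come
  back.\<close>

lemma pruefer_pos:
  assumes "bdd_meas q" "0 < x"
  shows "0 < pruefer q 0 x"
proof -
  define \<theta> where "\<theta> = pruefer q 0"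
  have \<theta>: "primitive \<theta> (\<lambda>x. pruefer_rhs q x (\<theta> x))" "\<theta> 0 = 0"
    using assms by (simp_all add: \<theta>_def pruefer_primitive)
  define a where "a x = (q x - 1) * (sin_quot (\<theta> x) * sin (\<theta> x))" for x
  have "loc_bdd a" unfolding a_def
    by (intro loc_bdd_mult[OF loc_bdd_diff[OF bdd_meas_loc_bdd[OF assms(1)] loc_bdd_const]] loc_bdd_continuous
      continuous_intros continuous_on_sin_quot primitive_continuous[OF \<theta>(1)])
  then obtain A where A: "primitive A a" using loc_bdd_has_primitive by blast
  have "pruefer_rhs q x (\<theta> x) = a x * \<theta> x + 1" for x
  proof -
    have "a x * \<theta> x + 1 = (q x - 1) * (sin_quot (\<theta> x) * \<theta> x * sin (\<theta> x)) + 1"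
      by (simp add: a_def mult_ac)
    then show ?thesis unfolding sin_quot_mult
      unfolding pruefer_rhs_def cos_squared_eq by (simp add: algebra_simps power2_eq_square)
  qed
  then have "primitive (\<lambda>x. exp (- A x) * \<theta> x) (\<lambda>x. exp (- A x) * 1)"
    using \<theta>(1) by (intro integrating_factor[OF _ A]) simp
  from primitive_strict_mono[OF this assms(2), of x]
  have "exp (- A 0) * \<theta> 0 < exp (- A x) * \<theta> x"
    using assms(2) by (simp add: continuous_intros primitive_continuous[OF A])
  then show ?thesis using \<theta> by (simp add: \<theta>_def zero_less_mult_iff)
qed

text \<open>For nonpositive \<open>q\<close> the angle pi/2 is a barrier: d = \<theta> - pi/2
  satisfies d' = sin^2 d + q cos^2 d, which is linear in d up to a nonpositive
  inhomogeneity.\<close>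

lemma pruefer_le_pi_half:
  assumes "bdd_meas q" "\<And>x. q x \<le> 0" "0 \<le> x"
  shows "pruefer q (pi / 2) x \<le> pi / 2"
proof -
  define d where "d x = pruefer q (pi / 2) x - pi / 2" for x
  have d: "primitive d (\<lambda>x. pruefer_rhs q x (d x + pi / 2))" "d 0 = 0"
    using primitive_diff[OF pruefer_primitive[OF assms(1), of "pi/2"] primitive_const[of "pi/2"]] assms
    by (simp_all add: d_def[abs_def])
  define a where "a x = sin_quot (d x) * sin (d x)" for x
  have "loc_bdd a" unfolding a_def
    by (intro loc_bdd_continuous continuous_intros continuous_on_sin_quot primitive_continuous[OF d(1)])
  then obtain A where A: "primitive A a" using loc_bdd_has_primitive by blast
  have "pruefer_rhs q x (d x + pi / 2) = a x * d x + q x * (cos (d x))\<^sup>2" for x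
  proof -
    have "a x * d x = sin_quot (d x) * d x * sin (d x)"
      by (simp add: a_def mult_ac)
    then show ?thesis unfolding sin_quot_mult
      by (simp add: pruefer_rhs_def power2_eq_square sin_add cos_add)
  qed
  then have "primitive (\<lambda>x. exp (- A x) * d x) (\<lambda>x. exp (- A x) * (q x * (cos (d x))\<^sup>2))"
    using d(1) by (intro integrating_factor[OF _ A]) simp
  moreover have "exp (- A y) * (q y * (cos (d y))\<^sup>2) \<le> 0" for y
    using assms(2)[of y] by (simp add: mult_le_0_iff)
  ultimately have "exp (- A x) * d x \<le> exp (- A 0) * d 0"
    using primitive_mono[OF primitive_minus assms(3)] by force
  then have "d x \<le> 0" using d(2) by (simp add: mult_le_0_iff)
  then show ?thesis by (simp add: d_def)
qed

section \<open>Solutions of the linear equation\<close>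

definition solves :: "(real \<Rightarrow> real) \<Rightarrow> (real \<Rightarrow> 'a::euclidean_space) \<Rightarrow> (real \<Rightarrow> 'a) \<Rightarrow> bool" where
  "solves q u u' \<longleftrightarrow> primitive u u' \<and> primitive u' (\<lambda>x. - q x *\<^sub>R u x)"

lemma solvesD: "solves q u u' \<Longrightarrow> primitive u u'" "solves q u u' \<Longrightarrow> primitive u' (\<lambda>x. - q x *\<^sub>R u x)"
  by (simp_all add: solves_def)

lemma solves_continuous: "solves q u u' \<Longrightarrow> continuous_on S u" "solves q u u' \<Longrightarrow> continuous_on S u'"
  using primitive_continuous solvesD by blast+

lemma solves_has_vector_derivative: "solves q u u' \<Longrightarrow> (u has_vector_derivative u' x) (at x)"
  by (intro primitive_has_vector_derivative solves_continuous solvesD)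

lemma solves_linear:
  assumes "bounded_linear h" "solves q u u'"
  shows "solves q (\<lambda>x. h (u x)) (\<lambda>x. h (u' x))"
proof -
  have "h (- q x *\<^sub>R u x) = - q x *\<^sub>R h (u x)" for x
    by (simp only: linear_cmul[OF bounded_linear.linear[OF assms(1)]])
  then show ?thesis
    using primitive_linear[OF assms(1) solvesD(1)[OF assms(2)]]
      primitive_linear[OF assms(1) solvesD(2)[OF assms(2)]]
    by (simp add: solves_def)
qed

lemma solves_add:
  assumes "solves q u u'" "solves q v v'"
  shows "solves q (\<lambda>x. u x + v x) (\<lambda>x. u' x + v' x)"
  using primitive_add[OF solvesD(1)[OF assms(1)] solvesD(1)[OF assms(2)]]
    primitive_add[OF solvesD(2)[OF assms(1)] solvesD(2)[OF assms(2)]]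
  by (simp add: solves_def algebra_simps)

lemma solves_shift:
  assumes "solves q u u'" "\<And>x. q (x + X) = q x"
  shows "solves q (\<lambda>x. u (x + X)) (\<lambda>x. u' (x + X))"
  using primitive_shift[OF solvesD(1)[OF assms(1)], of X] primitive_shift[OF solvesD(2)[OF assms(1)], of X]
  by (simp add: solves_def assms(2))

lemma solves_wronskian:
  fixes y :: "real \<Rightarrow> real"
  assumes "solves q1 y y'" "solves q2 u u'"
  shows "primitive (\<lambda>x. y x *\<^sub>R u' x - y' x *\<^sub>R u x) (\<lambda>x. ((q1 x - q2 x) * y x) *\<^sub>R u x)"
proof -
  have "primitive (\<lambda>x. y x *\<^sub>R u' x - y' x *\<^sub>R u x)
     (\<lambda>x. (y' x *\<^sub>R u' x + y x *\<^sub>R (- q2 x *\<^sub>R u x)) - ((- q1 x *\<^sub>R y x) *\<^sub>R u x + y' x *\<^sub>R u' x))"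
    by (intro primitive_diff primitive_scaleR solvesD[OF assms(1)] solvesD[OF assms(2)])
  then show ?thesis by (simp add: algebra_simps)
qed

lemma solves_wronskian_const:
  fixes y :: "real \<Rightarrow> real"
  assumes "solves q y y'" "solves q u u'"
  shows "y x *\<^sub>R u' x - y' x *\<^sub>R u x = y 0 *\<^sub>R u' 0 - y' 0 *\<^sub>R u 0"
  using primitive_zero[of "\<lambda>x. y x *\<^sub>R u' x - y' x *\<^sub>R u x" x 0] solves_wronskian[OF assms]
  by simp

text \<open>The linear equation is solved from the angle and not conversely: u = exp \<rho> sin
  \<theta> and u' = exp \<rho> cos \<theta> are consistent exactly for \<rho>' = (1 - q) sin
  \<theta> cos \<theta>.\<close>

definition log_amp :: "(real \<Rightarrow> real) \<Rightarrow> real \<Rightarrow> real \<Rightarrow> real" where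
  "log_amp q t0 = (SOME \<rho>. \<rho> 0 = 0 \<and>
     primitive \<rho> (\<lambda>x. (1 - q x) * (sin (pruefer q t0 x) * cos (pruefer q t0 x))))"

definition sol :: "(real \<Rightarrow> real) \<Rightarrow> real \<Rightarrow> real \<Rightarrow> real" where
  "sol q t0 x = exp (log_amp q t0 x) * sin (pruefer q t0 x)"

definition dsol :: "(real \<Rightarrow> real) \<Rightarrow> real \<Rightarrow> real \<Rightarrow> real" where
  "dsol q t0 x = exp (log_amp q t0 x) * cos (pruefer q t0 x)"

lemma log_amp:
  assumes "bdd_meas q"
  shows "log_amp q t0 0 = 0"
    "primitive (log_amp q t0) (\<lambda>x. (1 - q x) * (sin (pruefer q t0 x) * cos (pruefer q t0 x)))"
proof -
  have "loc_bdd (\<lambda>x. (1 - q x) * (sin (pruefer q t0 x) * cos (pruefer q t0 x)))"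
    by (intro loc_bdd_mult[OF loc_bdd_diff[OF loc_bdd_const bdd_meas_loc_bdd[OF assms]]] loc_bdd_continuous continuous_intros
        pruefer_continuous assms)
  then have "\<exists>\<rho>. \<rho> 0 = 0 \<and> primitive \<rho> (\<lambda>x. (1 - q x) * (sin (pruefer q t0 x) * cos (pruefer q t0 x)))"
    using loc_bdd_has_primitive by blast
  from someI_ex[OF this] show "log_amp q t0 0 = 0"
    "primitive (log_amp q t0) (\<lambda>x. (1 - q x) * (sin (pruefer q t0 x) * cos (pruefer q t0 x)))"
    unfolding log_amp_def by blast+
qed

lemma sol_0 [simp]: "bdd_meas q \<Longrightarrow> sol q t0 0 = sin t0"
  and dsol_0 [simp]: "bdd_meas q \<Longrightarrow> dsol q t0 0 = cos t0"
  by (simp_all add: sol_def dsol_def log_amp)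

lemma solves_sol:
  assumes "bdd_meas q"
  shows "solves q (sol q t0) (dsol q t0)"
proof -
  let ?s = "\<lambda>x. sin (pruefer q t0 x)" and ?c = "\<lambda>x. cos (pruefer q t0 x)"
  let ?e = "\<lambda>x. exp (log_amp q t0 x)"
  have E: "primitive ?e (\<lambda>x. ?e x * ((1 - q x) * (?s x * ?c x)))"
    by (rule primitive_exp[OF log_amp(2)[OF assms]])
  have S: "primitive ?s (\<lambda>x. ?c x * pruefer_rhs q x (pruefer q t0 x))"
    by (rule primitive_sin[OF pruefer_primitive[OF assms]])
  have C: "primitive ?c (\<lambda>x. - ?s x * pruefer_rhs q x (pruefer q t0 x))"
    by (rule primitive_cos[OF pruefer_primitive[OF assms]])
  have "primitive (sol q t0) (dsol q t0)"
  proof (rule primitive_cong[OF primitive_mult[OF E S]])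
    fix x
    have "?e x * ((1 - q x) * (?s x * ?c x)) * ?s x + ?e x * (?c x * pruefer_rhs q x (pruefer q t0 x)) =
        ?e x * ?c x * ((?s x)\<^sup>2 + (?c x)\<^sup>2)"
      unfolding pruefer_rhs_def by algebra
    then show "?e x * ((1 - q x) * (?s x * ?c x)) * ?s x + ?e x * (?c x * pruefer_rhs q x (pruefer q t0 x)) = dsol q t0 x"
      by (simp only: dsol_def sin_cos_squared_add mult_1_right)
  qed (simp add: sol_def)
  moreover have "primitive (dsol q t0) (\<lambda>x. - q x *\<^sub>R sol q t0 x)"
  proof (rule primitive_cong[OF primitive_mult[OF E C]])
    fix x
    have "?e x * ((1 - q x) * (?s x * ?c x)) * ?c x + ?e x * (- ?s x * pruefer_rhs q x (pruefer q t0 x)) =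
        - q x * ?e x * ?s x * ((?s x)\<^sup>2 + (?c x)\<^sup>2)"
      unfolding pruefer_rhs_def by algebra
    then show "?e x * ((1 - q x) * (?s x * ?c x)) * ?c x + ?e x * (- ?s x * pruefer_rhs q x (pruefer q t0 x)) = - q x *\<^sub>R sol q t0 x"
      by (simp only: sol_def sin_cos_squared_add mult_1_right real_scaleR_def mult.assoc)
  qed (simp add: dsol_def)
  ultimately show ?thesis by (simp add: solves_def)
qed

text \<open>Starting angles pi/2 and 0 give the initial values (1, 0) and (0, 1) of a function and
  its derivative: the cosine-like and the sine-like fundamental solution.\<close>

abbreviation "cf q \<equiv> sol q (pi / 2)"
abbreviation "cf' q \<equiv> dsol q (pi / 2)"
abbreviation "sf q \<equiv> sol q 0"
abbreviation "sf' q \<equiv> dsol q 0"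

lemma fundamental_det: "bdd_meas q \<Longrightarrow> cf q x * sf' q x - cf' q x * sf q x = 1"
  using solves_wronskian_const[OF solves_sol[of q "pi/2"] solves_sol[of q 0], of x] by simp

text \<open>The Wronskians of \<open>u\<close> with the two fundamental solutions are constant, and
  Cramer's rule with determinant 1 recovers \<open>u\<close>. Vector values of \<open>u\<close>
  cover complex solutions with the same real fundamental system.\<close>

lemma fundamental_repr:
  assumes "bdd_meas q" "solves q u u'"
  shows "u x = cf q x *\<^sub>R u 0 + sf q x *\<^sub>R u' 0" "u' x = cf' q x *\<^sub>R u 0 + sf' q x *\<^sub>R u' 0"
proof -
  have P: "cf q x *\<^sub>R u' x - cf' q x *\<^sub>R u x = u' 0"
    and R: "sf q x *\<^sub>R u' x - sf' q x *\<^sub>R u x = - u 0"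
    using solves_wronskian_const[OF solves_sol[OF assms(1), of "pi/2"] assms(2), of x]
      solves_wronskian_const[OF solves_sol[OF assms(1), of 0] assms(2), of x] assms(1) by simp_all
  have "u x = (cf q x * sf' q x - cf' q x * sf q x) *\<^sub>R u x"
    by (simp add: fundamental_det[OF assms(1)])
  also have "\<dots> = sf q x *\<^sub>R (cf q x *\<^sub>R u' x - cf' q x *\<^sub>R u x) - cf q x *\<^sub>R (sf q x *\<^sub>R u' x - sf' q x *\<^sub>R u x)"
    by (simp add: algebra_simps)
  finally show "u x = cf q x *\<^sub>R u 0 + sf q x *\<^sub>R u' 0" unfolding P R by simp
  have "u' x = (cf q x * sf' q x - cf' q x * sf q x) *\<^sub>R u' x"
    by (simp add: fundamental_det[OF assms(1)])
  also have "\<dots> = sf' q x *\<^sub>R (cf q x *\<^sub>R u' x - cf' q x *\<^sub>R u x) - cf' q x *\<^sub>R (sf q x *\<^sub>R u' x - sf' q x *\<^sub>R u x)"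
    by (simp add: algebra_simps)
  finally show "u' x = cf' q x *\<^sub>R u 0 + sf' q x *\<^sub>R u' 0" unfolding P R by simp
qed

lemma sol_repr:
  assumes "bdd_meas q"
  shows "sol q t0 x = cf q x * sin t0 + sf q x * cos t0" "dsol q t0 x = cf' q x * sin t0 + sf' q x * cos t0"
  using fundamental_repr[OF assms solves_sol[OF assms], of t0 x] assms by simp_all

lemma sol_amp: "(sol q t0 x)\<^sup>2 + (dsol q t0 x)\<^sup>2 = exp (2 * log_amp q t0 x)"
proof -
  have "(sol q t0 x)\<^sup>2 + (dsol q t0 x)\<^sup>2 = (exp (log_amp q t0 x))\<^sup>2 * ((sin (pruefer q t0 x))\<^sup>2 + (cos (pruefer q t0 x))\<^sup>2)"
    unfolding sol_def dsol_def power_mult_distrib by (simp only: distrib_left)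
  then show ?thesis by (simp add: exp_double)
qed

lemma sol_polar:
  assumes "bdd_meas q" "solves q y y'" "y 0 \<noteq> 0 \<or> y' 0 \<noteq> 0"
  obtains R t0 where "R > 0" "\<And>x. y x = R * sol q t0 x" "\<And>x. y' x = R * dsol q t0 x"
proof -
  define R where "R = sqrt ((y 0)\<^sup>2 + (y' 0)\<^sup>2)"
  have pos: "(y 0)\<^sup>2 + (y' 0)\<^sup>2 > 0" using assms(3) by (auto simp: sum_power2_gt_zero_iff)
  then have R: "R > 0" "R\<^sup>2 = (y 0)\<^sup>2 + (y' 0)\<^sup>2" by (simp_all add: R_def)
  have "(y' 0 / R)\<^sup>2 + (y 0 / R)\<^sup>2 = 1"
    unfolding power_divide add_divide_distrib[symmetric] add.commute[of "(y' 0)\<^sup>2"] R(2)[symmetric]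
    using R(1) by simp
  then obtain t0 where "y' 0 / R = cos t0" "y 0 / R = sin t0"
    using sincos_total_2pi by metis
  then have y0: "y 0 = R * sin t0" "y' 0 = R * cos t0" using R by (simp_all add: field_simps)
  have "y x = R * sol q t0 x" "y' x = R * dsol q t0 x" for x
    unfolding fundamental_repr[OF assms(1,2), of x] sol_repr[OF assms(1), of t0 x] y0
    by (simp_all add: algebra_simps)
  then show thesis using R that by blast
qed

lemma log_amp_bound:
  assumes "bdd_meas q" "\<And>x. \<bar>q x\<bar> + 1 \<le> K" "0 \<le> x" "x \<le> X"
  shows "\<bar>log_amp q t0 x\<bar> \<le> K * X"
proof -
  have K0: "K \<ge> 0" using assms(2)[of 0] by linarith
  have "norm (log_amp q t0 x - log_amp q t0 0) \<le> K * (x - 0)"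
  proof (rule primitive_norm_diff_le[OF log_amp(2)[OF assms(1)] assms(3)])
    fix x
    have "norm ((1 - q x) * (sin (pruefer q t0 x) * cos (pruefer q t0 x))) \<le> K * (1 * 1)"
      unfolding real_norm_def abs_mult using assms(2)[of x] abs_triangle_ineq4[of 1 "q x"]
      by (intro mult_mono abs_sin_le_one abs_cos_le_one) auto
    then show "norm ((1 - q x) * (sin (pruefer q t0 x) * cos (pruefer q t0 x))) \<le> K" by simp
  qed
  also have "\<dots> \<le> K * X" using K0 assms by (intro mult_left_mono) auto
  finally show ?thesis using assms by (simp add: log_amp)
qed

lemma sol_bound:
  assumes "bdd_meas q" "\<And>x. \<bar>q x\<bar> + 1 \<le> K" "0 \<le> x" "x \<le> X"
  shows "\<bar>sol q t0 x\<bar> \<le> exp (K * X)" "\<bar>dsol q t0 x\<bar> \<le> exp (K * X)"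
proof -
  have "exp (log_amp q t0 x) \<le> exp (K * X)" using log_amp_bound[OF assms] by (auto simp: abs_le_iff)
  then have "exp (log_amp q t0 x) * \<bar>sin (pruefer q t0 x)\<bar> \<le> exp (K * X) * 1"
    "exp (log_amp q t0 x) * \<bar>cos (pruefer q t0 x)\<bar> \<le> exp (K * X) * 1"
    by (intro mult_mono abs_sin_le_one abs_cos_le_one; simp)+
  then show "\<bar>sol q t0 x\<bar> \<le> exp (K * X)" "\<bar>dsol q t0 x\<bar> \<le> exp (K * X)"
    by (simp_all add: sol_def dsol_def abs_mult)
qed

text \<open>\<open>P\<close> and \<open>R\<close> are the changes, since the point 0, of the
  Wronskians of \<open>u\<close> with \<open>cf q1\<close> and \<open>sf q1\<close>. They measure
  the difference of the potentials, and solving for \<open>u\<close> is Cramer's rule again.\<close>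

lemma variation_of_constants:
  fixes u :: "real \<Rightarrow> real"
  assumes q1: "bdd_meas q1" and u: "solves q2 u u'"
  obtains P R where
    "primitive P (\<lambda>x. (q1 x - q2 x) * (cf q1 x * u x))" "P 0 = 0"
    "primitive R (\<lambda>x. (q1 x - q2 x) * (sf q1 x * u x))" "R 0 = 0"
    "\<And>x. u x = cf q1 x * u 0 + sf q1 x * u' 0 + sf q1 x * P x - cf q1 x * R x"
    "\<And>x. u' x = cf' q1 x * u 0 + sf' q1 x * u' 0 + sf' q1 x * P x - cf' q1 x * R x"
proof -
  define P where "P x = cf q1 x * u' x - cf' q1 x * u x - u' 0" for x
  define R where "R x = sf q1 x * u' x - sf' q1 x * u x + u 0" for x
  have P: "primitive P (\<lambda>x. (q1 x - q2 x) * (cf q1 x * u x))"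
    using primitive_diff[OF solves_wronskian[OF solves_sol[OF q1, of "pi/2"] u] primitive_const[of "u' 0"]]
    by (simp add: P_def[abs_def] mult_ac)
  have R: "primitive R (\<lambda>x. (q1 x - q2 x) * (sf q1 x * u x))"
    using primitive_add[OF solves_wronskian[OF solves_sol[OF q1, of 0] u] primitive_const[of "u 0"]]
    by (simp add: R_def[abs_def] mult_ac)
  have det: "cf q1 x * sf' q1 x = 1 + cf' q1 x * sf q1 x" for x
    using fundamental_det[OF q1, of x] by simp
  show thesis
  proof (rule that[OF P _ R])
    show "P 0 = 0" "R 0 = 0" using q1 by (simp_all add: P_def R_def)
    fix x
    have "cf q1 x * u 0 + sf q1 x * u' 0 + sf q1 x * P x - cf q1 x * R x =
       (cf q1 x * sf' q1 x) * u x - cf' q1 x * sf q1 x * u x"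
      by (simp add: P_def R_def algebra_simps)
    then show "u x = cf q1 x * u 0 + sf q1 x * u' 0 + sf q1 x * P x - cf q1 x * R x"
      unfolding det by (simp add: algebra_simps)
    have "cf' q1 x * u 0 + sf' q1 x * u' 0 + sf' q1 x * P x - cf' q1 x * R x =
       (cf q1 x * sf' q1 x) * u' x - cf' q1 x * sf q1 x * u' x"
      by (simp add: P_def R_def algebra_simps)
    then show "u' x = cf' q1 x * u 0 + sf' q1 x * u' 0 + sf' q1 x * P x - cf' q1 x * R x"
      unfolding det by (simp add: algebra_simps)
  qed
qed

text \<open>Since (y y')' = y'^2 - q y^2, a solution vanishing on the interval has integral of y'^2
  equal to zero, so its initial slope vanishes as well. But the initial values are sin t0 and cos
  t0.\<close>

lemma sol_nontrivial:
  assumes "bdd_meas q" "0 < X"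
  shows "\<exists>x\<in>{0..X}. sol q t0 x \<noteq> 0"
proof (rule ccontr)
  assume "\<not> ?thesis"
  then have z: "\<And>x. x \<in> {0..X} \<Longrightarrow> sol q t0 x = 0" by blast
  have "integral {0..X} (\<lambda>x. (dsol q t0 x)\<^sup>2) = 0"
  proof -
    have "primitive (\<lambda>x. sol q t0 x * dsol q t0 x) (\<lambda>x. dsol q t0 x * dsol q t0 x + sol q t0 x * (- q x *\<^sub>R sol q t0 x))"
      by (rule primitive_mult[OF solvesD[OF solves_sol[OF assms(1)]]])
    then have "((\<lambda>x. dsol q t0 x * dsol q t0 x + sol q t0 x * (- q x *\<^sub>R sol q t0 x)) has_integral
       sol q t0 X * dsol q t0 X - sol q t0 0 * dsol q t0 0) {0..X}"
      using assms by (intro primitive_has_integral) auto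
    then have "((\<lambda>x. dsol q t0 x * dsol q t0 x + sol q t0 x * (- q x *\<^sub>R sol q t0 x)) has_integral 0) {0..X}"
      using z[of X] z[of 0] assms(2) by (simp del: sol_0 dsol_0)
    then have "((\<lambda>x. (dsol q t0 x)\<^sup>2) has_integral 0) {0..X}"
      by (rule has_integral_eq[rotated]) (simp add: z power2_eq_square)
    then show ?thesis by (rule integral_unique)
  qed
  then have "\<forall>x\<in>{0..X}. (dsol q t0 x)\<^sup>2 = 0"
    using assms by (subst (asm) integral_eq_0_iff) (auto intro!: continuous_intros solves_continuous[OF solves_sol])
  then have "dsol q t0 0 = 0" "sol q t0 0 = 0" using z[of 0] assms(2) by (auto simp del: sol_0 dsol_0)
  then show False using assms sin_zero_abs_cos_one[of t0] by simp
qed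

text \<open>With a constant difference of the potentials the integrand of the comparison formula is
  continuous, so one point where the solution is nonzero already makes the integral
  positive.\<close>

lemma pruefer_strict_mono_potential:
  assumes q: "bdd_meas q1" "bdd_meas q2" "\<And>x. q2 x - q1 x = \<delta>" "\<delta> > 0" "0 < X"
  shows "pruefer q1 t0 X < pruefer q2 t0 X"
proof -
  let ?t1 = "pruefer q1 t0" and ?t2 = "pruefer q2 t0"
  obtain A where A: "primitive A (pruefer_slope q1 ?t1 ?t2)" "A 0 = 0"
    "primitive (\<lambda>x. exp (- A x) * (?t2 x - ?t1 x)) (\<lambda>x. exp (- A x) * ((q2 x - q1 x) * (sin (?t2 x))\<^sup>2))"
    using pruefer_difference_obtain[OF q(1) pruefer_solution[OF q(1)] pruefer_solution[OF q(2)]] by blast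
  obtain z where z: "z \<in> {0..X}" "sol q2 t0 z \<noteq> 0" using sol_nontrivial[OF q(2) \<open>0 < X\<close>] by blast
  have "exp (- A 0) * (?t2 0 - ?t1 0) < exp (- A X) * (?t2 X - ?t1 X)"
  proof (rule primitive_strict_mono[OF A(3) \<open>0 < X\<close> _ _ z(1)])
    show "continuous_on {0..X} (\<lambda>x. exp (- A x) * ((q2 x - q1 x) * (sin (?t2 x))\<^sup>2))"
      unfolding q(3) by (intro continuous_intros primitive_continuous[OF A(1)] pruefer_continuous q)
    show "exp (- A z) * ((q2 z - q1 z) * (sin (?t2 z))\<^sup>2) \<noteq> 0"
      using z(2) q(3,4) by (simp add: sol_def)
  qed (use q in auto)
  then show ?thesis using q by (simp add: zero_less_mult_iff)
qed

text \<open>The sine-like solution vanishes at multiples of pi/\<omega>, so the angle there is an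
  integer multiple of pi. The angle increases strictly, hence that integer grows by at least one
  from each zero to the next.\<close>

lemma pruefer_const_ge:
  assumes "\<omega> > 0"
  shows "real n * pi \<le> pruefer (\<lambda>_. \<omega>\<^sup>2) 0 (real n * pi / \<omega>)"
proof -
  let ?\<theta> = "pruefer (\<lambda>_. \<omega>\<^sup>2) 0"
  have "solves (\<lambda>_. \<omega>\<^sup>2) (\<lambda>x. sin (\<omega> * x) / \<omega>) (\<lambda>x. cos (\<omega> * x))"
    unfolding solves_def using assms
    by (intro conjI primitive_continuousI)
      (auto intro!: continuous_intros derivative_eq_intros
        simp: has_real_derivative_iff_has_vector_derivative[symmetric] power2_eq_square)
  from fundamental_repr(1)[OF _ this] have sf: "sf (\<lambda>_. \<omega>\<^sup>2) x = sin (\<omega> * x) / \<omega>" for x by simp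
  have zero: "\<exists>j::int. ?\<theta> (real k * pi / \<omega>) = of_int j * pi" for k
  proof -
    have "sf (\<lambda>_. \<omega>\<^sup>2) (real k * pi / \<omega>) = 0" using assms by (simp add: sf)
    then have "sin (?\<theta> (real k * pi / \<omega>)) = 0" by (simp add: sol_def)
    then show ?thesis by (auto simp: sin_zero_iff_int2)
  qed
  show ?thesis
  proof (induction n)
    case (Suc n)
    have lt: "real n * pi / \<omega> < real (Suc n) * pi / \<omega>"
      using assms by (intro divide_strict_right_mono mult_strict_right_mono) auto
    have pos: "0 < pruefer_rhs (\<lambda>_. \<omega>\<^sup>2) x t" for x t
    proof (cases "sin t = 0")
      case True
      then show ?thesis by (simp add: pruefer_rhs_def cos_squared_eq)
    next
      case False
      then have "0 < \<omega>\<^sup>2 * (sin t)\<^sup>2" using assms by simp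
      then show ?thesis unfolding pruefer_rhs_def by (simp add: add_nonneg_pos)
    qed
    have "continuous_on {real n * pi / \<omega>..real (Suc n) * pi / \<omega>} (\<lambda>x. pruefer_rhs (\<lambda>_. \<omega>\<^sup>2) x (?\<theta> x))"
      unfolding pruefer_rhs_def by (intro continuous_intros pruefer_continuous) simp_all
    then have less: "?\<theta> (real n * pi / \<omega>) < ?\<theta> (real (Suc n) * pi / \<omega>)"
      using lt pos
      by (intro primitive_strict_mono[OF pruefer_primitive[OF bdd_meas_const] lt, of _ _ "real n * pi / \<omega>"])
        (auto simp: less_imp_le less_imp_neq[symmetric])
    obtain i j :: int where ij: "?\<theta> (real n * pi / \<omega>) = of_int i * pi" "?\<theta> (real (Suc n) * pi / \<omega>) = of_int j * pi"
      using zero by blast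
    have "int n \<le> i" using Suc ij(1) by simp
    moreover have "i < j" using less unfolding ij by simp
    ultimately have "real (Suc n) \<le> of_int j" by linarith
    then show ?case unfolding ij(2) by (intro mult_right_mono) auto
  qed simp
qed

text \<open>Sign rules for binary quadratic forms, all from completing the square after
  multiplication by 4A or by 4C. Both versions occur because either coefficient may vanish.\<close>

lemma quadratic_form_disc:
  fixes A B C :: real
  shows "(\<And>a b. 0 \<le> A * a\<^sup>2 + B * a * b + C * b\<^sup>2) \<Longrightarrow> B\<^sup>2 - 4 * A * C \<le> 0"
    and "A * a\<^sup>2 + B * a * b + C * b\<^sup>2 = 0 \<Longrightarrow> a \<noteq> 0 \<or> b \<noteq> 0 \<Longrightarrow> 0 \<le> B\<^sup>2 - 4 * A * C"
    and "0 < A * a\<^sup>2 + B * a * b + C * b\<^sup>2 \<Longrightarrow> A * d\<^sup>2 + B * d * e + C * e\<^sup>2 < 0 \<Longrightarrow> 0 < B\<^sup>2 - 4 * A * C"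
    and "0 \<le> B\<^sup>2 - 4 * A * C \<Longrightarrow> \<exists>a b. (a \<noteq> 0 \<or> b \<noteq> 0) \<and> A * a\<^sup>2 + B * a * b + C * b\<^sup>2 = 0"
    and "B\<^sup>2 - 4 * A * C < 0 \<Longrightarrow> a \<noteq> 0 \<or> b \<noteq> 0 \<Longrightarrow> 0 < A * (A * a\<^sup>2 + B * a * b + C * b\<^sup>2)"
proof -
  have sq1: "4 * A * (A * a\<^sup>2 + B * a * b + C * b\<^sup>2) = (2 * A * a + B * b)\<^sup>2 - (B\<^sup>2 - 4 * A * C) * b\<^sup>2" for a b
    by (simp add: power2_eq_square algebra_simps)
  have sq2: "4 * C * (A * a\<^sup>2 + B * a * b + C * b\<^sup>2) = (2 * C * b + B * a)\<^sup>2 - (B\<^sup>2 - 4 * A * C) * a\<^sup>2" for a b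
    by (simp add: power2_eq_square algebra_simps)
  show 2: "0 \<le> B\<^sup>2 - 4 * A * C" if "A * a\<^sup>2 + B * a * b + C * b\<^sup>2 = 0" "a \<noteq> 0 \<or> b \<noteq> 0" for a b
  proof -
    have "0 \<le> (B\<^sup>2 - 4 * A * C) * b\<^sup>2" "0 \<le> (B\<^sup>2 - 4 * A * C) * a\<^sup>2"
      using sq1[of a b] sq2[of a b] that(1) by simp_all (metis zero_le_power2)+
    then show ?thesis using that(2) by (metis zero_le_mult_iff zero_le_power2 zero_eq_power2 order_antisym)
  qed
  show "B\<^sup>2 - 4 * A * C \<le> 0" if nn: "\<And>a b. 0 \<le> A * a\<^sup>2 + B * a * b + C * b\<^sup>2"
  proof (cases "A = 0")
    case True
    have "B = 0"
    proof (rule ccontr)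
      assume "B \<noteq> 0"
      \<comment> \<open>With A = 0 the form is affine in \<open>a\<close> along b = 1; this argument
        gives it the value -1.\<close>
      have "A * (- (C + 1) / B)\<^sup>2 + B * (- (C + 1) / B) * 1 + C * 1\<^sup>2 = - 1"
        using True \<open>B \<noteq> 0\<close> by simp
      with nn[of "- (C + 1) / B" 1] show False by linarith
    qed
    then show ?thesis using True by simp
  next
    case False
    \<comment> \<open>The vector (- B, 2A) is where the completed square 2Aa + Bb vanishes, so the
      form reduces there to a multiple of the discriminant.\<close>
    have "A * (A * (- B)\<^sup>2 + B * (- B) * (2 * A) + C * (2 * A)\<^sup>2) = - (B\<^sup>2 - 4 * A * C) * A\<^sup>2"
      by (simp add: power2_eq_square algebra_simps)
    moreover have "0 \<le> A" using nn[of 1 0] by simp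
    ultimately have "0 \<le> - (B\<^sup>2 - 4 * A * C) * A\<^sup>2"
      using nn[of "- B" "2 * A"] by (metis mult_nonneg_nonneg)
    then show ?thesis using False by (simp add: zero_le_mult_iff)
  qed
  show 5: "0 < A * (A * a\<^sup>2 + B * a * b + C * b\<^sup>2)" if "B\<^sup>2 - 4 * A * C < 0" "a \<noteq> 0 \<or> b \<noteq> 0" for a b
  proof -
    have A0: "A \<noteq> 0" using that(1) by auto
    have "0 < (2 * A * a + B * b)\<^sup>2 - (B\<^sup>2 - 4 * A * C) * b\<^sup>2"
    proof (cases "b = 0")
      case True
      then show ?thesis using that(2) A0 by simp
    next
      case False
      then have "(B\<^sup>2 - 4 * A * C) * b\<^sup>2 < 0" using that(1) by (simp add: mult_neg_pos)
      then show ?thesis by (smt (verit) zero_le_power2)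
    qed
    then have "0 < 4 * A * (A * a\<^sup>2 + B * a * b + C * b\<^sup>2)" by (simp only: sq1)
    then have "0 < 4 * (A * (A * a\<^sup>2 + B * a * b + C * b\<^sup>2))" by (simp only: mult.assoc)
    then show ?thesis by (simp only: zero_less_mult_iff) auto
  qed
  show "0 < B\<^sup>2 - 4 * A * C" if p: "0 < A * a\<^sup>2 + B * a * b + C * b\<^sup>2" and n: "A * d\<^sup>2 + B * d * e + C * e\<^sup>2 < 0" for a b d e
  proof (rule ccontr)
    assume "\<not> ?thesis"
    then have le: "B\<^sup>2 - 4 * A * C \<le> 0" by simp
    have nn: "0 \<le> A * (A * a\<^sup>2 + B * a * b + C * b\<^sup>2)" "0 \<le> C * (A * a\<^sup>2 + B * a * b + C * b\<^sup>2)" for a b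
    proof -
      have "(B\<^sup>2 - 4 * A * C) * b\<^sup>2 \<le> 0" "(B\<^sup>2 - 4 * A * C) * a\<^sup>2 \<le> 0" using le by (simp_all add: mult_nonpos_nonneg)
      then have "0 \<le> 4 * A * (A * a\<^sup>2 + B * a * b + C * b\<^sup>2)" "0 \<le> 4 * C * (A * a\<^sup>2 + B * a * b + C * b\<^sup>2)"
        unfolding sq1 sq2 by (smt (verit) zero_le_power2)+
      then show "0 \<le> A * (A * a\<^sup>2 + B * a * b + C * b\<^sup>2)" "0 \<le> C * (A * a\<^sup>2 + B * a * b + C * b\<^sup>2)"
        by (simp_all only: mult.assoc zero_le_mult_iff) auto
    qed
    have "A = 0" "C = 0" using nn[of a b] nn[of d e] p n by (smt (verit) mult_nonneg_nonpos mult_pos_pos mult_neg_neg mult_pos_neg mult_neg_pos zero_le_mult_iff)+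
    then have "B\<^sup>2 \<le> 0" using le by simp
    then have "B = 0" by simp
    then show False using p \<open>A = 0\<close> \<open>C = 0\<close> by simp
  qed
  show "\<exists>a b. (a \<noteq> 0 \<or> b \<noteq> 0) \<and> A * a\<^sup>2 + B * a * b + C * b\<^sup>2 = 0" if ge: "0 \<le> B\<^sup>2 - 4 * A * C"
  proof (cases "A = 0")
    case True
    then have "A * 1\<^sup>2 + B * 1 * 0 + C * 0\<^sup>2 = 0" by simp
    then show ?thesis by (metis zero_neq_one)
  next
    case False
    let ?r = "sqrt (B\<^sup>2 - 4 * A * C)"
    have "4 * A * (A * (- B + ?r)\<^sup>2 + B * (- B + ?r) * (2 * A) + C * (2 * A)\<^sup>2) = (2 * A)\<^sup>2 * (?r\<^sup>2 - (B\<^sup>2 - 4 * A * C))"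
      unfolding sq1 by (simp add: power2_eq_square algebra_simps)
    also have "\<dots> = 0" using ge by simp
    finally have "A * (- B + ?r)\<^sup>2 + B * (- B + ?r) * (2 * A) + C * (2 * A)\<^sup>2 = 0" using False by simp
    then show ?thesis using False by (intro exI[of _ "- B + ?r"] exI[of _ "2 * A"]) simp
  qed
qed

section \<open>Periodic potentials and the discriminant\<close>

text \<open>All conditions hold at every point and not just almost everywhere, which allows
  pointwise estimates and exact shifts. \<open>admissible_normalize\<close> provides such a
  representative for every admissible potential.\<close>

locale periodic_potential =
  fixes X Vp :: real and V :: "real \<Rightarrow> real"
  assumes X_pos: "X > 0"
    and V_meas: "V \<in> borel_measurable lebesgue"
    and V_bounds: "0 \<le> V x" "V x \<le> Vp"
    and V_periodic: "V (x + X) = V x"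
begin

lemma Vp_nonneg: "0 \<le> Vp" using V_bounds[of 0] by linarith

definition qE :: "real \<Rightarrow> real \<Rightarrow> real" where "qE E x = E - V x"

lemma qE_bdd: "bdd_meas (qE E)"
proof (rule bdd_measI)
  show "qE E \<in> borel_measurable lebesgue" unfolding qE_def[abs_def] using V_meas by simp
  show "\<bar>qE E x\<bar> \<le> \<bar>E\<bar> + Vp" for x using V_bounds[of x] unfolding qE_def by linarith
qed

lemma qE_bound: "\<bar>qE E x\<bar> + 1 \<le> \<bar>E\<bar> + Vp + 1"
  using V_bounds[of x] unfolding qE_def by linarith

lemma qE_periodic: "qE E (x + X) = qE E x"
  by (simp add: qE_def V_periodic)

definition adv :: "real \<Rightarrow> real \<Rightarrow> real" where
  "adv E t = pruefer (qE E) t X - t"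

lemma adv_add_pi: "adv E (t + of_int n * pi) = adv E t"
  by (simp add: adv_def pruefer_add_pi[OF qE_bdd])

text \<open>Angles keep their order: if s lies above t' by at most pi, its angle at \<open>X\<close>
  is at most pi above that of t'. Shifting t by multiples of pi reaches this situation without
  changing its advance.\<close>

lemma adv_less_pi: "adv E s < adv E t + pi"
proof -
  \<comment> \<open>The ceiling minus one, rather than the floor, makes t' < s strict, and this
    strictness is the one in the conclusion.\<close>
  define n where "n = \<lceil>(s - t) / pi\<rceil> - 1"
  define t' where "t' = t + of_int n * pi"
  have n: "of_int n < (s - t) / pi" "(s - t) / pi \<le> of_int n + 1" by (simp_all add: n_def) linarith
  then have t': "t' < s" "s \<le> t' + pi" unfolding t'_def by (simp_all add: field_simps)
  have "pruefer (qE E) s X \<le> pruefer (qE E) (t' + pi) X"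
    using pruefer_mono_init(1)[OF qE_bdd pruefer_solution[OF qE_bdd, where ?t0.0=s]
        pruefer_solution[OF qE_bdd, where ?t0.0="t' + pi"], where x=X] t'
    by (cases "s = t' + pi") (auto simp: qE_bdd intro: less_imp_le)
  also have "\<dots> = pruefer (qE E) t' X + pi"
    using pruefer_add_pi[OF qE_bdd, of E t' 1 X] by simp
  finally have "adv E s < adv E t' + pi" using t' by (simp add: adv_def)
  then show ?thesis by (simp add: t'_def adv_add_pi)
qed

lemma adv_continuous: "continuous_on S (adv E)"
proof -
  define C where "C = exp ((\<bar>E\<bar> + Vp + 1) * X)"
  have "\<bar>pruefer (qE E) t X - pruefer (qE E) s X\<bar> \<le> C * \<bar>t - s\<bar>" for s t
    using pruefer_lipschitz[OF qE_bdd qE_bdd pruefer_solution[OF qE_bdd] pruefer_solution[OF qE_bdd],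
        of E "\<bar>E\<bar> + Vp + 1" E 0 X X t s] qE_bound[of E] X_pos
    by (simp add: C_def qE_bdd)
  then have "C-lipschitz_on S (\<lambda>t. pruefer (qE E) t X)"
    by (intro lipschitz_onI) (auto simp: dist_real_def C_def)
  then have "continuous_on S (\<lambda>t. pruefer (qE E) t X)" by (rule lipschitz_on_continuous_on)
  then show ?thesis unfolding adv_def[abs_def] by (intro continuous_intros)
qed

lemma adv_lipschitz_E:
  "\<bar>adv E2 t - adv E1 t\<bar> \<le> exp ((\<bar>E1\<bar> + Vp + 1) * X) * (X * exp ((\<bar>E1\<bar> + Vp + 1) * X)) * \<bar>E2 - E1\<bar>"
  using pruefer_lipschitz[OF qE_bdd qE_bdd pruefer_solution[OF qE_bdd] pruefer_solution[OF qE_bdd],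
        of E1 "\<bar>E1\<bar> + Vp + 1" E2 "\<bar>E2 - E1\<bar>" X X t t] qE_bound[of E1] X_pos
  by (simp add: adv_def qE_bdd mult_ac) (simp add: qE_def)

lemma adv_strict_mono: "E1 < E2 \<Longrightarrow> adv E1 t < adv E2 t"
  using pruefer_strict_mono_potential[OF qE_bdd qE_bdd _ _ X_pos, of E2 E1 "E2 - E1" t]
  by (simp add: adv_def qE_def)

definition adv_max :: "real \<Rightarrow> real" where "adv_max E = (SUP t. adv E t)"
definition adv_min :: "real \<Rightarrow> real" where "adv_min E = (INF t. adv E t)"

lemma adv_reduce: "\<exists>t\<in>{0..pi}. adv E s = adv E t"
proof -
  define t where "t = s + of_int (- \<lfloor>s / pi\<rfloor>) * pi"
  have "of_int \<lfloor>s / pi\<rfloor> * pi \<le> s" "s \<le> (of_int \<lfloor>s / pi\<rfloor> + 1) * pi"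
    by (simp_all flip: pos_le_divide_eq pos_divide_le_eq)
  then have "t \<in> {0..pi}" by (simp add: t_def algebra_simps)
  then show ?thesis using adv_add_pi[of E s "- \<lfloor>s / pi\<rfloor>"] t_def by metis
qed

lemma adv_max: obtains t where "adv E t = adv_max E" "\<And>s. adv E s \<le> adv_max E"
proof -
  obtain t where t: "\<forall>s\<in>{0..pi}. adv E s \<le> adv E t"
    using continuous_attains_sup[OF compact_Icc _ adv_continuous, of 0 pi E] by auto
  then have le: "adv E s \<le> adv E t" for s using adv_reduce[of E s] by auto
  then have "adv_max E = adv E t"
    unfolding adv_max_def by (intro cSup_eq_maximum) auto
  then show thesis using that le by metis
qed

lemma adv_min: obtains t where "adv E t = adv_min E" "\<And>s. adv_min E \<le> adv E s"
proof -
  obtain t where t: "\<forall>s\<in>{0..pi}. adv E t \<le> adv E s"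
    using continuous_attains_inf[OF compact_Icc _ adv_continuous, of 0 pi E] by auto
  then have le: "adv E t \<le> adv E s" for s using adv_reduce[of E s] by auto
  then have "adv_min E = adv E t"
    unfolding adv_min_def by (intro cInf_eq_minimum) auto
  then show thesis using that le by metis
qed

lemma adv_le_max: "adv E s \<le> adv_max E" and adv_ge_min: "adv_min E \<le> adv E s"
  using adv_max[of E] adv_min[of E] by metis+

lemma adv_max_less: "adv_max E < adv_min E + pi"
  using adv_max[of E] adv_min[of E] adv_less_pi by metis

lemma adv_max_strict_mono: "E1 < E2 \<Longrightarrow> adv_max E1 < adv_max E2"
  and adv_min_strict_mono: "E1 < E2 \<Longrightarrow> adv_min E1 < adv_min E2"
  by (metis adv_max adv_le_max adv_strict_mono order_less_le_trans)
    (metis adv_min adv_ge_min adv_strict_mono order_le_less_trans)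

lemma adv_max_mono_iff: "adv_max E1 \<le> adv_max E2 \<longleftrightarrow> E1 \<le> E2"
  and adv_min_mono_iff: "adv_min E1 \<le> adv_min E2 \<longleftrightarrow> E1 \<le> E2"
  using adv_max_strict_mono[of E1 E2] adv_max_strict_mono[of E2 E1]
    adv_min_strict_mono[of E1 E2] adv_min_strict_mono[of E2 E1] by (cases E1 E2 rule: linorder_cases; simp)+

lemma continuous_adv_extrema: "continuous_on S adv_max" "continuous_on S adv_min"
proof -
  define C where "C E = exp ((\<bar>E\<bar> + Vp + 1) * X) * (X * exp ((\<bar>E\<bar> + Vp + 1) * X))" for E
  have L: "\<bar>adv E2 t - adv E1 t\<bar> \<le> C E1 * \<bar>E2 - E1\<bar>" for E1 E2 t
    using adv_lipschitz_E unfolding C_def .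
  have L': "adv E2 t \<le> adv E1 t + C E1 * \<bar>E2 - E1\<bar>" "adv E1 t \<le> adv E2 t + C E1 * \<bar>E2 - E1\<bar>" for E1 E2 t
    using L[of E2 t E1] by (auto simp: abs_le_iff)
  have "\<bar>adv_max E2 - adv_max E1\<bar> \<le> C E1 * \<bar>E2 - E1\<bar>" for E1 E2
  proof -
    obtain t1 where "adv E1 t1 = adv_max E1" by (metis adv_max)
    moreover obtain t2 where "adv E2 t2 = adv_max E2" by (metis adv_max)
    ultimately show ?thesis using L'(1)[of E2 t2 E1] L'(2)[of E1 t1 E2] adv_le_max[of E1 t2] adv_le_max[of E2 t1]
      by (smt (verit))
  qed
  moreover have "\<bar>adv_min E2 - adv_min E1\<bar> \<le> C E1 * \<bar>E2 - E1\<bar>" for E1 E2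
  proof -
    obtain t1 where "adv E1 t1 = adv_min E1" by (metis adv_min)
    moreover obtain t2 where "adv E2 t2 = adv_min E2" by (metis adv_min)
    ultimately show ?thesis using L'(1)[of E2 t1 E1] L'(2)[of E1 t2 E2] adv_ge_min[of E1 t2] adv_ge_min[of E2 t1]
      by (smt (verit))
  qed
  moreover have "isCont f E1" if f: "\<And>E1 E2. \<bar>f E2 - f E1\<bar> \<le> C E1 * \<bar>E2 - E1\<bar>" for f :: "real \<Rightarrow> real" and E1
  proof -
    have "((\<lambda>E2. f E2 - f E1) \<longlongrightarrow> 0) (at E1)"
    proof (rule Lim_null_comparison)
      show "\<forall>\<^sub>F E2 in at E1. norm (f E2 - f E1) \<le> C E1 * \<bar>E2 - E1\<bar>" using f by simp
      have "((\<lambda>E2. C E1 * \<bar>E2 - E1\<bar>) \<longlongrightarrow> C E1 * \<bar>E1 - E1\<bar>) (at E1)" by (intro tendsto_intros)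
      then show "((\<lambda>E2. C E1 * \<bar>E2 - E1\<bar>) \<longlongrightarrow> 0) (at E1)" by simp
    qed
    then show ?thesis by (simp add: isCont_def LIM_zero_iff)
  qed
  ultimately show "continuous_on S adv_max" "continuous_on S adv_min"
    by (blast intro: continuous_at_imp_continuous_on)+
qed

lemma adv_max_pos: "0 < adv_max E"
  using adv_le_max[of E 0] pruefer_pos[OF qE_bdd X_pos, of E] by (simp add: adv_def)

text \<open>The initial angle pi/2 is a barrier when E - V is nonpositive. Together with
  \<open>adv_max_less\<close> this keeps all advances at energy 0 below pi, which later makes the
  gap edges positive.\<close>

lemma adv_min_nonpos: "E \<le> 0 \<Longrightarrow> adv_min E \<le> 0"
proof -
  assume "E \<le> 0"
  then have "qE E x \<le> 0" for x using V_bounds[of x] by (simp add: qE_def)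
  then show ?thesis
    using adv_ge_min[of E "pi/2"] pruefer_le_pi_half[OF qE_bdd, of E X] X_pos by (simp add: adv_def)
qed

text \<open>With \<omega> X = n pi, the energy Vp + \<omega>^2 ensures that E - V is at least
  \<omega>^2, so the constant potential is a lower comparison.\<close>

lemma adv_large: "real n * pi \<le> adv_max (Vp + (real n * pi / X)\<^sup>2)"
proof (cases "n = 0")
  case True
  then show ?thesis using adv_max_pos by (simp add: less_imp_le)
next
  case False
  define \<omega> where "\<omega> = real n * pi / X"
  have \<omega>: "\<omega> > 0" "real n * pi / \<omega> = X" using False X_pos by (simp_all add: \<omega>_def)
  have "real n * pi \<le> pruefer (\<lambda>_. \<omega>\<^sup>2) 0 X" using pruefer_const_ge[OF \<omega>(1), of n] \<omega>(2) by simp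
  also have "\<dots> \<le> pruefer (qE (Vp + \<omega>\<^sup>2)) 0 X"
  proof (rule pruefer_mono_potential[OF bdd_meas_const qE_bdd pruefer_solution[OF bdd_meas_const] pruefer_solution[OF qE_bdd]])
    show "\<omega>\<^sup>2 \<le> qE (Vp + \<omega>\<^sup>2) x" for x using V_bounds[of x] by (simp add: qE_def)
    show "pruefer (\<lambda>x. \<omega>\<^sup>2) 0 0 \<le> pruefer (qE (Vp + \<omega>\<^sup>2)) 0 0" by (simp add: qE_bdd)
    show "0 \<le> X" using X_pos by simp
  qed
  also have "\<dots> \<le> adv_max (Vp + \<omega>\<^sup>2)" using adv_le_max[of "Vp + \<omega>\<^sup>2" 0] by (simp add: adv_def)
  finally show ?thesis by (simp add: \<omega>_def)
qed

lemma adv_max_attains: "n \<ge> 1 \<Longrightarrow> \<exists>E. adv_max E = real n * pi"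
  and adv_min_attains: "\<exists>E. adv_min E = real n * pi"
proof -
  \<comment> \<open>The minimal advance lags behind the maximal one by less than pi, hence the shift
    from n to n + 1.\<close>
  have big: "real n * pi \<le> adv_min (Vp + (real (Suc n) * pi / X)\<^sup>2)" for n
    using adv_large[of "Suc n"] adv_max_less[of "Vp + (real (Suc n) * pi / X)\<^sup>2"] by (simp add: algebra_simps)
  have nn: "0 \<le> Vp + (real n * pi / X)\<^sup>2" for n using Vp_nonneg by simp
  have "adv_min 0 \<le> real n * pi" using adv_min_nonpos[of 0] by (auto intro: order_trans)
  then show "\<exists>E. adv_min E = real n * pi"
    using IVT'[of adv_min 0 "real n * pi" "Vp + (real (Suc n) * pi / X)\<^sup>2"] big[of n]
      nn[of "Suc n"] continuous_adv_extrema(2) by blast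
  assume "n \<ge> 1"
  then have "pi \<le> real n * pi" by simp
  moreover have "adv_max 0 < pi" using adv_max_less[of 0] adv_min_nonpos[of 0] by linarith
  ultimately have "adv_max 0 \<le> real n * pi" by linarith
  then show "\<exists>E. adv_max E = real n * pi"
    using IVT'[of adv_max 0 "real n * pi" "Vp + (real n * pi / X)\<^sup>2"] adv_large[of n] nn[of n]
      continuous_adv_extrema(1) by blast
qed

end

section \<open>Monodromy matrix and discriminant\<close>

lemma sin_add_npi: "sin (x + real n * pi) = (-1) ^ n * sin x"
  by (simp add: sin_add)

lemma has_derivative_of_quadratic_error:
  fixes f :: "real \<Rightarrow> real"
  assumes "\<And>y. \<bar>y - x\<bar> \<le> 1 \<Longrightarrow> \<bar>f y - f x - L * (y - x)\<bar> \<le> C * (y - x)\<^sup>2"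
  shows "(f has_real_derivative L) (at x)"
proof -
  have "((\<lambda>h. (f (x + h) - f x) / h - L) \<longlongrightarrow> 0) (at 0)"
  proof (rule Lim_null_comparison)
    show "\<forall>\<^sub>F h in at 0. norm ((f (x + h) - f x) / h - L) \<le> C * \<bar>h\<bar>"
      unfolding eventually_at
    proof (intro exI[of _ 1] conjI ballI impI)
      fix h :: real assume h: "h \<noteq> 0 \<and> dist h 0 < 1"
      have "(f (x + h) - f x) / h - L = (f (x + h) - f x - L * h) / h"
        using h by (simp add: diff_divide_distrib)
      then have "norm ((f (x + h) - f x) / h - L) = \<bar>f (x + h) - f x - L * h\<bar> / \<bar>h\<bar>"
        by (simp add: abs_divide)
      also have "\<dots> \<le> C * h\<^sup>2 / \<bar>h\<bar>"
        using assms[of "x + h"] h by (intro divide_right_mono) auto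
      also have "\<dots> = C * \<bar>h\<bar>"
      proof -
        have "h\<^sup>2 = \<bar>h\<bar> * \<bar>h\<bar>" by (simp add: power2_eq_square)
        then show ?thesis using h unfolding \<open>h\<^sup>2 = _\<close> by (simp del: abs_mult_self_eq)
      qed
      finally show "norm ((f (x + h) - f x) / h - L) \<le> C * \<bar>h\<bar>" .
    qed simp
    have "((\<lambda>h. C * \<bar>h\<bar>) \<longlongrightarrow> C * \<bar>0\<bar>) (at 0)" by (intro tendsto_intros)
    then show "((\<lambda>h. C * \<bar>h\<bar>) \<longlongrightarrow> 0) (at 0)" by simp
  qed
  then show ?thesis unfolding DERIV_def by (simp add: LIM_zero_iff)
qed

lemma polar_obtain:
  fixes a b :: real
  obtains R t where "a = R * sin t" "b = R * cos t" "R \<ge> 0"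
proof (cases "a = 0 \<and> b = 0")
  case True
  then show thesis using that[of 0 0] by simp
next
  case False
  define R where "R = sqrt (a\<^sup>2 + b\<^sup>2)"
  have pos: "a\<^sup>2 + b\<^sup>2 > 0" using False by (simp add: sum_power2_gt_zero_iff)
  then have R: "R > 0" "R\<^sup>2 = a\<^sup>2 + b\<^sup>2" by (simp_all add: R_def)
  have "(b / R)\<^sup>2 + (a / R)\<^sup>2 = 1"
    unfolding power_divide add_divide_distrib[symmetric] add.commute[of "b\<^sup>2"] R(2)[symmetric]
    using R(1) by simp
  then obtain t where "b / R = cos t" "a / R = sin t" using sincos_total_2pi by metis
  then show thesis using R by (intro that[of R t]) (simp_all add: field_simps)
qed

context periodic_potential
begin

definition "mc E = cf (qE E) X"
definition "mc' E = cf' (qE E) X"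
definition "ms E = sf (qE E) X"
definition "ms' E = sf' (qE E) X"
definition discr :: "real \<Rightarrow> real" where "discr E = mc E + ms' E"

text \<open>The area spanned by a vector of initial values and its image under the monodromy matrix.
  It vanishes exactly at the eigenvectors, and its discriminant is \<open>discr\<^sup>2 - 4\<close>.\<close>

definition mform :: "real \<Rightarrow> real \<Rightarrow> real \<Rightarrow> real" where
  "mform E a b = mc' E * a\<^sup>2 + (ms' E - mc E) * a * b + (- ms E) * b\<^sup>2"

lemma mdet: "mc E * ms' E - mc' E * ms E = 1"
  using fundamental_det[OF qE_bdd, of E X] by (simp add: mc_def mc'_def ms_def ms'_def)

lemma mform_disc: "(ms' E - mc E)\<^sup>2 - 4 * mc' E * (- ms E) = (discr E)\<^sup>2 - 4"
proof -
  have "(ms' E - mc E)\<^sup>2 - 4 * mc' E * (- ms E) = (discr E)\<^sup>2 - 4 * (mc E * ms' E - mc' E * ms E)"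
    by (simp add: discr_def power2_eq_square algebra_simps)
  then show ?thesis by (simp add: mdet)
qed

lemma sol_X: "sol (qE E) t X = mc E * sin t + ms E * cos t"
  "dsol (qE E) t X = mc' E * sin t + ms' E * cos t"
  using sol_repr[OF qE_bdd, of E t X] by (simp_all add: mc_def mc'_def ms_def ms'_def)

text \<open>The bridge between angle and matrix: the sign of the form in direction t shows on which
  side of a multiple of pi the advance lies.\<close>

lemma mform_sin_cos: "mform E (sin t) (cos t) = - exp (log_amp (qE E) t X) * sin (adv E t)"
proof -
  have "mform E (sin t) (cos t) = sin t * dsol (qE E) t X - cos t * sol (qE E) t X"
    by (simp add: mform_def sol_X power2_eq_square algebra_simps)
  also have "\<dots> = - exp (log_amp (qE E) t X) * sin (adv E t)"
    by (simp add: sol_def dsol_def adv_def sin_diff algebra_simps)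
  finally show ?thesis .
qed

lemma mform_scale: "mform E (R * a) (R * b) = R\<^sup>2 * mform E a b"
  by (simp add: mform_def power2_eq_square algebra_simps)

text \<open>The number n pi lies between the extremal advances, which differ by less than pi. So
  every advance is within pi of n pi, where the sine has the sign of the displacement.\<close>

lemma sin_adv_sign:
  assumes "adv_min E \<le> real n * pi" "real n * pi \<le> adv_max E"
  shows "adv E t > real n * pi \<Longrightarrow> (-1) ^ n * sin (adv E t) > 0"
    and "adv E t < real n * pi \<Longrightarrow> (-1) ^ n * sin (adv E t) < 0"
proof -
  define d where "d = adv E t - real n * pi"
  have d: "- pi < d" "d < pi"
    using assms adv_max_less[of E] adv_le_max[of E t] adv_ge_min[of E t] by (simp_all add: d_def)
  have "(-1) ^ n * sin (adv E t) = (-1) ^ n * sin (d + real n * pi)" by (simp add: d_def)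
  also have "\<dots> = (-1) ^ n * (-1) ^ n * sin d" by (simp add: sin_add_npi)
  also have "\<dots> = sin d" by (simp flip: power_mult_distrib)
  finally have *: "(-1) ^ n * sin (adv E t) = sin d" .
  show "adv E t > real n * pi \<Longrightarrow> (-1) ^ n * sin (adv E t) > 0"
    unfolding * using d by (intro sin_gt_zero) (simp_all add: d_def)
  show "adv E t < real n * pi \<Longrightarrow> (-1) ^ n * sin (adv E t) < 0"
    unfolding *
  proof -
    assume "adv E t < real n * pi"
    then have "0 < sin (- d)" using d by (intro sin_gt_zero) (simp_all add: d_def)
    then show "sin d < 0" by (simp only: sin_minus neg_0_less_iff_less)
  qed
qed

lemma mform_sign:
  assumes "adv_min E \<le> real n * pi" "real n * pi \<le> adv_max E"
  shows "adv E t > real n * pi \<Longrightarrow> (-1) ^ n * mform E (sin t) (cos t) < 0"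
    and "adv E t < real n * pi \<Longrightarrow> (-1) ^ n * mform E (sin t) (cos t) > 0"
    and "adv E t = real n * pi \<Longrightarrow> mform E (sin t) (cos t) = 0"
proof -
  have *: "(-1) ^ n * mform E (sin t) (cos t) = - exp (log_amp (qE E) t X) * ((-1) ^ n * sin (adv E t))"
    by (simp add: mform_sin_cos)
  show "adv E t > real n * pi \<Longrightarrow> (-1) ^ n * mform E (sin t) (cos t) < 0"
    unfolding * using sin_adv_sign(1)[OF assms, of t] by (intro mult_neg_pos) auto
  show "adv E t < real n * pi \<Longrightarrow> (-1) ^ n * mform E (sin t) (cos t) > 0"
    unfolding * using sin_adv_sign(2)[OF assms, of t] by (intro mult_neg_neg) auto
  show "adv E t = real n * pi \<Longrightarrow> mform E (sin t) (cos t) = 0"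
    by (simp add: mform_sin_cos)
qed

text \<open>One advance below and one above n pi make the form \<open>mform\<close> indefinite, so
  its discriminant is positive.\<close>

lemma discr_gt_2:
  assumes "adv_min E < real n * pi" "real n * pi < adv_max E"
  shows "2 < \<bar>discr E\<bar>"
proof -
  obtain s t where s: "adv E s = adv_min E" and t: "adv E t = adv_max E" by (metis adv_min adv_max)
  have "(-1) ^ n * mform E (sin t) (cos t) < 0" "(-1) ^ n * mform E (sin s) (cos s) > 0"
    using mform_sign[of E n t] mform_sign[of E n s] assms s t by auto
  then have "(0 < mform E (sin s) (cos s) \<and> mform E (sin t) (cos t) < 0) \<or>
      (0 < mform E (sin t) (cos t) \<and> mform E (sin s) (cos s) < 0)"
    by (cases "even n") auto
  then have "\<exists>a b d e. 0 < mform E a b \<and> mform E d e < 0" by blast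
  then have "0 < (discr E)\<^sup>2 - 4"
    using quadratic_form_disc(3) unfolding mform_def mform_disc[symmetric] by blast
  then have "2\<^sup>2 < (discr E)\<^sup>2" by simp
  then show ?thesis using power2_less_imp_less[of 2 "\<bar>discr E\<bar>"] by simp
qed

lemma sol_at_eigendirection:
  assumes "adv E t = real n * pi"
  shows "sol (qE E) t X = (-1) ^ n * exp (log_amp (qE E) t X) * sin t"
    "dsol (qE E) t X = (-1) ^ n * exp (log_amp (qE E) t X) * cos t"
proof -
  have "pruefer (qE E) t X = t + real n * pi" using assms by (simp add: adv_def)
  then show "sol (qE E) t X = (-1) ^ n * exp (log_amp (qE E) t X) * sin t"
    "dsol (qE E) t X = (-1) ^ n * exp (log_amp (qE E) t X) * cos t"
    by (simp_all add: sol_def dsol_def sin_add cos_add)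
qed

text \<open>The direction t is an eigenvector of the monodromy matrix with eigenvalue \<mu>, and the
  determinant of that matrix is 1.\<close>

lemma discr_eigenvalue:
  assumes "adv E t = real n * pi"
  defines "\<mu> \<equiv> (-1) ^ n * exp (log_amp (qE E) t X)"
  shows "discr E * \<mu> = \<mu>\<^sup>2 + 1"
proof -
  have 1: "(mc E - \<mu>) * sin t + ms E * cos t = 0" "mc' E * sin t + (ms' E - \<mu>) * cos t = 0"
    using sol_at_eigendirection[OF assms(1)] by (simp_all add: sol_X \<mu>_def algebra_simps)
  have "((mc E - \<mu>) * (ms' E - \<mu>) - mc' E * ms E) * sin t =
      (ms' E - \<mu>) * ((mc E - \<mu>) * sin t + ms E * cos t) - ms E * (mc' E * sin t + (ms' E - \<mu>) * cos t)"
    by (simp add: algebra_simps)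
  moreover have "((mc E - \<mu>) * (ms' E - \<mu>) - mc' E * ms E) * cos t =
      (mc E - \<mu>) * (mc' E * sin t + (ms' E - \<mu>) * cos t) - mc' E * ((mc E - \<mu>) * sin t + ms E * cos t)"
    by (simp add: algebra_simps)
  moreover have "sin t \<noteq> 0 \<or> cos t \<noteq> 0" using sin_zero_abs_cos_one[of t] by auto
  ultimately have "(mc E - \<mu>) * (ms' E - \<mu>) - mc' E * ms E = 0" unfolding 1 by auto
  then have "(mc E * ms' E - mc' E * ms E) - discr E * \<mu> + \<mu>\<^sup>2 = 0"
    by (simp add: discr_def power2_eq_square algebra_simps)
  then show ?thesis by (simp add: mdet)
qed

text \<open>All advances lie on one side of n pi and one equals it. The form is therefore
  semidefinite with a nontrivial zero, its discriminant vanishes, and the discriminant of the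
  monodromy matrix is 2 or -2.\<close>

lemma discr_at_edge:
  assumes "adv_min E = real n * pi \<or> adv_max E = real n * pi"
  shows "discr E = 2 * (-1) ^ n"
proof -
  obtain s t where s: "adv E s = adv_min E" and t: "adv E t = adv_max E" by (metis adv_min adv_max)
  have le: "adv_min E \<le> adv_max E" using adv_le_max[of E s] s by simp
  then have n: "adv_min E \<le> real n * pi" "real n * pi \<le> adv_max E" using assms by auto
  obtain z where z: "adv E z = real n * pi" using assms s t by metis
  have "0 \<le> (ms' E - mc E)\<^sup>2 - 4 * mc' E * (- ms E)"
    using mform_sign(3)[OF n z] sin_zero_abs_cos_one[of z] unfolding mform_def
    by (intro quadratic_form_disc(2)[of _ "sin z" _ "cos z"]) auto
  then have ge: "4 \<le> (discr E)\<^sup>2" unfolding mform_disc by simp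
  have "(discr E)\<^sup>2 \<le> 4"
  proof (rule ccontr)
    assume "\<not> ?thesis"
    \<comment> \<open>The sign that makes the semidefinite form nonnegative: it depends on the
      parity of n and on whether the advances lie above or below n pi.\<close>
    define k :: real where "k = (if adv_min E = real n * pi then - ((-1) ^ n) else (-1) ^ n)"
    have "0 \<le> k * mform E (sin x) (cos x)" for x
    proof (cases "adv_min E = real n * pi")
      case True
      then have "adv E x = real n * pi \<or> adv E x > real n * pi" using adv_ge_min[of E x] by auto
      then show ?thesis using mform_sign[OF n, of x] True by (auto simp: k_def)
    next
      case False
      then have "adv E x = real n * pi \<or> adv E x < real n * pi" using adv_le_max[of E x] assms by auto
      then show ?thesis using mform_sign[OF n, of x] False by (auto simp: k_def)
    qed
    then have "0 \<le> R\<^sup>2 * (k * mform E (sin x) (cos x))" for x R by simp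
    then have "0 \<le> k * mform E (R * sin x) (R * cos x)" for x R unfolding mform_scale by (simp only: mult.left_commute)
    then have "0 \<le> k * mform E a b" for a b by (metis polar_obtain)
    then have "0 \<le> k * mc' E * a\<^sup>2 + k * (ms' E - mc E) * a * b + k * (- ms E) * b\<^sup>2" for a b
      by (simp add: mform_def algebra_simps)
    from quadratic_form_disc(1)[OF this]
    have "k\<^sup>2 * ((ms' E - mc E)\<^sup>2 - 4 * mc' E * (- ms E)) \<le> 0"
      by (simp add: power2_eq_square algebra_simps)
    moreover have "k\<^sup>2 = 1" by (cases "even n") (auto simp: k_def)
    ultimately show False using \<open>\<not> (discr E)\<^sup>2 \<le> 4\<close> unfolding mform_disc by simp
  qed
  with ge have "(discr E)\<^sup>2 = 2\<^sup>2" by simp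
  then have d: "discr E = 2 \<or> discr E = - 2" using power2_eq_iff by blast
  \<comment> \<open>The real eigenvalue \<mu> decides between 2 and -2: the product discr E * \<mu>
    = \<mu>^2 + 1 is positive, and \<mu> has the sign (-1)^n.\<close>
  define \<mu> where "\<mu> = (-1) ^ n * exp (log_amp (qE E) z X)"
  have "discr E * \<mu> > 0" using discr_eigenvalue[OF z] by (simp add: \<mu>_def add_nonneg_pos)
  then have "0 < discr E * (-1) ^ n * exp (log_amp (qE E) z X)" by (simp only: \<mu>_def mult.assoc)
  then have "discr E * (-1) ^ n > 0" by (rule zero_less_mult_pos2) simp
  then show ?thesis using d by (cases "even n") auto
qed

lemma adv_pi_multiple_nat:
  assumes "adv E t = of_int j * pi"
  obtains n :: nat where "adv E t = real n * pi" "adv_min E \<le> real n * pi" "real n * pi \<le> adv_max E"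
proof -
  have "- pi < of_int j * pi"
    using adv_max_less[of E] adv_max_pos[of E] adv_ge_min[of E t] assms by linarith
  then have "(-1) * pi < of_int j * pi" by simp
  then have "- 1 < real_of_int j" unfolding mult_less_cancel_right by simp
  then have "j \<ge> 0" by simp
  then show thesis using that[of "nat j"] adv_ge_min[of E t] adv_le_max[of E t] assms by simp
qed

text \<open>Otherwise the form would have a nontrivial zero, and the advance in that direction would
  be a multiple of pi.\<close>

lemma discr_less_2:
  assumes "\<And>n::nat. \<not> (adv_min E \<le> real n * pi \<and> real n * pi \<le> adv_max E)"
  shows "\<bar>discr E\<bar> < 2"
proof (rule ccontr)
  assume "\<not> ?thesis"
  then have "2\<^sup>2 \<le> \<bar>discr E\<bar>\<^sup>2" by (intro power_mono) auto
  then have "0 \<le> (discr E)\<^sup>2 - 4" by simp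
  from quadratic_form_disc(4)[OF this[folded mform_disc]]
  obtain a b where ab: "a \<noteq> 0 \<or> b \<noteq> 0" "mform E a b = 0" unfolding mform_def by blast
  obtain R t where R: "a = R * sin t" "b = R * cos t" using polar_obtain by metis
  then have "mform E (sin t) (cos t) = 0" using ab by (auto simp: mform_scale)
  then have "sin (adv E t) = 0" by (simp add: mform_sin_cos)
  then obtain j :: int where "adv E t = of_int j * pi" by (auto simp: sin_zero_iff_int2)
  then show False using adv_pi_multiple_nat assms by metis
qed

text \<open>A diagonal matrix with determinant 1 and trace in [-2, 2] is the identity or its
  negative. Every direction is then an eigenvector, so all advances are the same multiple of
  pi.\<close>

lemma discr_le_2_D:
  assumes "ms E = 0" "mc' E = 0" "\<bar>discr E\<bar> \<le> 2"
  shows "mc E = ms' E" "\<bar>discr E\<bar> = 2" "\<And>t. \<exists>n::nat. adv E t = real n * pi" "adv_min E = adv_max E"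
proof -
  have "\<bar>discr E\<bar>\<^sup>2 \<le> 2\<^sup>2" using assms(3) by (intro power_mono) auto
  then have "(ms' E - mc E)\<^sup>2 \<le> 0" using mform_disc[of E] assms by simp
  then show eq: "mc E = ms' E" by simp
  then have "(mc E)\<^sup>2 = 1" using mdet[of E] assms by (simp add: power2_eq_square)
  then have "mc E = 1 \<or> mc E = -1" by (simp add: power2_eq_1_iff)
  then show "\<bar>discr E\<bar> = 2" using eq by (auto simp: discr_def)
  have "mform E (sin t) (cos t) = 0" for t by (simp add: mform_def assms eq)
  then have "sin (adv E t) = 0" for t by (simp add: mform_sin_cos)
  then show ad: "\<exists>n::nat. adv E t = real n * pi" for t using adv_pi_multiple_nat by (metis sin_zero_iff_int2)
  obtain s t where s: "adv E s = adv_min E" and t: "adv E t = adv_max E" by (metis adv_min adv_max)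
  obtain i j :: nat where ij: "adv_min E = real i * pi" "adv_max E = real j * pi" using ad[of s] ad[of t] s t by auto
  have "real j * pi < real i * pi + pi" using adv_max_less[of E] ij by simp
  also have "\<dots> = real (Suc i) * pi" by (simp add: algebra_simps)
  finally have "j < Suc i" unfolding mult_less_cancel_right by simp
  moreover have "i \<le> j" using adv_le_max[of E s] s ij by simp
  ultimately show "adv_min E = adv_max E" using ij by simp
qed

lemma monodromy_scalar:
  assumes "adv_min E = real n * pi" "adv_max E = real n * pi"
  shows "ms E = 0" "mc' E = 0"
proof -
  have "adv E t = real n * pi" for t using adv_le_max[of E t] adv_ge_min[of E t] assms by simp
  then have "mform E (sin t) (cos t) = 0" for t by (simp add: mform_sin_cos)
  from this[of 0] this[of "pi/2"] show "ms E = 0" "mc' E = 0" by (simp_all add: mform_def)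
qed

text \<open>Bands are numbered from 1. Band n and band n + 1 share an energy only when all advances
  there equal n pi, that is, at a closed gap.\<close>

definition in_band :: "nat \<Rightarrow> real \<Rightarrow> bool" where
  "in_band n E \<longleftrightarrow> (real n - 1) * pi \<le> adv_min E \<and> adv_max E \<le> real n * pi"

text \<open>The number of bands through an energy equals the dimension of the corresponding Bloch
  eigenspace: an energy lies in two bands exactly when the monodromy matrix is the identity or its
  negative.\<close>

lemma card_bands:
  assumes "\<bar>discr E\<bar> \<le> 2"
  shows "finite {n. n \<ge> 1 \<and> in_band n E}"
    "card {n. n \<ge> 1 \<and> in_band n E} = (if ms E = 0 \<and> mc' E = 0 then 2 else 1)"
proof -
  define a where "a = adv_min E / pi"
  define b where "b = adv_max E / pi"
  have ab: "adv_min E = a * pi" "adv_max E = b * pi" by (simp_all add: a_def b_def)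
  have band: "in_band n E \<longleftrightarrow> real n - 1 \<le> a \<and> b \<le> real n" for n
    by (simp add: in_band_def ab)
  have "b * pi < (a + 1) * pi" using adv_max_less[of E] by (simp add: ab algebra_simps)
  then have b1: "b < a + 1" by simp
  have b0: "0 < b" using adv_max_pos[of E] by (simp add: ab zero_less_mult_iff)
  have le: "a \<le> b" by (metis ab adv_le_max adv_max adv_ge_min mult_le_cancel_right_pos order_trans pi_gt_zero)
  have strict: "\<not> (a < real n \<and> real n < b)" for n
    using discr_gt_2[of E n] assms by (auto simp: ab)
  \<comment> \<open>By \<open>strict\<close> no multiple of pi lies strictly between the extremal
    advances, so a multiple in range sits at one end or at both.\<close>
  consider (none) "\<And>n::nat. \<not> (a \<le> real n \<and> real n \<le> b)" | (both) n :: nat where "a = real n" "b = real n"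
    | (left) n :: nat where "a = real n" "real n < b" | (right) n :: nat where "a < real n" "b = real n"
    using strict by (metis order_le_less)
  then have "\<exists>S. {n. n \<ge> 1 \<and> in_band n E} = S \<and> finite S \<and> card S = (if ms E = 0 \<and> mc' E = 0 then 2 else 1)"
  proof cases
    case none
    define n where "n = nat \<lceil>b\<rceil>"
    have n: "real n - 1 < b" "b \<le> real n" "n \<ge> 1"
      using b0 unfolding n_def by linarith+
    have "\<not> (a \<le> real (n - 1) \<and> real (n - 1) \<le> b)" by (rule none)
    then have na: "real n - 1 < a" using n by (auto simp: of_nat_diff)
    have "{n. n \<ge> 1 \<and> in_band n E} = {n}"
    proof -
      have "k = n" if "real k - 1 \<le> a" "b \<le> real k" for k :: nat
      proof -
        have "real k < real n + 1" "real n < real k + 1" using that n na le none[of n] by linarith+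
        then show ?thesis by linarith
      qed
      then show ?thesis unfolding band using n na by auto
    qed
    moreover have "\<bar>discr E\<bar> < 2" using none by (intro discr_less_2) (simp add: ab)
    then have "\<not> (ms E = 0 \<and> mc' E = 0)" using discr_le_2_D(2)[of E] assms by auto
    ultimately show ?thesis by auto
  next
    case (both n)
    have "{n. n \<ge> 1 \<and> in_band n E} = {n, Suc n}"
      unfolding band using both b0 by auto
    moreover have "ms E = 0" "mc' E = 0" using monodromy_scalar[of E n] both by (simp_all add: ab)
    ultimately show ?thesis by auto
  next
    case (left n)
    have "{n. n \<ge> 1 \<and> in_band n E} = {Suc n}"
      unfolding band using left b1 by auto
    moreover have "\<not> (ms E = 0 \<and> mc' E = 0)"
      using discr_le_2_D(4)[of E] assms left by (auto simp: ab)
    ultimately show ?thesis by auto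
  next
    case (right n)
    have "{n. n \<ge> 1 \<and> in_band n E} = {n}"
      unfolding band using right b1 b0 by auto
    moreover have "\<not> (ms E = 0 \<and> mc' E = 0)"
      using discr_le_2_D(4)[of E] assms right by (auto simp: ab)
    ultimately show ?thesis by auto
  qed
  then show "finite {n. n \<ge> 1 \<and> in_band n E}"
    "card {n. n \<ge> 1 \<and> in_band n E} = (if ms E = 0 \<and> mc' E = 0 then 2 else 1)" by metis+
qed

section \<open>Derivative of the discriminant and its monotonicity on a band\<close>

definition sol_bd :: "real \<Rightarrow> real" where
  "sol_bd E = exp ((\<bar>E\<bar> + Vp + 2) * X)"

lemma sol_bd_ge_1: "1 \<le> sol_bd E"
  using X_pos Vp_nonneg by (simp add: sol_bd_def)

lemma sol_le_bd:
  assumes "\<bar>E' - E\<bar> \<le> 1" "0 \<le> x" "x \<le> X"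
  shows "\<bar>sol (qE E') t x\<bar> \<le> sol_bd E" "\<bar>dsol (qE E') t x\<bar> \<le> sol_bd E"
proof -
  \<comment> \<open>Energies up to distance 1 from \<open>E\<close> share one bound, whence the 2 in
    \<open>sol_bd\<close>.\<close>
  have "\<bar>qE E' x\<bar> + 1 \<le> \<bar>E\<bar> + Vp + 2" for x
    using qE_bound[of E' x] assms(1) by linarith
  from sol_bound[OF qE_bdd this assms(2,3)] show "\<bar>sol (qE E') t x\<bar> \<le> sol_bd E" "\<bar>dsol (qE E') t x\<bar> \<le> sol_bd E"
    by (simp_all add: sol_bd_def)
qed

lemma variation_term_le:
  assumes "primitive P (\<lambda>x. (qE E x - qE E' x) * (f x * g x))" "P 0 = 0"
    and "\<And>x. x \<in> {0..X} \<Longrightarrow> \<bar>f x\<bar> \<le> B" "\<And>x. x \<in> {0..X} \<Longrightarrow> \<bar>g x\<bar> \<le> C" "x \<in> {0..X}"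
  shows "\<bar>P x\<bar> \<le> \<bar>E' - E\<bar> * (B * C * X)"
proof -
  have BC: "0 \<le> B" "0 \<le> C" using assms(3)[of 0] assms(4)[of 0] X_pos by auto
  have "norm (P x - P 0) \<le> (\<bar>E' - E\<bar> * (B * C)) * (x - 0)"
  proof (rule primitive_norm_diff_le[OF assms(1)])
    fix y assume "y \<in> {0..x}"
    then have y: "y \<in> {0..X}" using assms(5) by auto
    have "\<bar>f y\<bar> * \<bar>g y\<bar> \<le> B * C"
      using assms(3,4)[OF y] BC by (intro mult_mono) auto
    then have "\<bar>qE E y - qE E' y\<bar> * (\<bar>f y\<bar> * \<bar>g y\<bar>) \<le> \<bar>E' - E\<bar> * (B * C)"
      by (rule mult_mono[rotated]) (simp_all add: qE_def)
    then show "norm ((qE E y - qE E' y) * (f y * g y)) \<le> \<bar>E' - E\<bar> * (B * C)"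
      by (simp add: abs_mult)
  qed (use assms(5) in auto)
  also have "\<dots> \<le> (\<bar>E' - E\<bar> * (B * C)) * X"
    using BC assms(5) by (intro mult_left_mono) auto
  finally show ?thesis using assms(2) by (simp add: mult_ac)
qed

lemma sol_lipschitz_E:
  assumes "\<bar>E' - E\<bar> \<le> 1" "x \<in> {0..X}"
  shows "\<bar>sol (qE E') t x - sol (qE E) t x\<bar> \<le> \<bar>E' - E\<bar> * (2 * sol_bd E ^ 3 * X)"
proof -
  let ?B = "sol_bd E"
  obtain P R where P: "primitive P (\<lambda>x. (qE E x - qE E' x) * (cf (qE E) x * sol (qE E') t x))" "P 0 = 0"
    and R: "primitive R (\<lambda>x. (qE E x - qE E' x) * (sf (qE E) x * sol (qE E') t x))" "R 0 = 0"
    and eq: "\<And>x. sol (qE E') t x = cf (qE E) x * sol (qE E') t 0 + sf (qE E) x * dsol (qE E') t 0 + sf (qE E) x * P x - cf (qE E) x * R x"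
    by (rule variation_of_constants[OF qE_bdd[of E] solves_sol[OF qE_bdd[of E'], of t]]) (rule that)
  have Px: "\<bar>P x\<bar> \<le> \<bar>E' - E\<bar> * (?B * ?B * X)"
    using sol_le_bd[of E E] sol_le_bd[OF assms(1)] by (intro variation_term_le[OF P _ _ assms(2)]) auto
  have Rx: "\<bar>R x\<bar> \<le> \<bar>E' - E\<bar> * (?B * ?B * X)"
    using sol_le_bd[of E E] sol_le_bd[OF assms(1)] by (intro variation_term_le[OF R _ _ assms(2)]) auto
  have "sol (qE E') t x - sol (qE E) t x = sf (qE E) x * P x - cf (qE E) x * R x"
    using eq[of x] sol_repr(1)[OF qE_bdd, of E t x] by (simp add: qE_bdd)
  also have "\<bar>\<dots>\<bar> \<le> \<bar>sf (qE E) x\<bar> * \<bar>P x\<bar> + \<bar>cf (qE E) x\<bar> * \<bar>R x\<bar>"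
    by (metis abs_mult abs_triangle_ineq4)
  also have "\<dots> \<le> ?B * (\<bar>E' - E\<bar> * (?B * ?B * X)) + ?B * (\<bar>E' - E\<bar> * (?B * ?B * X))"
    using sol_le_bd[of E E x] assms(2) Px Rx sol_bd_ge_1[of E] by (intro add_mono mult_mono) auto
  also have "\<dots> = \<bar>E' - E\<bar> * (2 * ?B ^ 3 * X)" by (simp add: power3_eq_cube)
  finally show ?thesis .
qed

text \<open>Replacing the solution at E' by the one at E costs a second factor E' - E by
  \<open>sol_lipschitz_E\<close>, in addition to the one already in the integrand.\<close>

lemma variation_term_approx:
  assumes P: "primitive P (\<lambda>x. (qE E x - qE E' x) * (sol (qE E) s x * sol (qE E') t x))" "P 0 = 0"
    and H: "primitive H (\<lambda>x. sol (qE E) s x * sol (qE E) t x)" "H 0 = 0"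
    and E: "\<bar>E' - E\<bar> \<le> 1"
  shows "\<bar>P X + (E' - E) * H X\<bar> \<le> 2 * sol_bd E ^ 4 * X\<^sup>2 * (E' - E)\<^sup>2"
proof -
  let ?B = "sol_bd E"
  have "primitive (\<lambda>x. P x + (E' - E) * H x)
     (\<lambda>x. (qE E x - qE E' x) * (sol (qE E) s x * sol (qE E') t x) + (E' - E) * (sol (qE E) s x * sol (qE E) t x))"
    by (intro primitive_add P primitive_cmult H)
  then have "primitive (\<lambda>x. P x + (E' - E) * H x)
     (\<lambda>x. (qE E x - qE E' x) * (sol (qE E) s x * (sol (qE E') t x - sol (qE E) t x)))"
    by (rule primitive_cong) (simp_all add: qE_def algebra_simps)
  from variation_term_le[OF this, of ?B "\<bar>E' - E\<bar> * (2 * ?B ^ 3 * X)" X]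
  have "\<bar>P X + (E' - E) * H X\<bar> \<le> \<bar>E' - E\<bar> * (?B * (\<bar>E' - E\<bar> * (2 * ?B ^ 3 * X)) * X)"
    using P(2) H(2) sol_le_bd[of E E] sol_lipschitz_E[OF E] X_pos by simp
  also have "\<dots> = 2 * ?B ^ 4 * X\<^sup>2 * \<bar>E' - E\<bar>\<^sup>2"
    by (simp add: power2_eq_square power4_eq_xxxx power3_eq_cube del: abs_mult_self_eq)
  finally show ?thesis by simp
qed

text \<open>By variation of constants the derivative of the discriminant is minus the integral over a
  period of a quadratic form in the fundamental solutions whose discriminant is \<open>discr\<^sup>2 - 4\<close>.\<close>

lemma discr_has_derivative:
  obtains L where "(discr has_real_derivative L) (at E)" "\<bar>discr E\<bar> < 2 \<Longrightarrow> L \<noteq> 0"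
proof -
  let ?c = "cf (qE E)" and ?s = "sf (qE E)"
  have ex: "\<exists>H. primitive H (\<lambda>x. sol (qE E) s x * sol (qE E) t x) \<and> H 0 = 0" for s t
  proof -
    have "loc_bdd (\<lambda>x. sol (qE E) s x * sol (qE E) t x)"
      by (intro loc_bdd_continuous continuous_intros solves_continuous[OF solves_sol[OF qE_bdd]])
    then show ?thesis using loc_bdd_has_primitive by blast
  qed
  then obtain H where H: "\<And>s t. primitive (H s t) (\<lambda>x. sol (qE E) s x * sol (qE E) t x)" "\<And>s t. H s t 0 = 0"
    by metis
  let ?Hcc = "H (pi/2) (pi/2)" and ?Hsc = "H 0 (pi/2)" and ?Hcs = "H (pi/2) 0" and ?Hss = "H 0 0"
  \<comment> \<open>Read off from the expansion discr E' - discr E = ms Pc - mc Rc + ms' Ps - mc' Rs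
    at \<open>X\<close>: each of these four terms is -(E' - E) times the matching integral
    \<open>H\<close>, up to a quadratic error.\<close>
  define L where "L = - (ms E * ?Hcc X - mc E * ?Hsc X + ms' E * ?Hcs X - mc' E * ?Hss X)"
  define K where "K = 2 * sol_bd E ^ 4 * X\<^sup>2"
  define C where "C = (\<bar>ms E\<bar> + \<bar>mc E\<bar> + \<bar>ms' E\<bar> + \<bar>mc' E\<bar>) * K"
  have "\<bar>discr E' - discr E - L * (E' - E)\<bar> \<le> C * (E' - E)\<^sup>2" if E': "\<bar>E' - E\<bar> \<le> 1" for E'
  proof -
    obtain Pc Rc where Pc: "primitive Pc (\<lambda>x. (qE E x - qE E' x) * (?c x * cf (qE E') x))" "Pc 0 = 0"
      and Rc: "primitive Rc (\<lambda>x. (qE E x - qE E' x) * (?s x * cf (qE E') x))" "Rc 0 = 0"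
      and c: "\<And>x. cf (qE E') x = ?c x * cf (qE E') 0 + ?s x * cf' (qE E') 0 + ?s x * Pc x - ?c x * Rc x"
      by (rule variation_of_constants[OF qE_bdd[of E] solves_sol[OF qE_bdd[of E'], of "pi/2"]]) (rule that)
    obtain Ps Rs where Ps: "primitive Ps (\<lambda>x. (qE E x - qE E' x) * (?c x * sf (qE E') x))" "Ps 0 = 0"
      and Rs: "primitive Rs (\<lambda>x. (qE E x - qE E' x) * (?s x * sf (qE E') x))" "Rs 0 = 0"
      and s: "\<And>x. sf' (qE E') x = cf' (qE E) x * sf (qE E') 0 + sf' (qE E) x * sf' (qE E') 0 + sf' (qE E) x * Ps x - cf' (qE E) x * Rs x"
      by (rule variation_of_constants[OF qE_bdd[of E] solves_sol[OF qE_bdd[of E'], of 0]]) (rule that)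
    have approx: "\<bar>Pc X + (E' - E) * ?Hcc X\<bar> \<le> K * (E' - E)\<^sup>2" "\<bar>Rc X + (E' - E) * ?Hsc X\<bar> \<le> K * (E' - E)\<^sup>2"
      "\<bar>Ps X + (E' - E) * ?Hcs X\<bar> \<le> K * (E' - E)\<^sup>2" "\<bar>Rs X + (E' - E) * ?Hss X\<bar> \<le> K * (E' - E)\<^sup>2"
      unfolding K_def by (rule variation_term_approx[OF Pc H(1) H(2) E'] variation_term_approx[OF Rc H(1) H(2) E']
          variation_term_approx[OF Ps H(1) H(2) E'] variation_term_approx[OF Rs H(1) H(2) E'])+
    have tri: "\<bar>a - b + c - d\<bar> \<le> \<bar>a\<bar> + \<bar>b\<bar> + \<bar>c\<bar> + \<bar>d\<bar>" for a b c d :: real by linarith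
    have "discr E' - discr E = ms E * Pc X - mc E * Rc X + ms' E * Ps X - mc' E * Rs X"
      using c[of X] s[of X] by (simp add: discr_def mc_def ms_def mc'_def ms'_def qE_bdd)
    then have eq: "discr E' - discr E - L * (E' - E) = ms E * (Pc X + (E' - E) * ?Hcc X) - mc E * (Rc X + (E' - E) * ?Hsc X)
        + ms' E * (Ps X + (E' - E) * ?Hcs X) - mc' E * (Rs X + (E' - E) * ?Hss X)"
      by (simp add: L_def algebra_simps)
    have "\<bar>discr E' - discr E - L * (E' - E)\<bar> \<le> \<bar>ms E * (Pc X + (E' - E) * ?Hcc X)\<bar> + \<bar>mc E * (Rc X + (E' - E) * ?Hsc X)\<bar>
        + \<bar>ms' E * (Ps X + (E' - E) * ?Hcs X)\<bar> + \<bar>mc' E * (Rs X + (E' - E) * ?Hss X)\<bar>"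
      unfolding eq by (rule tri)
    also have "\<dots> \<le> \<bar>ms E\<bar> * (K * (E' - E)\<^sup>2) + \<bar>mc E\<bar> * (K * (E' - E)\<^sup>2)
        + \<bar>ms' E\<bar> * (K * (E' - E)\<^sup>2) + \<bar>mc' E\<bar> * (K * (E' - E)\<^sup>2)"
      unfolding abs_mult by (intro add_mono mult_left_mono approx abs_ge_zero)
    also have "\<dots> = C * (E' - E)\<^sup>2" by (simp add: C_def algebra_simps)
    finally show ?thesis .
  qed
  then have "(discr has_real_derivative L) (at E)"
    by (rule has_derivative_of_quadratic_error)
  moreover have "L \<noteq> 0" if d: "\<bar>discr E\<bar> < 2"
  proof -
    have "\<bar>discr E\<bar>\<^sup>2 < 2\<^sup>2" using d by (intro power_strict_mono) auto
    then have neg: "(ms' E - mc E)\<^sup>2 - 4 * ms E * (- mc' E) < 0" using mform_disc[of E] by (simp add: mult_ac)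
    \<comment> \<open>Multiplying the definite form by its leading coefficient \<open>ms E\<close>
      fixes its sign. The vector of fundamental solutions never vanishes because of
      \<open>fundamental_det\<close>.\<close>
    define f where "f x = ms E * (ms E * (?c x)\<^sup>2 + (ms' E - mc E) * ?c x * ?s x + (- mc' E) * (?s x)\<^sup>2)" for x
    have pos: "0 < f x" for x
      unfolding f_def using fundamental_det[OF qE_bdd, of E x]
      by (intro quadratic_form_disc(5)[OF neg]) auto
    have "primitive (\<lambda>x. ms E * (ms E * ?Hcc x - mc E * ?Hsc x + ms' E * ?Hcs x - mc' E * ?Hss x))
       (\<lambda>x. ms E * (ms E * (?c x * ?c x) - mc E * (?s x * ?c x) + ms' E * (?c x * ?s x) - mc' E * (?s x * ?s x)))"
      by (intro primitive_cmult primitive_diff primitive_add H)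
    then have pf: "primitive (\<lambda>x. ms E * (ms E * ?Hcc x - mc E * ?Hsc x + ms' E * ?Hcs x - mc' E * ?Hss x)) f"
      by (rule primitive_cong) (simp_all add: f_def power2_eq_square algebra_simps)
    have cf: "continuous_on {0..X} f"
      unfolding f_def by (intro continuous_intros solves_continuous[OF solves_sol[OF qE_bdd]])
    have "ms E * (ms E * ?Hcc 0 - mc E * ?Hsc 0 + ms' E * ?Hcs 0 - mc' E * ?Hss 0) <
       ms E * (ms E * ?Hcc X - mc E * ?Hsc X + ms' E * ?Hcs X - mc' E * ?Hss X)"
      using pos[of 0] by (intro primitive_strict_mono[OF pf X_pos cf less_imp_le[OF pos], of 0]) (use X_pos in auto)
    then have "0 < ms E * - L" by (simp add: H(2) L_def)
    then show ?thesis by auto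
  qed
  ultimately show thesis using that by blast
qed

lemma discr_continuous: "continuous_on S discr"
proof -
  have "isCont discr E" for E using discr_has_derivative[of E] DERIV_isCont by metis
  then show ?thesis by (simp add: continuous_at_imp_continuous_on)
qed

lemma band_ends:
  assumes "n \<ge> 1"
  obtains El Er where "El < Er" "adv_min El = real (n - 1) * pi" "adv_max Er = real n * pi"
    "\<And>E. in_band n E \<longleftrightarrow> El \<le> E \<and> E \<le> Er"
proof -
  obtain El where El: "adv_min El = real (n - 1) * pi" using adv_min_attains by blast
  obtain Er where Er: "adv_max Er = real n * pi" using adv_max_attains[OF assms] by blast
  have n: "real (n - 1) = real n - 1" using assms by (simp add: of_nat_diff)
  have "adv_min El < adv_min Er" using adv_max_less[of Er] El Er n by (simp add: algebra_simps)
  then have "El < Er" using adv_min_mono_iff[of Er El] by (simp add: not_le)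
  moreover have "in_band n E \<longleftrightarrow> El \<le> E \<and> E \<le> Er" for E
    unfolding in_band_def n[symmetric] El[symmetric] Er[symmetric] adv_min_mono_iff adv_max_mono_iff ..
  ultimately show thesis using that El Er by blast
qed

text \<open>At the ends of a band the discriminant takes the values 2 and -2 in some order, which
  gives existence. Two energies with the same value would enclose a critical point; there all
  advances lie strictly between consecutive multiples of pi, so |discr| < 2 and the derivative is
  nonzero.\<close>

lemma band_unique_energy:
  assumes "n \<ge> 1" "\<bar>t\<bar> \<le> 2"
  shows "\<exists>!E. in_band n E \<and> discr E = t"
proof -
  obtain El Er where e: "El < Er" "adv_min El = real (n - 1) * pi" "adv_max Er = real n * pi"
    and band: "\<And>E. in_band n E \<longleftrightarrow> El \<le> E \<and> E \<le> Er" using band_ends[OF assms(1)] by blast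
  have dl: "discr El = 2 * (-1) ^ (n - 1)" using discr_at_edge[of El "n - 1"] e by simp
  have dr: "discr Er = 2 * (-1) ^ n" using discr_at_edge[of Er n] e by simp
  obtain k where k: "n = Suc k" using assms(1) by (cases n) auto
  have "\<exists>E. El \<le> E \<and> E \<le> Er \<and> discr E = t"
  proof (cases "even n")
    case True
    then show ?thesis using dl dr k assms(2) e(1)
      by (intro IVT' discr_continuous) auto
  next
    case False
    then show ?thesis using dl dr k assms(2) e(1)
      by (intro IVT2' discr_continuous) auto
  qed
  moreover have "E1 = E2" if "in_band n E1" "in_band n E2" "discr E1 = t" "discr E2 = t" for E1 E2
  proof -
    have False if E: "E1 < E2" "in_band n E1" "in_band n E2" "discr E1 = discr E2" for E1 E2
    proof -
      obtain z where z: "E1 < z" "z < E2" "(discr has_real_derivative 0) (at z)"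
        using Rolle[of E1 E2 discr] E(1,4) discr_continuous discr_has_derivative real_differentiable_def
        by metis
      have "adv_min E1 < adv_min z" "adv_max z < adv_max E2"
        using z adv_min_strict_mono adv_max_strict_mono by auto
      then have lt: "(real n - 1) * pi < adv_min z" "adv_max z < real n * pi" using E(2,3) unfolding in_band_def by linarith+
      have "\<not> (adv_min z \<le> real j * pi \<and> real j * pi \<le> adv_max z)" for j :: nat
      proof
        assume j: "adv_min z \<le> real j * pi \<and> real j * pi \<le> adv_max z"
        then have "(real n - 1) * pi < real j * pi" "real j * pi < real n * pi" using lt by linarith+
        then have "real n < real (j + 1)" "real j < real n" by simp_all
        then show False unfolding of_nat_less_iff by linarith
      qed
      then have "\<bar>discr z\<bar> < 2" by (rule discr_less_2)
      then show False using z(3) discr_has_derivative[of z] DERIV_unique by metis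
    qed
    then show ?thesis using that by (metis linorder_neqE_linordered_idom)
  qed
  ultimately show ?thesis using band by metis
qed

end

section \<open>Bloch functions and band edges\<close>

lemma H2_loc_continuous:
  fixes u :: "real \<Rightarrow> 'a::euclidean_space"
  assumes "H2_loc u u1 u2"
  shows "continuous_on S u" "continuous_on S u1"
proof -
  have "isCont u x" for x
    using assms unfolding H2_loc_def by (metis has_vector_derivative_continuous)
  then show "continuous_on S u" by (simp add: continuous_at_imp_continuous_on)
  have "isCont u1 x" for x
  proof -
    have i: "(u2 has_integral u1 b - u1 a) {a..b}" if "a \<le> b" for a b
      using assms that unfolding H2_loc_def by blast
    have "continuous_on {x-1..x+1} (\<lambda>y. integral {x-1..y} u2)"
      using i[of "x-1" "x+1"] by (intro indefinite_integral_continuous_1) (auto simp: integrable_on_def)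
    then have "continuous_on {x-1..x+1} (\<lambda>y. integral {x-1..y} u2 + u1 (x - 1))"
      by (intro continuous_intros)
    then have "continuous_on {x-1..x+1} u1"
      by (rule continuous_on_eq) (use integral_unique[OF i] in auto)
    then show ?thesis
      by (rule continuous_on_interior) (simp add: interior_atLeastAtMost_real)
  qed
  then show "continuous_on S u1" by (simp add: continuous_at_imp_continuous_on)
qed

text \<open>The differential equation identifies \<open>u2\<close> almost everywhere with a locally
  bounded \<open>g\<close>, so weak solutions enter the calculus of primitives.\<close>

lemma H2_loc_primitive:
  assumes "H2_loc u u1 u2" "loc_bdd g" "AE x in lebesgue. u2 x = g x"
  shows "primitive u u1" "primitive u1 g"
proof -
  show "primitive u u1"
  proof (rule primitive_continuousI)
    show "(u has_vector_derivative u1 x) (at x)" for x using assms(1) unfolding H2_loc_def by blast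
    show "continuous_on UNIV u1" by (rule H2_loc_continuous[OF assms(1)])
  qed
  have N: "negligible {x. u2 x \<noteq> g x}"
    using assms(3) by (simp add: negligible_iff_null_sets completion.AE_iff_null_sets)
  have "(g has_integral u1 b - u1 a) {a..b}" if "a \<le> b" for a b
  proof (rule has_integral_spike[OF N])
    show "(u2 has_integral u1 b - u1 a) {a..b}" using assms(1) that unfolding H2_loc_def by blast
  qed simp
  then show "primitive u1 g" using assms(2) by (simp add: primitive_def)
qed

lemma primitive_H2_loc:
  assumes "primitive u u1" "primitive u1 u2"
  shows "H2_loc u u1 u2"
  unfolding H2_loc_def
proof (intro conjI allI impI)
  show "(u has_vector_derivative u1 x) (at x)" for x
    using assms by (intro primitive_has_vector_derivative primitive_continuous)
  show "u2 \<in> borel_measurable lebesgue" using primitive_loc_bdd[OF assms(2)] by (simp add: loc_bdd_def)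
  fix a b :: real assume "a \<le> b"
  then show "(u2 has_integral u1 b - u1 a) {a..b}" by (rule primitive_has_integral[OF assms(2)])
  have "loc_bdd (\<lambda>x. (u2 x) \<bullet> (u2 x))"
    by (intro loc_bdd_bilinear[OF bounded_bilinear_inner] primitive_loc_bdd[OF assms(2)])
  then show "(\<lambda>x. (norm (u2 x))\<^sup>2) integrable_on {a..b}"
    by (simp add: loc_bdd_integrable power2_norm_eq_inner)
qed

lemma primitive_cis: "primitive (\<lambda>x. cis (k * x)) (\<lambda>x. \<i> * of_real k * cis (k * x))"
proof (rule primitive_continuousI)
  show "((\<lambda>x. cis (k * x)) has_vector_derivative \<i> * of_real k * cis (k * x)) (at x)" for x
    unfolding cis_conv_exp
    by (auto intro!: derivative_eq_intros has_vector_derivative_real_field simp: algebra_simps)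
  show "continuous_on UNIV (\<lambda>x. \<i> * of_real k * cis (k * x))" by (intro continuous_intros)
qed

lemma complex_kernel_2x2:
  fixes p q r s :: complex
  assumes "p * s - q * r = 0" "q \<noteq> 0 \<or> r \<noteq> 0"
  obtains a0 b0 where "a0 \<noteq> 0 \<or> b0 \<noteq> 0"
    "\<And>a b. p * a + q * b = 0 \<and> r * a + s * b = 0 \<longleftrightarrow> (\<exists>z. a = z * a0 \<and> b = z * b0)"
proof (cases "q = 0")
  case False
  have sq: "s * p = q * r" using assms(1) by (simp add: mult.commute)
  show thesis
  proof (rule that[of q "- p"])
    fix a b
    have "p * a + q * b = 0 \<and> r * a + s * b = 0" if z: "a = z * q" "b = z * - p" for z
    proof -
      have "r * a + s * b = z * (q * r - s * p)" by (simp add: z algebra_simps)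
      then show ?thesis using sq by (simp add: z)
    qed
    moreover have "a = (a / q) * q \<and> b = (a / q) * - p" if "p * a + q * b = 0"
      using False that by (simp add: field_simps eq_neg_iff_add_eq_0)
    ultimately show "p * a + q * b = 0 \<and> r * a + s * b = 0 \<longleftrightarrow> (\<exists>z. a = z * q \<and> b = z * - p)" by metis
  qed (use False in simp)
next
  case True
  then have r: "r \<noteq> 0" and ps: "p * s = 0" using assms by auto
  show thesis
  proof (rule that[of "- s" r])
    fix a b
    have "p * a + q * b = 0 \<and> r * a + s * b = 0" if z: "a = z * - s" "b = z * r" for z
      using True ps by (auto simp: z)
    moreover have "a = (b / r) * - s \<and> b = (b / r) * r" if "r * a + s * b = 0"
      using r that by (simp add: field_simps eq_neg_iff_add_eq_0 add.commute)
    ultimately show "p * a + q * b = 0 \<and> r * a + s * b = 0 \<longleftrightarrow> (\<exists>z. a = z * - s \<and> b = z * r)" by metis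
  qed (use r in simp)
qed

context periodic_potential
begin

text \<open>The factor exp (- i k x) turns a solution w of - w'' + V w = E w with w (x + X) = exp (i
  k X) w x into a periodic eigenfunction; a and b are the initial values of w and w'.\<close>

definition bloch_fun :: "real \<Rightarrow> real \<Rightarrow> complex \<Rightarrow> complex \<Rightarrow> real \<Rightarrow> complex" where
  "bloch_fun k E a b x = cis (- k * x) * (of_real (cf (qE E) x) * a + of_real (sf (qE E) x) * b)"

text \<open>The eigenspace of the monodromy matrix for the Floquet multiplier exp (i k X), zero
  vector included.\<close>

definition bloch_init :: "real \<Rightarrow> real \<Rightarrow> (complex \<times> complex) set" where
  "bloch_init k E = {(a, b). of_real (mc E) * a + of_real (ms E) * b = cis (k * X) * a
     \<and> of_real (mc' E) * a + of_real (ms' E) * b = cis (k * X) * b}"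

lemma bloch_eigenspace_subset:
  assumes "u \<in> bloch_eigenspace X V k E"
  shows "\<exists>(a, b)\<in>bloch_init k E. u = bloch_fun k E a b"
proof -
  from assms obtain u1 u2 where per: "\<And>x. u (x + X) = u x" and H: "H2_loc u u1 u2"
    and eq: "AE x in lebesgue. - (u2 x + 2 * (\<i> * of_real k) * u1 x + (\<i> * of_real k)\<^sup>2 * u x)
                + of_real (V x) * u x = of_real E * u x"
    unfolding bloch_eigenspace_def by blast
  define g where "g x = of_real (V x) * u x - of_real E * u x - 2 * (\<i> * of_real k) * u1 x - (\<i> * of_real k)\<^sup>2 * u x" for x
  have "bdd_meas V" using V_meas V_bounds by (intro bdd_measI[of _ Vp]) auto
  then have "loc_bdd g" unfolding g_def
    by (intro loc_bdd_diff loc_bdd_mult loc_bdd_const loc_bdd_of_real bdd_meas_loc_bdd loc_bdd_continuous H2_loc_continuous[OF H])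
  moreover have "AE x in lebesgue. u2 x = g x"
    using eq
  proof eventually_elim
    case (elim x)
    have "g x = of_real (V x) * u x - (- (u2 x + 2 * (\<i> * of_real k) * u1 x + (\<i> * of_real k)\<^sup>2 * u x)
                + of_real (V x) * u x) - 2 * (\<i> * of_real k) * u1 x - (\<i> * of_real k)\<^sup>2 * u x"
      unfolding elim g_def ..
    then show ?case by simp
  qed
  ultimately have P: "primitive u u1" "primitive u1 g" using H2_loc_primitive[OF H] by blast+
  define w where "w x = cis (k * x) * u x" for x
  define w' where "w' x = cis (k * x) * (\<i> * of_real k * u x + u1 x)" for x
  have "primitive w w'"
    by (rule primitive_cong[OF primitive_mult[OF primitive_cis[of k] P(1)]]) (simp_all add: w_def w'_def algebra_simps)
  moreover have "primitive w' (\<lambda>x. - qE E x *\<^sub>R w x)"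
    by (rule primitive_cong[OF primitive_mult[OF primitive_cis[of k] primitive_add[OF primitive_cmult[OF P(1), of "\<i> * of_real k"] P(2)]]])
      (simp_all add: w_def w'_def g_def qE_def scaleR_conv_of_real power2_eq_square algebra_simps)
  ultimately have w: "solves (qE E) w w'" by (simp add: solves_def)
  have wX: "w (x + X) = cis (k * X) * w x" for x
    by (simp add: w_def per distrib_left flip: cis_mult)
  \<comment> \<open>Two expressions for one function have the same derivative, so the second row of
    the eigenvector equation comes from the first.\<close>
  have w'X: "w' (x + X) = cis (k * X) * w' x" for x
  proof -
    have "((\<lambda>x. w (x + X)) has_vector_derivative w' (x + X)) (at x)"
      by (rule solves_has_vector_derivative[OF solves_shift[OF w qE_periodic]])
    moreover have "((\<lambda>x. cis (k * X) * w x) has_vector_derivative cis (k * X) * w' x) (at x)"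
      by (rule solves_has_vector_derivative[OF solves_linear[OF bounded_linear_mult_right w]])
    ultimately show ?thesis unfolding wX by (rule vector_derivative_unique_at)
  qed
  note repr = fundamental_repr[OF qE_bdd w, unfolded scaleR_conv_of_real]
  have "(w 0, w' 0) \<in> bloch_init k E"
    using wX[of 0] w'X[of 0] repr[of X] by (simp add: bloch_init_def mc_def ms_def mc'_def ms'_def)
  moreover have "u = bloch_fun k E (w 0) (w' 0)"
  proof
    fix x
    have "u x = cis (- k * x) * w x" by (simp add: w_def cis_mult flip: mult.assoc)
    then show "u x = bloch_fun k E (w 0) (w' 0) x" unfolding bloch_fun_def repr(1)[of x] .
  qed
  ultimately show ?thesis by blast
qed

lemma bloch_eigenspace_supset:
  assumes "(a, b) \<in> bloch_init k E"
  shows "bloch_fun k E a b \<in> bloch_eigenspace X V k E"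
proof -
  define w where "w x = of_real (cf (qE E) x) * a + of_real (sf (qE E) x) * b" for x
  define w' where "w' x = of_real (cf' (qE E) x) * a + of_real (sf' (qE E) x) * b" for x
  have "solves (qE E) (\<lambda>x. cf (qE E) x *\<^sub>R a + sf (qE E) x *\<^sub>R b) (\<lambda>x. cf' (qE E) x *\<^sub>R a + sf' (qE E) x *\<^sub>R b)"
    by (intro solves_add solves_linear[OF bounded_linear_scaleR_left] solves_sol qE_bdd)
  then have w: "solves (qE E) w w'" by (simp add: w_def[abs_def] w'_def[abs_def] scaleR_conv_of_real)
  have init: "w X = cis (k * X) * a" "w' X = cis (k * X) * b"
    using assms by (simp_all add: bloch_init_def w_def w'_def mc_def ms_def mc'_def ms'_def)
  have wX: "w (x + X) = cis (k * X) * w x" for x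
    using fundamental_repr(1)[OF qE_bdd solves_shift[OF w qE_periodic], of x]
    by (simp add: init scaleR_conv_of_real) (simp add: w_def algebra_simps)
  have u: "bloch_fun k E a b = (\<lambda>x. cis (- k * x) * w x)"
    by (simp add: fun_eq_iff bloch_fun_def w_def)
  define u1 where "u1 x = cis (- k * x) * (w' x - \<i> * of_real k * w x)" for x
  define u2 where "u2 x = cis (- k * x) * (- of_real (qE E x) * w x - 2 * \<i> * of_real k * w' x + (\<i> * of_real k)\<^sup>2 * w x)" for x
  have "primitive (bloch_fun k E a b) u1"
    by (rule primitive_cong[OF primitive_mult[OF primitive_cis[of "- k"] solvesD(1)[OF w]]])
      (simp_all add: u u1_def algebra_simps)
  moreover have "primitive u1 u2"
    by (rule primitive_cong[OF primitive_mult[OF primitive_cis[of "- k"]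
            primitive_diff[OF solvesD(2)[OF w] primitive_cmult[OF solvesD(1)[OF w], of "\<i> * of_real k"]]]])
      (simp_all add: u1_def u2_def scaleR_conv_of_real power2_eq_square algebra_simps)
  ultimately have "H2_loc (bloch_fun k E a b) u1 u2" by (rule primitive_H2_loc)
  moreover have "- (u2 x + 2 * (\<i> * of_real k) * u1 x + (\<i> * of_real k)\<^sup>2 * bloch_fun k E a b x)
                + of_real (V x) * bloch_fun k E a b x = of_real E * bloch_fun k E a b x" for x
    by (simp add: u1_def u2_def u qE_def power2_eq_square algebra_simps)
  moreover have "bloch_fun k E a b (x + X) = bloch_fun k E a b x" for x
  proof -
    have "cis (- k * (x + X)) * (cis (k * X) * w x) = cis (- k * (x + X) + k * X) * w x"
      by (simp only: cis_mult flip: mult.assoc)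
    also have "- k * (x + X) + k * X = - k * x" by (simp add: algebra_simps)
    finally show ?thesis unfolding u wX .
  qed
  ultimately show ?thesis unfolding bloch_eigenspace_def by blast
qed

lemma bloch_fun_linear:
  "bloch_fun k E (z * a) (z * b) = (\<lambda>x. z * bloch_fun k E a b x)"
  "bloch_fun k E (a + a') (b + b') = bloch_fun k E a b + bloch_fun k E a' b'"
  by (simp_all add: fun_eq_iff bloch_fun_def algebra_simps)

lemma bloch_fun_eq_0:
  assumes "bloch_fun k E a b = 0"
  shows "a = 0" "b = 0"
proof -
  have z: "bloch_fun k E a b x = 0" for x using assms by simp
  show a: "a = 0" using z[of 0] by (simp add: bloch_fun_def qE_bdd)
  obtain x where "sf (qE E) x \<noteq> 0" using sol_nontrivial[OF qE_bdd X_pos] by blast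
  then show "b = 0" using z[of x] a by (simp add: bloch_fun_def)
qed

text \<open>The monodromy matrix minus \<mu> = exp (i k X) has determinant \<mu> (2 cos (k X) -
  discr E). If this vanishes, the kernel is a line, or the plane when both off-diagonal entries are
  zero. Initial values determine the Bloch function linearly and injectively, so dimensions carry
  over.\<close>

lemma bloch_dim:
  "cfun.dim (bloch_eigenspace X V k E) =
    (if discr E = 2 * cos (k * X) then if ms E = 0 \<and> mc' E = 0 then 2 else 1 else 0)"
proof -
  define \<mu> where "\<mu> = cis (k * X)"
  have set: "bloch_eigenspace X V k E = {bloch_fun k E a b | a b. (a, b) \<in> bloch_init k E}"
    using bloch_eigenspace_subset bloch_eigenspace_supset by fastforce
  have init: "(a, b) \<in> bloch_init k E \<longleftrightarrow> (of_real (mc E) - \<mu>) * a + of_real (ms E) * b = 0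
      \<and> of_real (mc' E) * a + (of_real (ms' E) - \<mu>) * b = 0" for a b
    by (auto simp: bloch_init_def \<mu>_def algebra_simps)
  have "(of_real (mc E) - \<mu>) * (of_real (ms' E) - \<mu>) - of_real (ms E) * of_real (mc' E) =
      of_real (mc E * ms' E - mc' E * ms E) - of_real (discr E) * \<mu> + \<mu> * \<mu>"
    by (simp add: discr_def algebra_simps)
  also have "\<dots> = \<mu> * (of_real (2 * cos (k * X)) - of_real (discr E))"
  proof -
    have "\<mu> + cis (- (k * X)) = of_real (2 * cos (k * X))" by (simp add: \<mu>_def complex_eq_iff)
    moreover have "\<mu> * cis (- (k * X)) = 1" by (simp add: \<mu>_def cis_mult)
    ultimately have "\<mu> * of_real (2 * cos (k * X)) = \<mu> * \<mu> + 1" by (metis distrib_left)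
    then show ?thesis unfolding mdet right_diff_distrib by simp
  qed
  finally have char: "(of_real (mc E) - \<mu>) * (of_real (ms' E) - \<mu>) - of_real (ms E) * of_real (mc' E) =
      \<mu> * (of_real (2 * cos (k * X)) - of_real (discr E))" .
  have mu0: "\<mu> \<noteq> 0" by (simp add: \<mu>_def)
  consider (none) "discr E \<noteq> 2 * cos (k * X)"
    | (two) "discr E = 2 * cos (k * X)" "ms E = 0" "mc' E = 0"
    | (one) "discr E = 2 * cos (k * X)" "ms E \<noteq> 0 \<or> mc' E \<noteq> 0" by blast
  then show ?thesis
  proof cases
    case none
    have "a = 0 \<and> b = 0" if "(a, b) \<in> bloch_init k E" for a b
    proof -
      let ?d = "(of_real (mc E) - \<mu>) * (of_real (ms' E) - \<mu>) - of_real (ms E) * of_real (mc' E)"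
      have d0: "?d \<noteq> 0" unfolding char using mu0 none by (metis eq_iff_diff_eq_0 mult_eq_0_iff of_real_eq_iff)
      have 1: "(of_real (mc E) - \<mu>) * a + of_real (ms E) * b = 0" "of_real (mc' E) * a + (of_real (ms' E) - \<mu>) * b = 0"
        using that init by blast+
      have "?d * a = (of_real (ms' E) - \<mu>) * ((of_real (mc E) - \<mu>) * a + of_real (ms E) * b)
          - of_real (ms E) * (of_real (mc' E) * a + (of_real (ms' E) - \<mu>) * b)" by (simp add: algebra_simps)
      moreover have "?d * b = (of_real (mc E) - \<mu>) * (of_real (mc' E) * a + (of_real (ms' E) - \<mu>) * b)
          - of_real (mc' E) * ((of_real (mc E) - \<mu>) * a + of_real (ms E) * b)" by (simp add: algebra_simps)
      ultimately have "?d * a = 0" "?d * b = 0" unfolding 1 by simp_all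
      then show ?thesis using d0 by (metis mult_eq_0_iff)
    qed
    moreover have "bloch_fun k E 0 0 = 0" by (simp add: fun_eq_iff bloch_fun_def)
    ultimately have "bloch_eigenspace X V k E \<subseteq> cfun.span {}" unfolding set cfun.span_empty by auto
    then have "cfun.dim (bloch_eigenspace X V k E) = 0"
      by (intro cfun.dim_unique[of "{}"]) (simp_all add: cfun.independent_empty)
    then show ?thesis using none by simp
  next
    case one
    have "(of_real (mc E) - \<mu>) * (of_real (ms' E) - \<mu>) - of_real (ms E) * of_real (mc' E) = 0"
      unfolding char using one by simp
    moreover have "complex_of_real (ms E) \<noteq> 0 \<or> complex_of_real (mc' E) \<noteq> 0" using one by simp
    ultimately have "\<exists>a0 b0. (a0 \<noteq> 0 \<or> b0 \<noteq> 0) \<and> (\<forall>a b. (a, b) \<in> bloch_init k E \<longleftrightarrow> (\<exists>z. a = z * a0 \<and> b = z * b0))"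
      unfolding init by (rule complex_kernel_2x2) blast
    then obtain a0 b0 where ab: "a0 \<noteq> 0 \<or> b0 \<noteq> 0"
      "\<And>a b. (a, b) \<in> bloch_init k E \<longleftrightarrow> (\<exists>z. a = z * a0 \<and> b = z * b0)" by blast
    let ?f = "bloch_fun k E a0 b0"
    have "(a0, b0) \<in> bloch_init k E" using ab(2) by (metis mult_1)
    then have "{?f} \<subseteq> bloch_eigenspace X V k E" unfolding set by blast
    moreover have "bloch_eigenspace X V k E \<subseteq> cfun.span {?f}"
    proof
      fix u assume "u \<in> bloch_eigenspace X V k E"
      then obtain z where "u = bloch_fun k E (z * a0) (z * b0)" unfolding set ab(2) by blast
      then have "u = (\<lambda>x. z * ?f x)" by (simp add: bloch_fun_linear)
      then show "u \<in> cfun.span {?f}" using cfun.span_scale[OF cfun.span_base, of ?f "{?f}" z] by simp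
    qed
    moreover have "?f \<noteq> 0"
    proof
      assume "?f = 0"
      from bloch_fun_eq_0[OF this] show False using ab(1) by simp
    qed
    then have "\<not> cfun.dependent {?f}" by (simp add: cfun.dependent_single)
    ultimately have "cfun.dim (bloch_eigenspace X V k E) = 1"
      by (intro cfun.dim_unique[of "{?f}"]) auto
    then show ?thesis using one by auto
  next
    case two
    \<comment> \<open>A diagonal monodromy matrix with this trace is \<mu> times the identity, so
      every pair of initial values qualifies.\<close>
    have "\<bar>discr E\<bar> \<le> 2" unfolding two(1) using abs_cos_le_one[of "k * X"] by (simp add: abs_mult)
    from discr_le_2_D(1,2)[OF two(2,3) this]
    have eq: "mc E = ms' E" "\<bar>cos (k * X)\<bar> = 1" using two(1) by (auto simp: abs_mult)
    then have "sin (k * X) = 0" using sin_cos_squared_add[of "k * X"] by (auto simp: abs_eq_iff' power2_eq_square)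
    then have "\<mu> = of_real (cos (k * X))" by (simp add: \<mu>_def complex_eq_iff)
    moreover have "mc E = cos (k * X)" using eq(1) two(1) by (simp add: discr_def)
    ultimately have all: "(a, b) \<in> bloch_init k E" for a b using two eq(1) unfolding init by simp
    let ?f = "bloch_fun k E 1 0" and ?g = "bloch_fun k E 0 1"
    have g0: "?g \<noteq> 0" 
    proof
      assume "?g = 0"
      from bloch_fun_eq_0(2)[OF this] show False by simp
    qed
    have ng: "?f \<notin> cfun.span {?g}"
    proof
      assume "?f \<in> cfun.span {?g}"
      then obtain z where "?f = (\<lambda>x. z * ?g x)" unfolding cfun.span_singleton by blast
      then have "?f 0 = z * ?g 0" by (rule fun_cong)
      then show False by (simp add: bloch_fun_def qE_bdd)
    qed
    then have ne: "?f \<noteq> ?g" using cfun.span_base[of ?g "{?g}"] by auto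
    have "{?f, ?g} \<subseteq> bloch_eigenspace X V k E" using all unfolding set by blast
    moreover have "bloch_eigenspace X V k E \<subseteq> cfun.span {?f, ?g}"
    proof
      fix u assume "u \<in> bloch_eigenspace X V k E"
      then obtain a b where "u = bloch_fun k E a b" unfolding set by blast
      then have "u = bloch_fun k E (a * 1 + b * 0) (a * 0 + b * 1)" by simp
      then have "u = (\<lambda>x. a * ?f x) + (\<lambda>x. b * ?g x)" unfolding bloch_fun_linear .
      then show "u \<in> cfun.span {?f, ?g}"
        using cfun.span_add[OF cfun.span_scale[OF cfun.span_base, of ?f "{?f, ?g}" a] cfun.span_scale[OF cfun.span_base, of ?g "{?f, ?g}" b]]
        by simp
    qed
    moreover have "\<not> cfun.dependent {?f, ?g}"
      using ng g0 ne by (simp add: cfun.independent_insert cfun.dependent_single)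
    moreover have "card {?f, ?g} = 2" using ne by simp
    ultimately have "cfun.dim (bloch_eigenspace X V k E) = 2"
      by (intro cfun.dim_unique[of "{?f, ?g}"]) auto
    then show ?thesis using two by simp
  qed
qed

end

section \<open>Enumeration of the eigenvalues and location of the gap edges\<close>

lemma eigenvalue_enumeration_unique:
  assumes e: "eigenvalue_enumeration X V k e" "eigenvalue_enumeration X V k e'" and "n \<ge> 1"
  shows "e n = e' n"
proof -
  have lt: "\<not> e n < e' n"
    if e: "eigenvalue_enumeration X V k e" "eigenvalue_enumeration X V k e'"
      and n: "n \<ge> 1" "\<And>j. 1 \<le> j \<Longrightarrow> j < n \<Longrightarrow> e j = e' j" for n e e'
  proof
    assume less: "e n < e' n"
    have "j < n" if "1 \<le> j" "e' j = e n" for j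
    proof (rule ccontr)
      assume "\<not> j < n"
      then have "e' n \<le> e' j"
        using e(2) n(1) by (auto simp: eigenvalue_enumeration_def mono_on_def)
      then show False using less that by simp
    qed
    \<comment> \<open>At a first disagreement, \<open>e'\<close> takes the value \<open>e n\<close>
      only at indices below n, where both sequences agree, while \<open>e\<close> takes it at n too.
      The multiplicities would differ.\<close>
    then have sub: "{j \<in> {1..}. e' j = e n} \<subseteq> {j \<in> {1..}. e j = e n} - {n}"
      using n(2) by force
    have fin: "finite {j \<in> {1..}. e j = e n}" using e(1) by (simp add: eigenvalue_enumeration_def)
    then have "card {j \<in> {1..}. e' j = e n} < card {j \<in> {1..}. e j = e n}"
      using sub n(1) by (intro psubset_card_mono) auto
    moreover have "card {j \<in> {1..}. e' j = e n} = card {j \<in> {1..}. e j = e n}"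
      using e by (simp add: eigenvalue_enumeration_def)
    ultimately show False by simp
  qed
  show ?thesis using assms(3)
  proof (induction n rule: less_induct)
    case (less n)
    then have "\<And>j. 1 \<le> j \<Longrightarrow> j < n \<Longrightarrow> e j = e' j" by blast
    then show ?case using lt[OF e less.prems] lt[OF e(2,1) less.prems] by (metis linorder_neqE_linordered_idom)
  qed
qed

lemma band_eqI:
  assumes "eigenvalue_enumeration X V k e" "n \<ge> 1"
  shows "band X V n k = e n"
  unfolding band_def using assms eigenvalue_enumeration_unique by (intro the_equality) blast+

context periodic_potential
begin

definition bloch_energy :: "real \<Rightarrow> nat \<Rightarrow> real" where
  "bloch_energy k n = (THE E. in_band n E \<and> discr E = 2 * cos (k * X))"

lemma bloch_energy:
  assumes "n \<ge> 1"
  shows "in_band n (bloch_energy k n)" "discr (bloch_energy k n) = 2 * cos (k * X)"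
    "in_band n E \<Longrightarrow> discr E = 2 * cos (k * X) \<Longrightarrow> E = bloch_energy k n"
proof -
  have ex1: "\<exists>!E. in_band n E \<and> discr E = 2 * cos (k * X)"
    using abs_cos_le_one[of "k * X"] by (intro band_unique_energy[OF assms]) (simp add: abs_mult)
  from theI'[OF ex1] show "in_band n (bloch_energy k n)" "discr (bloch_energy k n) = 2 * cos (k * X)"
    by (simp_all add: bloch_energy_def)
  then show "in_band n E \<Longrightarrow> discr E = 2 * cos (k * X) \<Longrightarrow> E = bloch_energy k n" using ex1 by blast
qed

lemma bands_ordered:
  assumes "in_band n E1" "in_band m E2" "n < m"
  shows "E1 \<le> E2"
proof -
  have "real n + 1 \<le> real m" using assms(3) by linarith
  then have "real n * pi \<le> (real m - 1) * pi" by (intro mult_right_mono) auto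
  then have "adv_max E1 \<le> adv_min E2" using assms(1,2) unfolding in_band_def by linarith
  also have "\<dots> \<le> adv_max E2" using adv_ge_min adv_le_max order_trans by blast
  finally show ?thesis by (simp add: adv_max_mono_iff)
qed

text \<open>If discr E = 2 cos (k X), the indices with value \<open>E\<close> are the bands through
  \<open>E\<close>, otherwise there are none. \<open>card_bands\<close> and \<open>bloch_dim\<close>
  give the same number in every case.\<close>

lemma bloch_enumeration: "eigenvalue_enumeration X V k (bloch_energy k)"
  unfolding eigenvalue_enumeration_def
proof (intro conjI allI)
  show "mono_on {1..} (bloch_energy k)"
  proof (rule mono_onI)
    fix n m :: nat assume "n \<in> {1..}" "m \<in> {1..}" "n \<le> m"
    then show "bloch_energy k n \<le> bloch_energy k m"
      using bands_ordered[OF bloch_energy(1) bloch_energy(1)] by (cases "n = m") auto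
  qed
  fix E
  have *: "{n \<in> {1..}. bloch_energy k n = E} = (if discr E = 2 * cos (k * X) then {n. n \<ge> 1 \<and> in_band n E} else {})"
    using bloch_energy by auto
  have "\<bar>discr E\<bar> \<le> 2" if "discr E = 2 * cos (k * X)"
    using abs_cos_le_one[of "k * X"] that by (simp add: abs_mult)
  then show "finite {n \<in> {1..}. bloch_energy k n = E}"
    "card {n \<in> {1..}. bloch_energy k n = E} = cfun.dim (bloch_eigenspace X V k E)"
    unfolding * bloch_dim using card_bands[of E] by simp_all
qed

lemma band_eq: "n \<ge> 1 \<Longrightarrow> band X V n k = bloch_energy k n"
  by (rule band_eqI[OF bloch_enumeration])

text \<open>The quasimomentum at which the edges of the m-th gap are attained: the centre or the
  boundary of the Brillouin zone according to parity.\<close>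

definition edge_k :: "nat \<Rightarrow> real" where
  "edge_k m = (if even m then 0 else pi / X)"

lemma edge_k: "edge_k m \<in> {- pi / X..pi / X}" "2 * cos (edge_k m * X) = 2 * (-1) ^ m"
  using X_pos by (auto simp: edge_k_def)

text \<open>The energy with maximal advance m pi is the right end of band m. Its discriminant is the
  value belonging to \<open>edge_k m\<close>, so it is the band energy there; at every other
  quasimomentum the energy stays in the band and thus below.\<close>

lemma gap_left_edge:
  assumes "m \<ge> 1"
  shows "adv_max (gap_left X m V) = real m * pi"
proof -
  obtain E where E: "adv_max E = real m * pi" using adv_max_attains[OF assms] by blast
  have "in_band m E" using E adv_max_less[of E] by (simp add: in_band_def algebra_simps)
  moreover have "discr E = 2 * cos (edge_k m * X)" using discr_at_edge[of E m] E edge_k(2) by simp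
  ultimately have "band X V m (edge_k m) = E" using bloch_energy(3)[OF assms] band_eq[OF assms] by simp
  moreover have "band X V m k \<le> E" for k
    using bloch_energy(1)[OF assms, of k] E unfolding band_eq[OF assms] in_band_def adv_max_mono_iff[symmetric, of _ E]
    by simp
  ultimately have "gap_left X m V = E"
    unfolding gap_left_def using edge_k(1)[of m] by (intro cSup_eq_maximum) auto
  then show ?thesis using E by simp
qed

lemma gap_right_edge: "adv_min (gap_right X m V) = real m * pi"
proof -
  have m: "m + 1 \<ge> 1" by simp
  obtain E where E: "adv_min E = real m * pi" using adv_min_attains by blast
  have "in_band (m + 1) E" using E adv_max_less[of E] by (simp add: in_band_def algebra_simps)
  moreover have "discr E = 2 * cos (edge_k m * X)" using discr_at_edge[of E m] E edge_k(2) by simp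
  ultimately have "band X V (m + 1) (edge_k m) = E" using bloch_energy(3)[OF m] band_eq[OF m] by simp
  moreover have "E \<le> band X V (m + 1) k" for k
    using bloch_energy(1)[OF m, of k] E unfolding band_eq[OF m] in_band_def adv_min_mono_iff[symmetric, of E]
    by simp
  ultimately have "gap_right X m V = E"
    unfolding gap_right_def using edge_k(1)[of m] by (intro cInf_eq_minimum) auto
  then show ?thesis using E by simp
qed

lemma gap_left_pos: "m \<ge> 1 \<Longrightarrow> 0 < gap_left X m V"
proof -
  assume m: "m \<ge> 1"
  have "adv_max 0 < pi" using adv_max_less[of 0] adv_min_nonpos[of 0] by linarith
  also have "pi \<le> real m * pi" using m by simp
  finally have "adv_max 0 < adv_max (gap_left X m V)" using gap_left_edge[OF m] by simp
  then show ?thesis using adv_max_mono_iff[of "gap_left X m V" 0] by (simp add: not_le[symmetric])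
qed

lemma gap_left_le_right: "m \<ge> 1 \<Longrightarrow> gap_left X m V \<le> gap_right X m V"
proof -
  assume m: "m \<ge> 1"
  have "adv_min (gap_left X m V) \<le> adv_max (gap_left X m V)"
    using adv_ge_min adv_le_max order_trans by blast
  also have "\<dots> = adv_min (gap_right X m V)" using gap_left_edge[OF m] gap_right_edge by simp
  finally show ?thesis by (simp add: adv_min_mono_iff)
qed

text \<open>A single trial angle bounds an edge, as a trial function does in a minimax
  principle.\<close>

lemma gap_left_leI: "m \<ge> 1 \<Longrightarrow> real m * pi \<le> adv E t \<Longrightarrow> gap_left X m V \<le> E"
  using adv_le_max[of E t] gap_left_edge adv_max_mono_iff[of "gap_left X m V" E] by simp

lemma gap_right_geI: "adv E t \<le> real m * pi \<Longrightarrow> E \<le> gap_right X m V"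
  using adv_ge_min[of E t] gap_right_edge[of m] adv_min_mono_iff[of E "gap_right X m V"] by simp

lemma edge_eigenfunction_solves:
  assumes "edge_eigenfunction X m V E \<psi>"
  obtains \<psi>' where "solves (qE E) \<psi> \<psi>'"
proof -
  from assms obtain \<psi>1 \<psi>2 where H: "H2_loc \<psi> \<psi>1 \<psi>2"
    and eq: "AE x in lebesgue. - \<psi>2 x + V x * \<psi> x = E * \<psi> x"
    unfolding edge_eigenfunction_def by blast
  have "loc_bdd (\<lambda>x. - qE E x *\<^sub>R \<psi> x)"
    by (intro loc_bdd_scaleR loc_bdd_minus bdd_meas_loc_bdd qE_bdd loc_bdd_continuous H2_loc_continuous[OF H])
  moreover have "AE x in lebesgue. \<psi>2 x = - qE E x *\<^sub>R \<psi> x"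
    using eq by eventually_elim (simp add: qE_def algebra_simps)
  ultimately show thesis using H2_loc_primitive[OF H] that unfolding solves_def by blast
qed

text \<open>A (anti)periodic solution advances by a multiple of \<open>\<pi>\<close>, and at an edge \<open>m \<pi>\<close> is the only one in
  range because all advances differ by less than \<open>\<pi>\<close>.\<close>

lemma edge_eigenfunction_polar:
  assumes "edge_eigenfunction X m V E \<psi>" "adv_min E \<le> real m * pi" "real m * pi \<le> adv_max E"
  obtains R t0 where "R > 0" "\<And>x. \<psi> x = R * sol (qE E) t0 x" "adv E t0 = real m * pi"
proof -
  obtain \<psi>' where s: "solves (qE E) \<psi> \<psi>'" using edge_eigenfunction_solves[OF assms(1)] by blast
  have per: "\<psi> (x + X) = (-1) ^ m * \<psi> x" for x using assms(1) by (simp add: edge_eigenfunction_def)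
  have nz: "\<psi> 0 \<noteq> 0 \<or> \<psi>' 0 \<noteq> 0"
  proof (rule ccontr)
    assume n: "\<not> ?thesis"
    have z: "\<psi> x = 0" for x unfolding fundamental_repr(1)[OF qE_bdd s, of x] using n by simp
    have "((\<lambda>x. (\<psi> x)\<^sup>2) has_integral 1) {0..X}"
      using assms(1) unfolding edge_eigenfunction_def by blast
    then have "((\<lambda>x::real. 0::real) has_integral 1) {0..X}" unfolding z by simp
    from has_integral_unique[OF this has_integral_0] show False by simp
  qed
  obtain R t0 where R: "R > 0" "\<And>x. \<psi> x = R * sol (qE E) t0 x" "\<And>x. \<psi>' x = R * dsol (qE E) t0 x"
    using sol_polar[OF qE_bdd s nz] by blast
  have "((\<lambda>x. \<psi> (x + X)) has_vector_derivative \<psi>' (0 + X)) (at 0)"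
    by (rule solves_has_vector_derivative[OF solves_shift[OF s qE_periodic]])
  moreover have "((\<lambda>x. (-1) ^ m * \<psi> x) has_vector_derivative (-1) ^ m * \<psi>' 0) (at 0)"
    by (rule solves_has_vector_derivative[OF solves_linear[OF bounded_linear_mult_right s]])
  ultimately have "\<psi>' X = (-1) ^ m * \<psi>' 0" unfolding per using vector_derivative_unique_at by fastforce
  moreover have "\<psi> X = (-1) ^ m * \<psi> 0" using per[of 0] by simp
  ultimately have X: "sol (qE E) t0 X = (-1) ^ m * sin t0" "dsol (qE E) t0 X = (-1) ^ m * cos t0"
    using R by (simp_all add: qE_bdd)
  have "mform E (sin t0) (cos t0) = sin t0 * dsol (qE E) t0 X - cos t0 * sol (qE E) t0 X"
    by (simp add: mform_def sol_X power2_eq_square algebra_simps)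
  then have "mform E (sin t0) (cos t0) = 0" unfolding X by simp
  then have "sin (adv E t0) = 0" by (simp add: mform_sin_cos)
  then obtain j :: int where "adv E t0 = of_int j * pi" by (auto simp: sin_zero_iff_int2)
  then obtain n :: nat where n: "adv E t0 = real n * pi" using adv_pi_multiple_nat by blast
  have "real n * pi < real m * pi + pi" "real m * pi < real n * pi + pi"
    using adv_le_max[of E t0] adv_ge_min[of E t0] adv_max_less[of E] n assms(2,3) by linarith+
  then have "real n * pi < real (m + 1) * pi" "real m * pi < real (n + 1) * pi"
    by (simp_all add: algebra_simps)
  then have "n = m" unfolding mult_less_cancel_right of_nat_less_iff using pi_gt_zero by auto
  then show thesis using that R n by blast
qed

text \<open>At an edge the characteristic equation of the monodromy matrix has the double root
  (-1)^m, so the solution in direction t is periodic or antiperiodic and only has to be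
  normalized.\<close>

lemma edge_eigenfunction_exists:
  assumes edge: "adv_min E = real m * pi \<or> adv_max E = real m * pi" and t: "adv E t = real m * pi"
  obtains R where "R > 0" "edge_eigenfunction X m V E (\<lambda>x. R * sol (qE E) t x)"
proof -
  define \<mu> where "\<mu> = (-1) ^ m * exp (log_amp (qE E) t X)"
  have "\<mu> * \<mu> - 2 * (-1) ^ m * \<mu> + 1 = 0"
    using discr_eigenvalue[OF t] discr_at_edge[OF edge] by (simp add: \<mu>_def power2_eq_square)
  then have "(\<mu> - (-1) ^ m)\<^sup>2 = 0"
    by (cases "even m") (simp_all add: power2_eq_square algebra_simps)
  then have \<mu>: "\<mu> = (-1) ^ m" by simp
  have X: "sol (qE E) t X = (-1) ^ m * sin t" "dsol (qE E) t X = (-1) ^ m * cos t"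
    using sol_at_eigendirection[OF t] \<mu> unfolding \<mu>_def by simp_all
  have per: "sol (qE E) t (x + X) = (-1) ^ m * sol (qE E) t x" for x
    using fundamental_repr(1)[OF qE_bdd solves_shift[OF solves_sol[OF qE_bdd] qE_periodic], of E t x]
      sol_repr(1)[OF qE_bdd, of E t x] by (simp add: X algebra_simps)
  have ps: "loc_bdd (\<lambda>x. sol (qE E) t x * sol (qE E) t x)"
    by (intro loc_bdd_continuous continuous_intros solves_continuous[OF solves_sol[OF qE_bdd]])
  then obtain S where S: "primitive S (\<lambda>x. sol (qE E) t x * sol (qE E) t x)" "S 0 = 0"
    using loc_bdd_has_primitive by blast
  obtain z where "z \<in> {0..X}" "sol (qE E) t z \<noteq> 0" using sol_nontrivial[OF qE_bdd X_pos] by blast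
  then have pos: "0 < S X"
    using primitive_strict_mono[OF S(1) X_pos, of z] S(2)
    by (auto intro!: continuous_intros solves_continuous[OF solves_sol[OF qE_bdd]])
  define R where "R = 1 / sqrt (S X)"
  have R: "R > 0" "R\<^sup>2 * S X = 1" using pos by (simp_all add: R_def power_divide)
  have "((\<lambda>x. R\<^sup>2 * (sol (qE E) t x * sol (qE E) t x)) has_integral R\<^sup>2 * (S X - S 0)) {0..X}"
    using X_pos by (intro has_integral_mult_right primitive_has_integral[OF S(1)]) auto
  then have int: "((\<lambda>x. (R * sol (qE E) t x)\<^sup>2) has_integral 1) {0..X}"
    using R(2) S(2) by (simp add: power_mult_distrib power2_eq_square mult_ac)
  have s: "solves (qE E) (\<lambda>x. R * sol (qE E) t x) (\<lambda>x. R * dsol (qE E) t x)"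
    by (rule solves_linear[OF bounded_linear_mult_right solves_sol[OF qE_bdd]])
  have H: "H2_loc (\<lambda>x. R * sol (qE E) t x) (\<lambda>x. R * dsol (qE E) t x) (\<lambda>x. - qE E x *\<^sub>R (R * sol (qE E) t x))"
    by (rule primitive_H2_loc[OF solvesD[OF s]])
  have "edge_eigenfunction X m V E (\<lambda>x. R * sol (qE E) t x)"
    unfolding edge_eigenfunction_def using H int
    by (intro conjI exI[of _ "\<lambda>x. R * dsol (qE E) t x"] exI[of _ "\<lambda>x. - qE E x *\<^sub>R (R * sol (qE E) t x)"])
      (auto simp: per qE_def algebra_simps)
  then show thesis using that R(1) by blast
qed

end

section \<open>Normalization and first-order perturbation\<close>

lemma AE_lebesgue_translate:
  fixes P :: "real \<Rightarrow> bool"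
  assumes "AE x in lebesgue. P x"
  shows "AE x in lebesgue. P (x + c)"
proof -
  have "negligible {x. \<not> P x}"
    using assms by (simp add: negligible_iff_null_sets completion.AE_iff_null_sets)
  then have "negligible ((+) (- c) ` {x. \<not> P x})" by (rule negligible_translation)
  moreover have "(+) (- c) ` {x. \<not> P x} = {x. \<not> P (x + c)}"
    by (auto simp: image_iff intro!: exI[of _ "_ + c"])
  ultimately show ?thesis
    by (simp add: negligible_iff_null_sets completion.AE_iff_null_sets)
qed

lemma AE_periodic:
  fixes P :: "real \<Rightarrow> bool"
  assumes "X > 0" "AE x in lebesgue. x \<in> {0..X} \<longrightarrow> P x" "\<And>x. P (x + X) \<longleftrightarrow> P x"
  shows "AE x in lebesgue. P x"
proof -
  have nat: "P (x + real n * X) \<longleftrightarrow> P x" for x and n :: nat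
  proof (induction n)
    case (Suc n)
    have "P (x + real n * X + X) \<longleftrightarrow> P x" using assms(3) Suc by simp
    then show ?case by (simp add: algebra_simps)
  qed simp
  have shift: "P (x + of_int j * X) \<longleftrightarrow> P x" for x and j :: int
  proof (cases "j \<ge> 0")
    case True
    then show ?thesis using nat[of x "nat j"] by simp
  next
    case False
    then show ?thesis using nat[of "x + of_int j * X" "nat (- j)"] by simp
  qed
  have "AE x in lebesgue. \<forall>j::int. x + of_int j * X \<in> {0..X} \<longrightarrow> P (x + of_int j * X)"
    unfolding AE_all_countable using AE_lebesgue_translate[OF assms(2)] by blast
  then show ?thesis
  proof eventually_elim
    case (elim x)
    let ?j = "- \<lfloor>x / X\<rfloor>"
    have "of_int \<lfloor>x / X\<rfloor> * X \<le> x" "x \<le> (of_int \<lfloor>x / X\<rfloor> + 1) * X"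
      using assms(1) by (simp_all flip: pos_le_divide_eq pos_divide_le_eq)
    then have "x + of_int ?j * X \<in> {0..X}" by (simp add: algebra_simps)
    then show ?case using elim shift[of x ?j] by blast
  qed
qed

text \<open>The potential is set to 0 off the points all of whose translates by multiples of
  \<open>X\<close> are good. Using all translates makes this set invariant, which preserves
  periodicity, and countability keeps its complement null.\<close>

lemma admissible_normalize:
  assumes "V \<in> admissible X Vp" "X > 0" "Vp > 0"
  obtains V' where "periodic_potential X Vp V'" "AE x in lebesgue. V x = V' x"
proof -
  define Q where "Q x \<longleftrightarrow> V (x + X) = V x \<and> 0 \<le> V x \<and> V x \<le> Vp" for x
  define G where "G = {x. \<forall>j::int. Q (x + of_int j * X)}"
  have "AE x in lebesgue. Q x"
    using assms(1) by (auto simp: admissible_def Q_def)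
  then have "AE x in lebesgue. \<forall>j::int. Q (x + of_int j * X)"
    unfolding AE_all_countable using AE_lebesgue_translate by blast
  then have aeG: "AE x in lebesgue. x \<in> G" by (simp add: G_def)
  have QG: "Q x" if "x \<in> G" for x using that unfolding G_def by (auto dest: spec[of _ 0])
  have GX: "x + X \<in> G \<longleftrightarrow> x \<in> G" for x
  proof
    assume "x + X \<in> G"
    then have "Q (x + X + of_int (j - 1) * X)" for j :: int unfolding G_def by blast
    then show "x \<in> G" by (simp add: G_def algebra_simps)
  next
    assume "x \<in> G"
    then have "Q (x + of_int (j + 1) * X)" for j :: int unfolding G_def by blast
    then show "x + X \<in> G" by (simp add: G_def algebra_simps)
  qed
  define V' where "V' x = (if x \<in> G then V x else 0)" for x
  have "- G \<in> null_sets lebesgue"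
    using aeG by (simp add: completion.AE_iff_null_sets Compl_eq)
  then have "G \<in> sets lebesgue" using null_setsD2 sets.compl_sets[of "- G" lebesgue] by auto
  then have "V' \<in> borel_measurable lebesgue"
    unfolding V'_def[abs_def] using assms(1) by (intro measurable_If_set) (auto simp: admissible_def)
  moreover have "0 \<le> V' x" "V' x \<le> Vp" "V' (x + X) = V' x" for x
    using QG[of x] assms(3) GX[of x] by (auto simp: V'_def Q_def)
  ultimately have "periodic_potential X Vp V'" using assms(2) by unfold_locales auto
  moreover have "AE x in lebesgue. V x = V' x" using aeG by eventually_elim (simp add: V'_def)
  ultimately show thesis using that by blast
qed

lemma periodic_potential_admissible: "periodic_potential X Vp V \<Longrightarrow> V \<in> admissible X Vp"
  unfolding admissible_def periodic_potential_def by auto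

lemma AE_cong_iff:
  assumes "AE x in M. V x = V' x"
  shows "(AE x in M. P x (V x)) \<longleftrightarrow> (AE x in M. P x (V' x))"
  using assms by (intro iffI; elim AE_mp; auto intro!: AE_I2)

lemma gap_edges_AE_cong:
  assumes "AE x in lebesgue. V x = V' x"
  shows "gap_left X m V = gap_left X m V'" "gap_right X m V = gap_right X m V'"
    "gap_ratio X m V = gap_ratio X m V'"
proof -
  have "bloch_eigenspace X V k E = bloch_eigenspace X V' k E" for k E
    unfolding bloch_eigenspace_def
    using AE_cong_iff[OF assms, of "\<lambda>x v. - (_ x + 2 * (\<i> * complex_of_real k) * _ x
                     + (\<i> * complex_of_real k)\<^sup>2 * _ x) + complex_of_real v * _ x = complex_of_real E * _ x"]
    by (simp only:)
  then have "band X V n k = band X V' n k" for n k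
    by (simp add: band_def eigenvalue_enumeration_def)
  then show l: "gap_left X m V = gap_left X m V'" and r: "gap_right X m V = gap_right X m V'"
    by (simp_all add: gap_left_def gap_right_def)
  then show "gap_ratio X m V = gap_ratio X m V'" by (simp add: gap_ratio_def)
qed

lemma edge_eigenfunction_AE_cong:
  assumes "AE x in lebesgue. V x = V' x"
  shows "edge_eigenfunction X m V E \<psi> = edge_eigenfunction X m V' E \<psi>"
  unfolding edge_eigenfunction_def
  using AE_cong_iff[OF assms, of "\<lambda>x v. - _ x + v * \<psi> x = E * \<psi> x"] by (simp only:)

lemma is_local_maximizer_AE_cong:
  assumes "AE x in lebesgue. V x = V' x" "periodic_potential X Vp V'" "is_local_maximizer X Vp m V"
  shows "is_local_maximizer X Vp m V'"
proof -
  have "Linf_dist W V = Linf_dist W V'" if "W \<in> admissible X Vp" for W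
    unfolding Linf_dist_def
  proof (rule esssup_AE_cong)
    show "(\<lambda>x. ereal \<bar>W x - V x\<bar>) \<in> borel_measurable lebesgue"
      "(\<lambda>x. ereal \<bar>W x - V' x\<bar>) \<in> borel_measurable lebesgue"
      using that assms(3) periodic_potential_admissible[OF assms(2)]
      by (auto simp: is_local_maximizer_def admissible_def)
    show "AE x in lebesgue. ereal \<bar>W x - V x\<bar> = ereal \<bar>W x - V' x\<bar>"
      using assms(1) by eventually_elim simp
  qed
  then show ?thesis
    using assms(3) gap_edges_AE_cong(3)[OF assms(1)] periodic_potential_admissible[OF assms(2)]
    unfolding is_local_maximizer_def by auto
qed

text \<open>The change of the angle at \<open>X\<close>, times (n + 1) exp (- A n X), tends to the
  integral of g times the squared solution. Indeed A n tends to - 2 \<open>log_amp\<close>, so exp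
  (- A n) sin^2 of the perturbed angle tends to the squared solution. A sequence of step sizes suits
  dominated convergence.\<close>

lemma pruefer_first_order:
  assumes q: "bdd_meas q" and g: "bdd_meas g" and X: "X > 0"
  defines "qn n \<equiv> \<lambda>x. q x + 1 / real (Suc n) * g x"
  shows "0 < integral {0..X} (\<lambda>x. g x * (sol q t0 x)\<^sup>2) \<Longrightarrow>
      \<forall>\<^sub>F n in sequentially. pruefer q t0 X < pruefer (qn n) t0 X"
    and "integral {0..X} (\<lambda>x. g x * (sol q t0 x)\<^sup>2) < 0 \<Longrightarrow>
      \<forall>\<^sub>F n in sequentially. pruefer (qn n) t0 X < pruefer q t0 X"
proof -
  obtain B where B: "B > 0" "\<And>x. \<bar>q x\<bar> \<le> B" using bdd_meas_bound[OF q] by blast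
  obtain G where G: "G > 0" "\<And>x. \<bar>g x\<bar> \<le> G" using bdd_meas_bound[OF g] by blast
  define K where "K = B + 1"
  have K: "\<bar>q x\<bar> + 1 \<le> K" "K \<ge> 0" for x using B by (auto simp: K_def)
  have qn: "bdd_meas (qn n)" for n
    unfolding qn_def by (intro bdd_meas_add q bdd_meas_cmult g)
  let ?t = "pruefer q t0" and ?tn = "\<lambda>n. pruefer (qn n) t0"
  have "\<forall>n. \<exists>A. primitive A (pruefer_slope q ?t (?tn n)) \<and> A 0 = 0 \<and>
      primitive (\<lambda>x. exp (- A x) * (?tn n x - ?t x)) (\<lambda>x. exp (- A x) * ((qn n x - q x) * (sin (?tn n x))\<^sup>2))"
  proof
    fix n
    show "\<exists>A. primitive A (pruefer_slope q ?t (?tn n)) \<and> A 0 = 0 \<and>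
      primitive (\<lambda>x. exp (- A x) * (?tn n x - ?t x)) (\<lambda>x. exp (- A x) * ((qn n x - q x) * (sin (?tn n x))\<^sup>2))"
      by (rule pruefer_difference_obtain[OF q pruefer_solution[OF q] pruefer_solution[OF qn]]) blast
  qed
  from choice[OF this] obtain A where A': "\<forall>n. primitive (A n) (pruefer_slope q ?t (?tn n)) \<and> A n 0 = 0 \<and>
      primitive (\<lambda>x. exp (- A n x) * (?tn n x - ?t x)) (\<lambda>x. exp (- A n x) * ((qn n x - q x) * (sin (?tn n x))\<^sup>2))" ..
  then have A: "\<And>n. primitive (A n) (pruefer_slope q ?t (?tn n))" "\<And>n. A n 0 = 0"
      "\<And>n. primitive (\<lambda>x. exp (- A n x) * (?tn n x - ?t x)) (\<lambda>x. exp (- A n x) * ((qn n x - q x) * (sin (?tn n x))\<^sup>2))"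
    by simp_all
  have lim_t: "(\<lambda>n. ?tn n x) \<longlonglongrightarrow> ?t x" if x: "x \<in> {0..X}" for x
  proof -
    have "\<bar>?tn n x - ?t x\<bar> \<le> exp (K * X) * (G / real (Suc n) * X * exp (K * X))" for n
    proof -
      have "\<bar>qn n y - q y\<bar> \<le> G / real (Suc n)" for y
        unfolding qn_def using G(2)[of y] by (simp add: divide_right_mono)
      from pruefer_lipschitz[OF q qn[of n] pruefer_solution[OF q, of t0] pruefer_solution[OF qn[of n], of t0] K(1) this, of x X]
      show ?thesis using x by (simp add: q qn)
    qed
    moreover have "(\<lambda>n. exp (K * X) * (G / real (Suc n) * X * exp (K * X))) \<longlonglongrightarrow> exp (K * X) * (0 * X * exp (K * X))"
      by (intro tendsto_intros LIMSEQ_Suc[OF lim_const_over_n])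
    ultimately have "(\<lambda>n. ?tn n x - ?t x) \<longlonglongrightarrow> 0"
      by (intro Lim_null_comparison[of "\<lambda>n. ?tn n x - ?t x"]) auto
    then show ?thesis by (simp add: LIM_zero_iff)
  qed
  have lim_A: "(\<lambda>n. A n x) \<longlonglongrightarrow> - 2 * log_amp q t0 x" if x: "x \<in> {0..X}" for x
  proof -
    let ?s = "\<lambda>y. (q y - 1) * (1 * sin (?t y + ?t y))"
    have "(\<lambda>n. integral {0..x} (pruefer_slope q ?t (?tn n))) \<longlonglongrightarrow> integral {0..x} ?s"
    proof (rule dominated_convergence(2)[where h="\<lambda>_. K"])
      show "pruefer_slope q ?t (?tn n) integrable_on {0..x}" for n
        by (rule loc_bdd_integrable[OF primitive_loc_bdd[OF A(1)]])
      show "(\<lambda>_. K) integrable_on {0..x}" by (rule integrable_const_ivl)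
      show "norm (pruefer_slope q ?t (?tn n) y) \<le> K" for n y
        using abs_pruefer_slope_le[of q ?t "?tn n" y] K(1)[of y] by simp
      fix y assume "y \<in> {0..x}"
      then have "(\<lambda>n. ?tn n y) \<longlonglongrightarrow> ?t y" using x by (intro lim_t) auto
      then have "(\<lambda>n. ?tn n y - ?t y) \<longlonglongrightarrow> 0" "(\<lambda>n. ?tn n y) \<longlonglongrightarrow> ?t y" by (simp_all add: LIM_zero)
      then have "(\<lambda>n. sin_quot (?tn n y - ?t y)) \<longlonglongrightarrow> sin_quot 0"
        by (intro isCont_tendsto_compose[OF isCont_sin_quot])
      then show "(\<lambda>n. pruefer_slope q ?t (?tn n) y) \<longlonglongrightarrow> ?s y"
        unfolding pruefer_slope_def using \<open>(\<lambda>n. ?tn n y) \<longlonglongrightarrow> ?t y\<close>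
        by (intro tendsto_intros) (simp add: sin_quot_def)
    qed
    moreover have "integral {0..x} (pruefer_slope q ?t (?tn n)) = A n x" for n
      using primitive_integral[OF A(1), of 0 x n] A(2) x by simp
    moreover have "integral {0..x} ?s = - 2 * log_amp q t0 x"
    proof -
      have "primitive (\<lambda>x. - 2 * log_amp q t0 x) ?s"
        by (rule primitive_cong[OF primitive_cmult[OF log_amp(2)[OF q], of "-2"]]) (simp_all add: sin_double algebra_simps)
      then show ?thesis using primitive_integral[of _ ?s 0 x] log_amp(1)[OF q] x by fastforce
    qed
    ultimately show ?thesis by simp
  qed
  let ?J = "\<lambda>n. integral {0..X} (\<lambda>x. exp (- A n x) * (g x * (sin (?tn n x))\<^sup>2))"
  have J: "exp (- A n X) * (?tn n X - ?t X) = 1 / real (Suc n) * ?J n" for n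
  proof -
    have "exp (- A n X) * (?tn n X - ?t X) = integral {0..X} (\<lambda>x. exp (- A n x) * ((qn n x - q x) * (sin (?tn n x))\<^sup>2))"
      using primitive_integral[OF A(3), of 0 X n] X by (simp add: q qn)
    also have "\<dots> = integral {0..X} (\<lambda>x. 1 / real (Suc n) * (exp (- A n x) * (g x * (sin (?tn n x))\<^sup>2)))"
      by (simp add: qn_def mult_ac)
    finally show ?thesis by (simp only: integral_mult_right)
  qed
  have lim_J: "?J \<longlonglongrightarrow> integral {0..X} (\<lambda>x. g x * (sol q t0 x)\<^sup>2)"
  proof (rule dominated_convergence(2)[where h="\<lambda>_. exp (K * X) * G"])
    show "(\<lambda>x. exp (- A n x) * (g x * (sin (?tn n x))\<^sup>2)) integrable_on {0..X}" for n
      by (intro loc_bdd_integrable loc_bdd_mult bdd_meas_loc_bdd[OF g] loc_bdd_continuous continuous_intros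
          primitive_continuous[OF A(1)] pruefer_continuous qn)
    show "(\<lambda>_. exp (K * X) * G) integrable_on {0..X}" by (rule integrable_const_ivl)
    fix n x assume x: "x \<in> {0..X}"
    have "norm (A n x - A n 0) \<le> K * (x - 0)"
      using abs_pruefer_slope_le[of q ?t "?tn n"] K(1) x
      by (intro primitive_norm_diff_le[OF A(1)]) (auto intro: order_trans)
    also have "\<dots> \<le> K * X" using K(2) x by (intro mult_left_mono) auto
    finally have "exp (- A n x) \<le> exp (K * X)" using A(2) by (simp add: abs_le_iff)
    then have "exp (- A n x) * (\<bar>g x\<bar> * (sin (?tn n x))\<^sup>2) \<le> exp (K * X) * (G * 1)"
      using G by (intro mult_mono) (auto simp: abs_square_le_1)
    then show "norm (exp (- A n x) * (g x * (sin (?tn n x))\<^sup>2)) \<le> exp (K * X) * G"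
      by (simp add: abs_mult)
  next
    fix x assume x: "x \<in> {0..X}"
    have "(\<lambda>n. exp (- A n x) * (g x * (sin (?tn n x))\<^sup>2)) \<longlonglongrightarrow> exp (- (- 2 * log_amp q t0 x)) * (g x * (sin (?t x))\<^sup>2)"
      by (intro tendsto_intros lim_A lim_t x)
    then show "(\<lambda>n. exp (- A n x) * (g x * (sin (?tn n x))\<^sup>2)) \<longlonglongrightarrow> g x * (sol q t0 x)\<^sup>2"
      by (simp add: sol_def power_mult_distrib exp_double mult_ac)
  qed
  show "\<forall>\<^sub>F n in sequentially. ?t X < ?tn n X" if "0 < integral {0..X} (\<lambda>x. g x * (sol q t0 x)\<^sup>2)"
    using order_tendstoD(1)[OF lim_J that]
  proof eventually_elim
    case (elim n)
    then have "0 < exp (- A n X) * (?tn n X - ?t X)" unfolding J by simp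
    then show ?case by (simp add: zero_less_mult_iff)
  qed
  show "\<forall>\<^sub>F n in sequentially. ?tn n X < ?t X" if "integral {0..X} (\<lambda>x. g x * (sol q t0 x)\<^sup>2) < 0"
    using order_tendstoD(2)[OF lim_J that]
  proof eventually_elim
    case (elim n)
    then have "exp (- A n X) * (?tn n X - ?t X) < 0" unfolding J by (intro mult_pos_neg) simp_all
    then show ?case by (simp add: mult_less_0_iff)
  qed
qed

lemma integral_zero_AE:
  fixes h :: "real \<Rightarrow> real"
  assumes "loc_bdd h" "\<And>x. 0 \<le> h x" "integral {a..b} h = 0"
  shows "AE x in lebesgue. x \<in> {a..b} \<longrightarrow> h x = 0"
proof -
  have "h absolutely_integrable_on {a..b}"
    using assms(1,2) by (intro nonnegative_absolutely_integrable_1 loc_bdd_integrable) auto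
  then have i: "integrable (lebesgue_on {a..b}) h"
    by (rule absolutely_integrable_imp_integrable) simp
  have "integral\<^sup>L (lebesgue_on {a..b}) h = 0"
    using lebesgue_integral_eq_integral[OF i] assms(3) by simp
  then have "AE x in lebesgue_on {a..b}. h x = 0"
    using integral_nonneg_eq_0_iff_AE[OF i] assms(2) by simp
  then show ?thesis by (subst (asm) AE_restrict_space_iff) auto
qed

text \<open>After cross-multiplication the two sides differ by 2 (a b' - b a').\<close>

lemma gap_ratio_less:
  fixes a b a' b' :: real
  assumes "0 < a" "0 < a'" "a \<le> b" "a' \<le> b'" "b * a' < a * b'"
  shows "(b - a) / ((a + b) / 2) < (b' - a') / ((a' + b') / 2)"
proof -
  have "(b - a) * (a' + b') < (b' - a') * (a + b)" using assms(5) by (simp add: algebra_simps)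
  moreover have "0 < a + b" "0 < a' + b'" using assms by linarith+
  ultimately show ?thesis by (simp add: frac_less_eq divide_less_eq less_divide_eq field_simps)
qed

context periodic_potential
begin

text \<open>The angle of \<psi> advances by m pi in the unperturbed problem. Moving the energy by s
  c and the potential by s W changes its advance to first order with the sign of the integral of (c
  - W) \<psi>^2, which is c - I. This makes it a trial angle for the perturbed edge.\<close>

lemma perturbed_edges:
  assumes m: "m \<ge> 1" and W: "bdd_meas W" and pp: "\<And>n. periodic_potential X Vp (\<lambda>x. V x + 1 / real (Suc n) * W x)"
    and edge: "edge_eigenfunction X m V E \<psi>" and hit: "adv_min E \<le> real m * pi" "real m * pi \<le> adv_max E"
    and I: "((\<lambda>x. W x * (\<psi> x)\<^sup>2) has_integral I) {0..X}"
  shows "I < c \<Longrightarrow> \<forall>\<^sub>F n in sequentially. gap_left X m (\<lambda>x. V x + 1 / real (Suc n) * W x) \<le> E + 1 / real (Suc n) * c"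
    and "c < I \<Longrightarrow> \<forall>\<^sub>F n in sequentially. E + 1 / real (Suc n) * c \<le> gap_right X m (\<lambda>x. V x + 1 / real (Suc n) * W x)"
proof -
  obtain R t0 where R: "R > 0" "\<And>x. \<psi> x = R * sol (qE E) t0 x" and t0: "adv E t0 = real m * pi"
    using edge_eigenfunction_polar[OF edge hit] by blast
  define g where "g x = c - W x" for x
  have g: "bdd_meas g" unfolding g_def by (intro bdd_meas_diff W bdd_meas_const)
  have "((\<lambda>x. c * (\<psi> x)\<^sup>2 - W x * (\<psi> x)\<^sup>2) has_integral c * 1 - I) {0..X}"
    using edge unfolding edge_eigenfunction_def by (intro has_integral_diff has_integral_mult_right I) blast
  then have "((\<lambda>x. 1 / R\<^sup>2 * (c * (\<psi> x)\<^sup>2 - W x * (\<psi> x)\<^sup>2)) has_integral 1 / R\<^sup>2 * (c * 1 - I)) {0..X}"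
    by (rule has_integral_mult_right)
  moreover have "1 / R\<^sup>2 * (c * (\<psi> x)\<^sup>2 - W x * (\<psi> x)\<^sup>2) = g x * (sol (qE E) t0 x)\<^sup>2" for x
    using R(1) by (simp add: R(2) g_def power_mult_distrib field_simps)
  ultimately have int: "integral {0..X} (\<lambda>x. g x * (sol (qE E) t0 x)\<^sup>2) = (c - I) / R\<^sup>2"
    by (simp add: integral_unique)
  \<comment> \<open>Energy shift and potential shift combine into one perturbation of E - V, to
    which the first-order lemma applies.\<close>
  have q: "(\<lambda>x. qE E x + 1 / real (Suc n) * g x) =
      periodic_potential.qE (\<lambda>x. V x + 1 / real (Suc n) * W x) (E + 1 / real (Suc n) * c)" for n
    unfolding fun_eq_iff periodic_potential.qE_def[OF pp] qE_def g_def
    by (simp add: diff_divide_distrib)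
  have adv: "pruefer (\<lambda>x. qE E x + 1 / real (Suc n) * g x) t0 X - t0 =
      periodic_potential.adv X (\<lambda>x. V x + 1 / real (Suc n) * W x) (E + 1 / real (Suc n) * c) t0" for n
    unfolding q periodic_potential.adv_def[OF pp] ..
  show "\<forall>\<^sub>F n in sequentially. gap_left X m (\<lambda>x. V x + 1 / real (Suc n) * W x) \<le> E + 1 / real (Suc n) * c" if "I < c"
  proof -
    have "0 < integral {0..X} (\<lambda>x. g x * (sol (qE E) t0 x)\<^sup>2)" unfolding int using that R(1) by simp
    from pruefer_first_order(1)[OF qE_bdd g X_pos this] show ?thesis
    proof eventually_elim
      case (elim n)
      then have "real m * pi \<le> pruefer (\<lambda>x. qE E x + 1 / real (Suc n) * g x) t0 X - t0"
        using t0 unfolding adv_def by linarith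
      then show ?case unfolding adv by (rule periodic_potential.gap_left_leI[OF pp m])
    qed
  qed
  show "\<forall>\<^sub>F n in sequentially. E + 1 / real (Suc n) * c \<le> gap_right X m (\<lambda>x. V x + 1 / real (Suc n) * W x)" if "c < I"
  proof -
    have "integral {0..X} (\<lambda>x. g x * (sol (qE E) t0 x)\<^sup>2) < 0" unfolding int using that R(1) by (simp add: divide_less_0_iff)
    from pruefer_first_order(2)[OF qE_bdd g X_pos this] show ?thesis
    proof eventually_elim
      case (elim n)
      then have "pruefer (\<lambda>x. qE E x + 1 / real (Suc n) * g x) t0 X - t0 \<le> real m * pi"
        using t0 unfolding adv_def by linarith
      then show ?case unfolding adv by (rule periodic_potential.gap_right_geI[OF pp])
    qed
  qed
qed

text \<open>Moving the potential towards \<open>Vp\<close> where \<open>\<psi>\<alpha>\<^sup>2 / \<alpha> < \<psi>\<beta>\<^sup>2 / \<beta>\<close> and towards \<open>0\<close> where the opposite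
  strict inequality holds increases \<open>\<beta> / \<alpha>\<close> to first order unless the potential is already extremal
  there.\<close>

lemma local_maximizer_bang_bang:
  assumes m: "m \<ge> 1" and max: "is_local_maximizer X Vp m V"
    and ea: "edge_eigenfunction X m V (gap_left X m V) \<psi>\<alpha>"
    and eb: "edge_eigenfunction X m V (gap_right X m V) \<psi>\<beta>"
  shows "AE x in lebesgue.
      ((\<psi>\<alpha> x)\<^sup>2 / gap_left X m V < (\<psi>\<beta> x)\<^sup>2 / gap_right X m V \<longrightarrow> V x = Vp)
    \<and> ((\<psi>\<alpha> x)\<^sup>2 / gap_left X m V > (\<psi>\<beta> x)\<^sup>2 / gap_right X m V \<longrightarrow> V x = 0)"
proof -
  define \<alpha> where "\<alpha> = gap_left X m V"
  define \<beta> where "\<beta> = gap_right X m V"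
  have ab: "0 < \<alpha>" "\<alpha> \<le> \<beta>" using gap_left_pos[OF m] gap_left_le_right[OF m] by (simp_all add: \<alpha>_def \<beta>_def)
  have adva: "adv_min \<alpha> \<le> real m * pi" "real m * pi \<le> adv_max \<alpha>"
    using gap_left_edge[OF m] adv_ge_min[of \<alpha>] adv_max[of \<alpha>] unfolding \<alpha>_def by (metis order_refl adv_max)+
  have advb: "adv_min \<beta> \<le> real m * pi" "real m * pi \<le> adv_max \<beta>"
    using gap_right_edge[of m] adv_le_max[of \<beta>] unfolding \<beta>_def by (metis order_refl adv_min)+
  obtain \<psi>\<alpha>' where sa: "solves (qE \<alpha>) \<psi>\<alpha> \<psi>\<alpha>'" using edge_eigenfunction_solves[OF ea] unfolding \<alpha>_def by blast
  obtain \<psi>\<beta>' where sb: "solves (qE \<beta>) \<psi>\<beta> \<psi>\<beta>'" using edge_eigenfunction_solves[OF eb] unfolding \<beta>_def by blast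
  define fa where "fa x = (\<psi>\<alpha> x)\<^sup>2 / \<alpha>" for x
  define fb where "fb x = (\<psi>\<beta> x)\<^sup>2 / \<beta>" for x
  have ca: "continuous_on UNIV fa" and cb: "continuous_on UNIV fb"
    unfolding fa_def fb_def using ab by (auto intro!: continuous_intros solves_continuous(1)[OF sa] solves_continuous(1)[OF sb])
  have "((-1) ^ m * y)\<^sup>2 = y\<^sup>2" for y :: real by (simp add: power_mult_distrib flip: power_mult)
  then have per: "fa (x + X) = fa x" "fb (x + X) = fb x" for x
    using ea eb by (simp_all add: fa_def fb_def edge_eigenfunction_def)
  \<comment> \<open>\<open>W\<close> leads from \<open>V\<close> to the prescribed extreme value, so
    V + s W stays admissible for all s in [0, 1].\<close>
  define W where "W x = (if fa x < fb x then Vp - V x else if fb x < fa x then - V x else 0)" for x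
  have W_meas: "W \<in> borel_measurable lebesgue"
  proof -
    have [measurable]: "fa \<in> borel_measurable lebesgue" "fb \<in> borel_measurable lebesgue"
      using loc_bdd_continuous[OF ca] loc_bdd_continuous[OF cb] by (simp_all add: loc_bdd_def)
    note V_meas[measurable]
    show ?thesis unfolding W_def[abs_def] by measurable
  qed
  have W_bd: "\<bar>W x\<bar> \<le> Vp" for x using V_bounds[of x] Vp_nonneg by (auto simp: W_def)
  then have W: "bdd_meas W" by (rule bdd_measI[OF W_meas])
  have W_per: "W (x + X) = W x" for x by (simp add: W_def per V_periodic)
  \<comment> \<open>\<open>W\<close> and fb - fa never have opposite signs. The integral of
    \<open>h\<close> is Ib/\<beta> - Ia/\<alpha>, the formal first-order gain of log \<beta> - log
    \<alpha>.\<close>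
  define h where "h x = W x * (fb x - fa x)" for x
  have h0: "0 \<le> h x" for x
    using V_bounds[of x] by (auto simp: h_def W_def intro: mult_nonneg_nonpos)
  have h_loc_bdd: "loc_bdd h" unfolding h_def
    by (intro loc_bdd_mult bdd_meas_loc_bdd W loc_bdd_continuous continuous_intros ca cb)
  have "AE x in lebesgue. x \<in> {0..X} \<longrightarrow> h x = 0"
  proof (rule integral_zero_AE[OF h_loc_bdd h0], rule ccontr)
    assume "integral {0..X} h \<noteq> 0"
    moreover have "0 \<le> integral {0..X} h"
      using h0 by (intro Henstock_Kurzweil_Integration.integral_nonneg loc_bdd_integrable h_loc_bdd)
    ultimately have hpos: "0 < integral {0..X} h" by simp
    define Ia where "Ia = integral {0..X} (\<lambda>x. W x * (\<psi>\<alpha> x)\<^sup>2)"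
    define Ib where "Ib = integral {0..X} (\<lambda>x. W x * (\<psi>\<beta> x)\<^sup>2)"
    have ia: "((\<lambda>x. W x * (\<psi>\<alpha> x)\<^sup>2) has_integral Ia) {0..X}" unfolding Ia_def
      by (intro integrable_integral loc_bdd_integrable loc_bdd_mult bdd_meas_loc_bdd W loc_bdd_continuous continuous_intros
          solves_continuous(1)[OF sa])
    have ib: "((\<lambda>x. W x * (\<psi>\<beta> x)\<^sup>2) has_integral Ib) {0..X}" unfolding Ib_def
      by (intro integrable_integral loc_bdd_integrable loc_bdd_mult bdd_meas_loc_bdd W loc_bdd_continuous continuous_intros
          solves_continuous(1)[OF sb])
    have "((\<lambda>x. 1 / \<beta> * (W x * (\<psi>\<beta> x)\<^sup>2) - 1 / \<alpha> * (W x * (\<psi>\<alpha> x)\<^sup>2)) has_integral 1 / \<beta> * Ib - 1 / \<alpha> * Ia) {0..X}"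
      by (intro has_integral_diff has_integral_mult_right ia ib)
    moreover have "1 / \<beta> * (W x * (\<psi>\<beta> x)\<^sup>2) - 1 / \<alpha> * (W x * (\<psi>\<alpha> x)\<^sup>2) = h x" for x
      by (simp add: h_def fa_def fb_def algebra_simps)
    ultimately have "integral {0..X} h = 1 / \<beta> * Ib - 1 / \<alpha> * Ia" by (simp add: integral_unique)
    then have "\<alpha> * \<beta> * integral {0..X} h = \<alpha> * Ib - \<beta> * Ia" using ab by (simp add: field_simps)
    moreover have "0 < \<alpha> * \<beta> * integral {0..X} h" using hpos ab by simp
    ultimately have gain: "\<beta> * Ia < \<alpha> * Ib" by linarith
    \<comment> \<open>Raising Ia and lowering Ib by this amount costs exactly half of the gain
      \<alpha> Ib - \<beta> Ia, so a strict inequality survives.\<close>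
    define \<epsilon> where "\<epsilon> = (\<alpha> * Ib - \<beta> * Ia) / (2 * (\<alpha> + \<beta>))"
    have \<epsilon>: "\<epsilon> > 0" using gain ab by (simp add: \<epsilon>_def)
    have "2 * (\<epsilon> * (\<alpha> + \<beta>)) = \<alpha> * Ib - \<beta> * Ia" using ab by (simp add: \<epsilon>_def field_simps)
    moreover have "0 < \<epsilon> * (\<alpha> + \<beta>)" using \<epsilon> ab by simp
    ultimately have "\<epsilon> * (\<alpha> + \<beta>) < \<alpha> * Ib - \<beta> * Ia" by linarith
    then have gain': "\<beta> * (Ia + \<epsilon>) < \<alpha> * (Ib - \<epsilon>)" by (simp add: algebra_simps)
    let ?V = "\<lambda>n x. V x + 1 / real (Suc n) * W x"
    have pp: "periodic_potential X Vp (?V n)" for n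
    proof
      show "?V n \<in> borel_measurable lebesgue" using V_meas W_meas by simp
      fix x
      define s where "s = 1 / real (Suc n)"
      have s: "0 \<le> s" "s \<le> 1" by (simp_all add: s_def)
      have 1: "s * (Vp - V x) \<le> 1 * (Vp - V x)" "0 \<le> s * (Vp - V x)" "s * V x \<le> 1 * V x" "0 \<le> s * V x"
        using s V_bounds[of x] by (intro mult_right_mono mult_nonneg_nonneg; simp)+
      have "0 \<le> V x + s * W x \<and> V x + s * W x \<le> Vp"
        unfolding W_def using 1 V_bounds[of x] by (auto simp: algebra_simps)
      then show "0 \<le> ?V n x" "?V n x \<le> Vp" by (simp_all add: s_def)
      show "?V n (x + X) = ?V n x" by (simp add: W_per V_periodic)
    qed (rule X_pos)
    obtain e where e: "e > 0" "\<And>U. U \<in> admissible X Vp \<Longrightarrow> Linf_dist U V < ereal e \<Longrightarrow> gap_ratio X m U \<le> gap_ratio X m V"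
      using max unfolding is_local_maximizer_def by blast
    have evL: "\<forall>\<^sub>F n in sequentially. gap_left X m (?V n) \<le> \<alpha> + 1 / real (Suc n) * (Ia + \<epsilon>)"
      using perturbed_edges(1)[OF m W pp ea[folded \<alpha>_def] adva ia, of "Ia + \<epsilon>"] \<epsilon> by simp
    have evR: "\<forall>\<^sub>F n in sequentially. \<beta> + 1 / real (Suc n) * (Ib - \<epsilon>) \<le> gap_right X m (?V n)"
      using perturbed_edges(2)[OF m W pp eb[folded \<beta>_def] advb ib, of "Ib - \<epsilon>"] \<epsilon> by simp
    have "(\<lambda>n. Vp / real (Suc n)) \<longlonglongrightarrow> 0" by (rule LIMSEQ_Suc[OF lim_const_over_n])
    then have "\<forall>\<^sub>F n in sequentially. Vp / real (Suc n) < e" using e(1) by (rule order_tendstoD)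
    then have "\<forall>\<^sub>F n in sequentially. False"
      using evL evR
    proof eventually_elim
      case (elim n)
      define s where "s = 1 / real (Suc n)"
      have s: "s > 0" by (simp add: s_def)
      have Vn: "periodic_potential X Vp (?V n)" by (rule pp)
      have "Linf_dist (?V n) V \<le> ereal (Vp / real (Suc n))"
        unfolding Linf_dist_def
      proof (rule esssup_I)
        show "(\<lambda>x. ereal \<bar>?V n x - V x\<bar>) \<in> borel_measurable lebesgue" using W_meas by simp
        show "AE x in lebesgue. ereal \<bar>?V n x - V x\<bar> \<le> ereal (Vp / real (Suc n))"
          using W_bd by (intro AE_I2) (simp add: divide_right_mono)
      qed
      also have "\<dots> < ereal e" using elim(1) by simp
      finally have le: "gap_ratio X m (?V n) \<le> gap_ratio X m V"
        using e(2) periodic_potential_admissible[OF pp] by blast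
      have a': "0 < gap_left X m (?V n)" "gap_left X m (?V n) \<le> gap_right X m (?V n)"
        using periodic_potential.gap_left_pos[OF Vn m] periodic_potential.gap_left_le_right[OF Vn m] by auto
      have "\<beta> * gap_left X m (?V n) \<le> \<beta> * (\<alpha> + s * (Ia + \<epsilon>))"
        using elim(2) ab by (intro mult_left_mono) (simp_all add: s_def)
      also have "\<dots> = \<alpha> * \<beta> + s * (\<beta> * (Ia + \<epsilon>))" by (simp add: algebra_simps)
      also have "\<dots> < \<alpha> * \<beta> + s * (\<alpha> * (Ib - \<epsilon>))" using gain' s by simp
      also have "\<dots> = \<alpha> * (\<beta> + s * (Ib - \<epsilon>))" by (simp add: algebra_simps)
      also have "\<dots> \<le> \<alpha> * gap_right X m (?V n)"
        using elim(3) ab by (intro mult_left_mono) (simp_all add: s_def)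
      finally have "gap_ratio X m V < gap_ratio X m (?V n)"
        unfolding gap_ratio_def \<alpha>_def[symmetric] \<beta>_def[symmetric] using gap_ratio_less[OF ab(1) a'(1) ab(2) a'(2)] by blast
      then show False using le by simp
    qed
    then show False by simp
  qed
  then have "AE x in lebesgue. h x = 0"
    by (rule AE_periodic[OF X_pos]) (simp add: h_def W_per per)
  then show ?thesis
    unfolding \<alpha>_def[symmetric] \<beta>_def[symmetric] fa_def[symmetric] fb_def[symmetric]
    by eventually_elim (auto simp: h_def W_def)
qed

end

section \<open>Isolated zeros and the bang-bang property\<close>

lemma eventually_nonzero_if_derivative:
  fixes f :: "real \<Rightarrow> real"
  assumes "(f has_real_derivative D) (at x)" "f x \<noteq> 0 \<or> D \<noteq> 0"
  shows "\<forall>\<^sub>F y in at x. f y \<noteq> 0"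
proof (cases "f x = 0")
  case False
  have "(f \<longlongrightarrow> f x) (at x)" using DERIV_isCont[OF assms(1)] by (simp add: isCont_def)
  then show ?thesis using False by (rule tendsto_imp_eventually_ne)
next
  case True
  have "((\<lambda>y. (f y - f x) / (y - x)) \<longlongrightarrow> D) (at x)"
    using assms(1) by (simp add: has_field_derivative_iff)
  then have "\<forall>\<^sub>F y in at x. (f y - f x) / (y - x) \<noteq> 0"
    using assms(2) True by (intro tendsto_imp_eventually_ne) auto
  then show ?thesis by eventually_elim (use True in auto)
qed

lemma solves_nontrivial_at:
  fixes y :: "real \<Rightarrow> real"
  assumes "bdd_meas q" "solves q y y'" "y z \<noteq> 0"
  shows "y x \<noteq> 0 \<or> y' x \<noteq> 0"
proof -
  have "y 0 \<noteq> 0 \<or> y' 0 \<noteq> 0"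
  proof (rule ccontr)
    assume n: "\<not> ?thesis"
    have "y z = 0" unfolding fundamental_repr(1)[OF assms(1,2), of z] using n by simp
    then show False using assms(3) by simp
  qed
  then obtain R t0 where R: "R > 0" "\<And>x. y x = R * sol q t0 x" "\<And>x. y' x = R * dsol q t0 x"
    using sol_polar[OF assms(1,2)] by blast
  have "sol q t0 x \<noteq> 0 \<or> dsol q t0 x \<noteq> 0"
    using sol_amp[of q t0 x] by (metis exp_not_eq_zero add_0 power_zero_numeral)
  then show ?thesis using R by auto
qed

lemma finite_isolated:
  fixes Z :: "real set"
  assumes "\<And>x. \<forall>\<^sub>F y in at x. y \<notin> Z"
  shows "finite (Z \<inter> {a..b})"
proof (rule ccontr)
  assume "infinite (Z \<inter> {a..b})"
  then obtain x where "x islimpt (Z \<inter> {a..b})"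
    using compact_eq_Bolzano_Weierstrass[of "{a..b}"] by auto
  then have "x islimpt Z" using islimpt_subset by blast
  then show False using assms[of x] by (simp add: islimpt_iff_eventually)
qed

context periodic_potential
begin

text \<open>At a double zero of \<open>p + r\<close> the Wronskian \<open>p' r - p r'\<close> vanishes, but it is strictly monotone
  near that point because its derivative is \<open>(b - a) p r\<close> and \<open>r\<close> is close to \<open>- p\<close>. So Rolle's
  theorem for \<open>(p + r) / p\<close> excludes further zeros nearby.\<close>

lemma sum_isolated_zeros:
  assumes p: "solves (qE a) p p'" and r: "solves (qE b) r r'" and "a < b" and pz: "p z \<noteq> (0::real)"
  shows "\<forall>\<^sub>F x in at x0. p x + r x \<noteq> 0"
proof -
  define g where "g x = p x + r x" for x
  define w where "w x = p' x * r x - p x * r' x" for x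
  have dp: "(p has_real_derivative p' x) (at x)" and dr: "(r has_real_derivative r' x) (at x)" for x
    using solves_has_vector_derivative[OF p] solves_has_vector_derivative[OF r]
    by (simp_all add: has_real_derivative_iff_has_vector_derivative)
  have dg: "(g has_real_derivative p' x + r' x) (at x)" for x
    unfolding g_def by (intro DERIV_add dp dr)
  have p_ne: "\<forall>\<^sub>F x in at x0. p x \<noteq> 0"
    using solves_nontrivial_at[OF qE_bdd p pz, of x0] by (rule eventually_nonzero_if_derivative[OF dp])
  show ?thesis
  proof (cases "g x0 = 0 \<and> p' x0 + r' x0 = 0")
    case False
    then have "\<forall>\<^sub>F x in at x0. g x \<noteq> 0" by (intro eventually_nonzero_if_derivative[OF dg]) auto
    then show ?thesis by (simp add: g_def)
  next
    case True
    then have r0: "r x0 = - p x0" "r' x0 = - p' x0" by (simp_all add: g_def)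
    have lim: "((\<lambda>x. g x / p x) \<longlongrightarrow> 0) (at x0)"
    proof (cases "p x0 = 0")
      case False
      have "((\<lambda>x. g x / p x) \<longlongrightarrow> g x0 / p x0) (at x0)"
        using DERIV_isCont[OF dg, of x0] DERIV_isCont[OF dp, of x0] False
        by (intro tendsto_divide) (simp_all add: isCont_def)
      then show ?thesis using True by simp
    next
      case z: True
      then have p'0: "p' x0 \<noteq> 0" using solves_nontrivial_at[OF qE_bdd p pz, of x0] by simp
      \<comment> \<open>A quotient of difference quotients: g and its derivative vanish at x0, while
        p has a simple zero there.\<close>
      have "((\<lambda>x. ((g x - g x0) / (x - x0)) / ((p x - p x0) / (x - x0))) \<longlongrightarrow> (p' x0 + r' x0) / p' x0) (at x0)"
        using dg[of x0] dp[of x0] p'0 by (intro tendsto_divide) (simp_all add: has_field_derivative_iff)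
      then have "((\<lambda>x. ((g x - g x0) / (x - x0)) / ((p x - p x0) / (x - x0))) \<longlongrightarrow> 0) (at x0)"
        using True by simp
      then show ?thesis
      proof (rule Lim_transform_eventually)
        show "\<forall>\<^sub>F x in at x0. ((g x - g x0) / (x - x0)) / ((p x - p x0) / (x - x0)) = g x / p x"
          using eventually_neq_at_within[of x0] by eventually_elim (use True z in auto)
      qed
    qed
    have "\<forall>\<^sub>F x in at x0. p x \<noteq> 0 \<and> g x / p x < 1"
      using p_ne order_tendstoD(2)[OF lim, of 1] by (simp add: eventually_conj)
    then obtain d where d: "d > 0" "\<And>x. x \<noteq> x0 \<Longrightarrow> dist x x0 < d \<Longrightarrow> p x \<noteq> 0 \<and> g x / p x < 1"
      unfolding eventually_at by blast
    have pr_neg: "0 < - (p x * r x)" if "x \<noteq> x0" "dist x x0 < d" for x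
    proof -
      have "p x * r x = (p x)\<^sup>2 * (g x / p x - 1)"
        using d(2)[OF that] by (simp add: g_def power2_eq_square field_simps)
      moreover have "(p x)\<^sup>2 * (g x / p x - 1) < 0"
        using d(2)[OF that] by (intro mult_pos_neg) auto
      ultimately show ?thesis by simp
    qed
    have pr_nonneg: "0 \<le> - (p x * r x)" if "dist x x0 < d" for x
      using pr_neg[of x] that r0 by (cases "x = x0") auto
    have w_prim: "primitive (\<lambda>x. - w x) (\<lambda>x. (b - a) * - (p x * r x))"
      by (rule primitive_cong[OF solves_wronskian[OF p r]])
        (simp_all add: w_def qE_def algebra_simps)
    have w_cont: "continuous_on S (\<lambda>x. (b - a) * - (p x * r x))" for S
      by (intro continuous_intros solves_continuous(1)[OF p] solves_continuous(1)[OF r])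
    have w_mono: "w t < w s" if st: "s < t" "dist s x0 < d" "dist t x0 < d" for s t
    proof -
      have near: "dist x x0 < d" if "x \<in> {s..t}" for x
        using that \<open>dist s x0 < d\<close> \<open>dist t x0 < d\<close> by (auto simp: dist_real_def abs_less_iff)
      obtain y where y: "y \<in> {s..t}" "y \<noteq> x0"
        using st(1) by (metis atLeastAtMost_iff less_imp_le less_irrefl order_refl)
      have "0 \<le> (b - a) * - (p x * r x)" if "x \<in> {s..t}" for x
        using assms(3) by (intro mult_nonneg_nonneg pr_nonneg near[OF that]) simp
      moreover have "0 < (b - a) * - (p y * r y)"
        using assms(3) by (intro mult_pos_pos pr_neg[OF y(2) near[OF y(1)]]) simp
      ultimately have "- w s < - w t"
        by (intro primitive_strict_mono[OF w_prim st(1) w_cont _ y(1)]) auto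
      then show ?thesis by simp
    qed
    have w0: "w x0 = 0" using r0 by (simp add: w_def)
    have "g x1 \<noteq> 0" if x1: "x1 \<noteq> x0" "dist x1 x0 < d" for x1
    proof
      assume g1: "g x1 = 0"
      \<comment> \<open>The quotient g / p, extended by its limit at x0. Its derivative elsewhere is
        - w / p^2, so a Rolle point strictly between x0 and x1 would be a second zero of the
        strictly decreasing w.\<close>
      define h where "h x = (if x = x0 then 0 else g x / p x)" for x
      define s where "s = min x0 x1"
      define t where "t = max x0 x1"
      have st: "s < t" using x1 by (auto simp: s_def t_def)
      have near: "dist x x0 < d" if "x \<in> {s..t}" for x
        using that x1 d(1) by (auto simp: s_def t_def dist_real_def abs_less_iff min_def max_def split: if_splits)
      have dh: "(h has_real_derivative - w x / (p x)\<^sup>2) (at x)" if x: "x \<noteq> x0" "dist x x0 < d" for x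
      proof -
        have px: "p x \<noteq> 0" using d(2)[OF x] by simp
        have "((\<lambda>x. g x / p x) has_real_derivative ((p' x + r' x) * p x - g x * p' x) / (p x * p x)) (at x)"
          by (rule DERIV_divide[OF dg dp px])
        moreover have "((p' x + r' x) * p x - g x * p' x) / (p x * p x) = - w x / (p x)\<^sup>2"
          by (simp add: g_def w_def power2_eq_square algebra_simps)
        ultimately have "((\<lambda>x. g x / p x) has_real_derivative - w x / (p x)\<^sup>2) (at x)" by simp
        moreover have "\<forall>\<^sub>F y in nhds x. h y = g y / p y"
          using t1_space_nhds[OF x(1)] by eventually_elim (simp add: h_def)
        ultimately show ?thesis by (simp add: DERIV_cong_ev)
      qed
      have "(h \<longlongrightarrow> 0) (at x0)"
      proof (rule Lim_transform_eventually[OF lim])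
        show "\<forall>\<^sub>F x in at x0. g x / p x = h x"
          using eventually_neq_at_within[of x0] by eventually_elim (simp add: h_def)
      qed
      then have "isCont h x0" by (simp add: isCont_def h_def[of x0])
      then have "isCont h x" if "x \<in> {s..t}" for x
        using DERIV_isCont[OF dh[OF _ near[OF that]]] by (cases "x = x0") auto
      then have hc: "continuous_on {s..t} h" by (simp add: continuous_at_imp_continuous_on)
      have inner: "x \<noteq> x0" if "s < x" "x < t" for x using that by (auto simp: s_def t_def min_def max_def split: if_splits)
      have "h s = h t" using g1 by (auto simp: h_def s_def t_def min_def max_def)
      moreover have "h differentiable (at x)" if "s < x" "x < t" for x
        using dh[OF inner[OF that] near[of x]] that by (auto simp: real_differentiable_def)
      ultimately obtain \<xi> where \<xi>: "s < \<xi>" "\<xi> < t" "(h has_real_derivative 0) (at \<xi>)"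
        using Rolle[OF st _ hc] by blast
      have n: "\<xi> \<noteq> x0" "dist \<xi> x0 < d" using inner near[of \<xi>] \<xi> by auto
      have "- w \<xi> / (p \<xi>)\<^sup>2 = 0" using DERIV_unique[OF dh[OF n] \<xi>(3)] .
      then have "w \<xi> = 0" using d(2)[OF n] by simp
      then show False using w_mono[of \<xi> x0] w_mono[of x0 \<xi>] n w0 d(1) by (cases "\<xi> < x0") auto
    qed
    then have "\<forall>\<^sub>F x in at x0. g x \<noteq> 0" unfolding eventually_at using d(1) by blast
    then show ?thesis by (simp add: g_def)
  qed
qed

text \<open>At a closed gap \<open>sf\<close> and \<open>cf\<close> both yield eigenfunctions at
  either edge. Exchanging them forces \<open>V\<close> to equal \<open>Vp\<close> and 0 almost
  everywhere on the set where f > 0, which is open and contains 0 since there \<open>cf\<close> is 1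
  and \<open>sf\<close> is 0.\<close>

lemma local_maximizer_gap_open:
  assumes m: "m \<ge> 1" and Vp: "Vp > 0" and max: "is_local_maximizer X Vp m V"
  shows "gap_left X m V < gap_right X m V"
proof (rule ccontr)
  define E where "E = gap_left X m V"
  assume "\<not> ?thesis"
  then have eq: "gap_right X m V = E" using gap_left_le_right[OF m] by (simp add: E_def)
  have E0: "E > 0" using gap_left_pos[OF m] by (simp add: E_def)
  have mm: "adv_max E = real m * pi" "adv_min E = real m * pi"
    using gap_left_edge[OF m] gap_right_edge[of m] eq by (simp_all add: E_def)
  have adv: "adv E t = real m * pi" for t using adv_le_max[of E t] adv_ge_min[of E t] mm by simp
  obtain R1 where R1: "R1 > 0" "edge_eigenfunction X m V E (\<lambda>x. R1 * sf (qE E) x)"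
    using edge_eigenfunction_exists[OF _ adv] mm by blast
  obtain R2 where R2: "R2 > 0" "edge_eigenfunction X m V E (\<lambda>x. R2 * cf (qE E) x)"
    using edge_eigenfunction_exists[OF _ adv] mm by blast
  note K = local_maximizer_bang_bang[OF m max, folded E_def, unfolded eq]
  define f where "f x = (R2 * cf (qE E) x)\<^sup>2 / E - (R1 * sf (qE E) x)\<^sup>2 / E" for x
  have "AE x in lebesgue. \<not> 0 < f x"
    using K[OF R1(2) R2(2)] K[OF R2(2) R1(2)]
    by eventually_elim (use Vp in \<open>auto simp: f_def\<close>)
  then have neg: "negligible {x. 0 < f x}"
    by (simp add: negligible_iff_null_sets completion.AE_iff_null_sets)
  have "continuous_on UNIV f"
    unfolding f_def using E0 by (intro continuous_intros solves_continuous[OF solves_sol[OF qE_bdd]]) auto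
  then have "open {x. 0 < f x}" by (intro open_Collect_less continuous_intros)
  moreover have "0 \<in> {x. 0 < f x}" using R2 E0 by (simp add: f_def qE_bdd)
  ultimately show False using neg open_not_negligible by blast
qed

text \<open>The switching function f = r^2 - p^2 factors as -(p + r)(p - r), and each factor has
  isolated zeros. Its zero set is therefore null and locally finite, and f keeps its sign between
  breakpoints.\<close>

lemma local_maximizer_piecewise_constant:
  assumes m: "m \<ge> 1" and Vp: "Vp > 0" and max: "is_local_maximizer X Vp m V"
  shows "piecewise_constant V" "AE x in lebesgue. V x = 0 \<or> V x = Vp"
proof -
  define \<alpha> where "\<alpha> = gap_left X m V"
  define \<beta> where "\<beta> = gap_right X m V"
  have ab: "0 < \<alpha>" "\<alpha> < \<beta>" using gap_left_pos[OF m] local_maximizer_gap_open[OF assms] by (simp_all add: \<alpha>_def \<beta>_def)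
  have ea: "adv_max \<alpha> = real m * pi" and eb: "adv_min \<beta> = real m * pi"
    using gap_left_edge[OF m] gap_right_edge[of m] by (simp_all add: \<alpha>_def \<beta>_def)
  obtain ta where "adv \<alpha> ta = real m * pi" using adv_max[of \<alpha>] ea by metis
  then obtain Ra where Ra: "Ra > 0" "edge_eigenfunction X m V \<alpha> (\<lambda>x. Ra * sol (qE \<alpha>) ta x)"
    using edge_eigenfunction_exists ea by blast
  obtain tb where "adv \<beta> tb = real m * pi" using adv_min[of \<beta>] eb by metis
  then obtain Rb where Rb: "Rb > 0" "edge_eigenfunction X m V \<beta> (\<lambda>x. Rb * sol (qE \<beta>) tb x)"
    using edge_eigenfunction_exists eb by blast
  \<comment> \<open>Dividing by the square root of the edge makes p^2 and r^2 the weighted squares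
    that the criterion compares.\<close>
  define p where "p x = Ra / sqrt \<alpha> * sol (qE \<alpha>) ta x" for x
  define r where "r x = Rb / sqrt \<beta> * sol (qE \<beta>) tb x" for x
  define f where "f x = (r x)\<^sup>2 - (p x)\<^sup>2" for x
  have sp: "solves (qE \<alpha>) p (\<lambda>x. Ra / sqrt \<alpha> * dsol (qE \<alpha>) ta x)"
    unfolding p_def by (rule solves_linear[OF bounded_linear_mult_right solves_sol[OF qE_bdd]])
  \<comment> \<open>The factor k is used with both signs, to treat p + r and p - r as sums of two
    solutions.\<close>
  have sr: "solves (qE \<beta>) (\<lambda>x. k * r x) (\<lambda>x. k * (Rb / sqrt \<beta> * dsol (qE \<beta>) tb x))" for k
    unfolding r_def by (intro solves_linear[OF bounded_linear_mult_right] solves_linear[OF bounded_linear_mult_right solves_sol[OF qE_bdd]])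
  obtain z where "sol (qE \<alpha>) ta z \<noteq> 0" using sol_nontrivial[OF qE_bdd X_pos] by blast
  then have pz: "p z \<noteq> 0" using Ra ab by (simp add: p_def)
  have K: "AE x in lebesgue. (0 < f x \<longrightarrow> V x = Vp) \<and> (f x < 0 \<longrightarrow> V x = 0)"
    using local_maximizer_bang_bang[OF m max Ra(2)[unfolded \<alpha>_def] Rb(2)[unfolded \<beta>_def], folded \<alpha>_def \<beta>_def]
    by eventually_elim (use ab in \<open>auto simp: f_def p_def r_def power_mult_distrib power_divide\<close>)
  define Z where "Z = {x. f x = 0}"
  have "\<forall>\<^sub>F y in at x. y \<notin> Z" for x
    using sum_isolated_zeros[OF sp sr[of 1] ab(2) pz, of x] sum_isolated_zeros[OF sp sr[of "-1"] ab(2) pz, of x]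
  proof eventually_elim
    case (elim y)
    have "f y = - ((p y + 1 * r y) * (p y + - 1 * r y))" by (simp add: f_def power2_eq_square algebra_simps)
    then show ?case using elim unfolding Z_def by (simp del: mult_1 mult_minus1)
  qed
  then have fin: "finite (Z \<inter> {a..b})" for a b by (rule finite_isolated)
  have "Z = (\<Union>n::nat. Z \<inter> {- real n..real n})"
  proof -
    have "\<exists>n::nat. x \<in> {- real n..real n}" for x
      using real_arch_simple[of "\<bar>x\<bar>"] by (auto simp: abs_le_iff minus_le_iff)
    then show ?thesis by blast
  qed
  also have "countable \<dots>" by (rule countable_UN) (auto intro: countable_finite fin)
  finally have "Z \<in> null_sets lebesgue" by (intro null_sets_completionI countable_imp_null_set_lborel)
  then have "AE x in lebesgue. x \<notin> Z"
    by (simp add: completion.AE_iff_null_sets)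
  with K show "AE x in lebesgue. V x = 0 \<or> V x = Vp"
    by eventually_elim (auto simp: Z_def)
  have fc: "continuous_on S f" for S
    unfolding f_def using solves_continuous(1)[OF sr[of 1]] by (intro continuous_intros solves_continuous(1)[OF sp]) simp
  show "piecewise_constant V"
    unfolding piecewise_constant_def
  proof (intro exI[of _ Z] conjI allI impI fin)
    fix a b assume ab: "Z \<inter> {a<..<b} = {}"
    have nz: "f x \<noteq> 0" if "x \<in> {a<..<b}" for x using that ab by (auto simp: Z_def)
    have "\<exists>s\<in>{-1, 1}. \<forall>x\<in>{a<..<b}. 0 < s * f x"
    proof (rule ccontr)
      assume "\<not> ?thesis"
      then obtain x y where xy: "x \<in> {a<..<b}" "y \<in> {a<..<b}" "f x \<ge> 0" "f y \<le> 0" by (auto simp: not_less)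
      have "\<exists>z\<in>{a<..<b}. f z = 0"
      proof (cases "x \<le> y")
        case True
        then show ?thesis using IVT2'[of f y 0 x] xy fc by force
      next
        case False
        then show ?thesis using IVT'[of f y 0 x] xy fc by force
      qed
      then show False using nz by blast
    qed
    then consider "\<forall>x\<in>{a<..<b}. 0 < f x" | "\<forall>x\<in>{a<..<b}. f x < 0" by auto
    then show "\<exists>c. AE x in lebesgue. x \<in> {a<..<b} \<longrightarrow> V x = c"
    proof cases
      case 1
      from K have "AE x in lebesgue. x \<in> {a<..<b} \<longrightarrow> V x = Vp"
        by eventually_elim (use 1 in auto)
      then show ?thesis by blast
    next
      case 2
      from K have "AE x in lebesgue. x \<in> {a<..<b} \<longrightarrow> V x = 0"
        by eventually_elim (use 2 in auto)
      then show ?thesis by blast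
    qed
  qed
qed

end

lemma piecewise_constant_AE_cong:
  assumes "AE x in lebesgue. V x = V' x" "piecewise_constant V'"
  shows "piecewise_constant V"
  using assms(2) AE_cong_iff[OF assms(1), of "\<lambda>x v. x \<in> {_<..<_} \<longrightarrow> v = _"]
  unfolding piecewise_constant_def by (simp only:)

theorem theorem2p3:
  fixes X Vp :: real and m :: nat
  assumes "X > 0" and "Vp > 0" and "m \<ge> 1"
  shows "(\<forall>V. is_maximizer X Vp m V \<longrightarrow>
            piecewise_constant V \<and> (AE x in lebesgue. V x = 0 \<or> V x = Vp))
       \<and> (\<forall>V \<psi>\<alpha> \<psi>\<beta>.
            is_local_maximizer X Vp m V
          \<and> gap_left X m V \<noteq> gap_right X m V
          \<and> edge_eigenfunction X m V (gap_left X m V) \<psi>\<alpha>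
          \<and> edge_eigenfunction X m V (gap_right X m V) \<psi>\<beta> \<longrightarrow>
            (AE x in lebesgue.
               ((\<psi>\<alpha> x)\<^sup>2 / gap_left X m V < (\<psi>\<beta> x)\<^sup>2 / gap_right X m V \<longrightarrow> V x = Vp)
             \<and> ((\<psi>\<alpha> x)\<^sup>2 / gap_left X m V > (\<psi>\<beta> x)\<^sup>2 / gap_right X m V \<longrightarrow> V x = 0)))"
proof (intro conjI allI impI)
  fix V assume max: "is_maximizer X Vp m V"
  then have loc: "is_local_maximizer X Vp m V"
    unfolding is_maximizer_def is_local_maximizer_def by (auto intro: exI[of _ 1])
  have "V \<in> admissible X Vp" using max by (simp add: is_maximizer_def)
  then obtain V' where V': "periodic_potential X Vp V'" "AE x in lebesgue. V x = V' x"
    using admissible_normalize assms(1,2) by blast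
  interpret periodic_potential X Vp V' by (rule V'(1))
  note loc' = is_local_maximizer_AE_cong[OF V'(2,1) loc]
  show "piecewise_constant V"
    by (rule piecewise_constant_AE_cong[OF V'(2) local_maximizer_piecewise_constant(1)[OF assms(3,2) loc']])
  show "AE x in lebesgue. V x = 0 \<or> V x = Vp"
    using local_maximizer_piecewise_constant(2)[OF assms(3,2) loc'] V'(2) by eventually_elim simp
next
  fix V \<psi>\<alpha> \<psi>\<beta>
  assume *: "is_local_maximizer X Vp m V
          \<and> gap_left X m V \<noteq> gap_right X m V
          \<and> edge_eigenfunction X m V (gap_left X m V) \<psi>\<alpha>
          \<and> edge_eigenfunction X m V (gap_right X m V) \<psi>\<beta>"
  then have "V \<in> admissible X Vp" by (simp add: is_local_maximizer_def)
  then obtain V' where V': "periodic_potential X Vp V'" "AE x in lebesgue. V x = V' x"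
    using admissible_normalize assms(1,2) by blast
  interpret periodic_potential X Vp V' by (rule V'(1))
  have loc': "is_local_maximizer X Vp m V'" using is_local_maximizer_AE_cong[OF V'(2,1)] * by blast
  have "edge_eigenfunction X m V' (gap_left X m V') \<psi>\<alpha>" "edge_eigenfunction X m V' (gap_right X m V') \<psi>\<beta>"
    using * unfolding edge_eigenfunction_AE_cong[OF V'(2)] gap_edges_AE_cong[OF V'(2)] by blast+
  from local_maximizer_bang_bang[OF assms(3) loc' this] V'(2)
  show "AE x in lebesgue.
               ((\<psi>\<alpha> x)\<^sup>2 / gap_left X m V < (\<psi>\<beta> x)\<^sup>2 / gap_right X m V \<longrightarrow> V x = Vp)
             \<and> ((\<psi>\<alpha> x)\<^sup>2 / gap_left X m V > (\<psi>\<beta> x)\<^sup>2 / gap_right X m V \<longrightarrow> V x = 0)"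
    unfolding gap_edges_AE_cong[OF V'(2)] by eventually_elim simp
qed

end
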